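(* Assume that $\mathcal{X}\subset\mathbb{R}^d$ is bounded and convex, and that one of the following two conditions holds. (i) The distribution of $X$ admits a Lebesgue density $p_X$ which is bounded on $\mathcal{X}$ from below by a constant $\underline{p}_X>0$ and from above by a constant $\bar p_X<\infty$, and $Q$ has finite support, putting mass only on points $t_1<\dots<t_p$. (ii) For all $y\in\mathrm{supp}(\mathbb{P}^Y)$, the distribution of $X$ conditional on $Y=y$ admits a Lebesgue density bounded on $\mathcal{X}$ from below by $\underline{p}_X>0$ and from above by $\bar p_X<\infty$, with constants not depending on $y$; and $Q$ has support in a compact interval $[a,b]$ and admits a Lebesgue density $q$ bounded from above by a constant $c<\infty$. Then, as $n\to\infty$, $$\left(\int_{\mathbb{R}}\int_{\mathcal{X}}\bigl(\hat F_n(\hat\alpha_n^{\top}x,t)-F_0(\alpha_0^{\top}x,t)\bigr)^2\,d\mathbb{P}^X(x)\,dQ(t)\right)^{1/2}=O_p(n^{-1/3}).$$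
   Context: Model. $(X,Y)$ has joint distribution $\mathbb{P}$, with $X$ taking values in $\mathcal{X}\subseteq\mathbb{R}^d$ and $Y$ real-valued; $\mathbb{P}^X,\mathbb{P}^Y$ are the marginals and $\mathrm{supp}$ denotes the support of a measure. Let $\mathcal{S}_{d-1}=\{x\in\mathbb{R}^d:\|x\|=1\}$ (Euclidean norm) and, for $\alpha\in\mathcal{S}_{d-1}$, $\mathcal{C}_\alpha=\{\alpha^{\top}x: x\in\mathcal{X}\}$. Let $\mathcal{F}_\alpha$ be the class of functions $F:\mathcal{C}_\alpha\times\mathbb{R}\to[0,1]$ such that $y\mapsto F(z,y)$ is a cumulative distribution function (CDF) for every fixed $z$ and $z\mapsto F(z,y)$ is non-increasing for every fixed $y$. Let $\mathcal{F}=\{(F,\alpha):\alpha\in\mathcal{S}_{d-1},\,F\in\mathcal{F}_\alpha\}$. The distributional single index model holds: there is $(F_0,\alpha_0)\in\mathcal{F}$ with $\mathbb{P}(Y\le y\mid X=x)=F_0(\alpha_0^{\top}x,y)$ for all $y\in\mathbb{R}$, $x\in\mathcal{X}$. The observations $(X_1,Y_1),\dots,(X_n,Y_n)$ are i.i.d. copies of $(X,Y)$. Estimator. $Q$ is a fixed finite Borel measure on $\mathbb{R}$ and $$L_n(Q;F,\alpha)=\frac1n\sum_{i=1}^n\int_{\mathbb{R}}\bigl(1\{Y_i\le t\}-F(\alpha^{\top}X_i,t)\bigr)^2\,dQ(t).$$ $(\hat F_n,\hat\alpha_n)$ is a minimizer of $L_n(Q;\cdot,\cdot)$ over $\mathcal{F}$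 (minimizers exist but are not unique), chosen with $\hat\alpha_n^{\top}X_i\ne\hat\alpha_n^{\top}X_j$ for $i\neq j$. For fixed $\alpha$, with $z_1<\dots<z_m$ the distinct values of $\alpha^{\top}X_1,\dots,\alpha^{\top}X_n$ and multiplicities $n_1,\dots,n_m$, the minimizer in $F$ is uniquely determined on $\{z_1,\dots,z_m\}\times\mathrm{supp}(Q)$ and given by $$\hat F_{n,\alpha}(z_i,y)=\min_{k=1,\dots,i}\ \max_{l=i,\dots,m}\ \frac{1}{n_k+\dots+n_l}\sum_{j=k}^{l}\ \sum_{s:\,\alpha^{\top}X_s=z_j}1\{Y_s\le y\},$$ and $\hat F_n=\hat F_{n,\hat\alpha_n}$. Outside $\{\hat\alpha_n^{\top}X_1,\dots,\hat\alpha_n^{\top}X_n\}\times\mathrm{supp}(Q)$, $\hat F_n$ is extended to $\mathbb{R}\times\mathbb{R}$ by any interpolation that keeps it non-increasing in the first argument and a CDF in the second argument. *)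

theory Defs
  imports "HOL-Probability.Probability"
begin

definition msupport :: "'a::topological_space measure \<Rightarrow> 'a set" where
  "msupport \<mu> = {x. \<forall>U. open U \<longrightarrow> x \<in> U \<longrightarrow> emeasure \<mu> U > 0}"

text \<open>\<open>\<kappa>\<close> is a (regular) version of the conditional distribution of \<open>f\<close> given \<open>g\<close> under \<open>P\<close>:
  a Markov kernel that disintegrates the joint law of \<open>(f, g)\<close>. Such a version is unique only up to
  null sets of the law of \<open>g\<close>.\<close>

definition is_cond_distr ::
  "'a measure \<Rightarrow> ('a \<Rightarrow> 'b::topological_space) \<Rightarrow> ('a \<Rightarrow> 'c::topological_space) \<Rightarrow> ('c \<Rightarrow> 'b measure) \<Rightarrow> bool"
where
  "is_cond_distr P f g \<kappa> \<longleftrightarrow>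
     \<kappa> \<in> borel \<rightarrow>\<^sub>M prob_algebra borel \<and>
     (\<forall>A\<in>sets borel. \<forall>B\<in>sets borel.
        emeasure P {p \<in> space P. f p \<in> A \<and> g p \<in> B} =
        (\<integral>\<^sup>+y\<in>B. emeasure (\<kappa> y) A \<partial>distr P borel g))"

text \<open>The density itself is not required to vanish off \<open>S\<close>; only its values on \<open>S\<close> are bounded.\<close>

definition has_bounded_density ::
  "'a::euclidean_space measure \<Rightarrow> 'a set \<Rightarrow> real \<Rightarrow> real \<Rightarrow> bool"
where
  "has_bounded_density \<mu> S lo hi \<longleftrightarrow>
     (\<exists>f\<in>borel_measurable borel.
        \<mu> = density lborel (\<lambda>x. ennreal (f x)) \<and> (\<forall>x\<in>S. lo \<le> f x \<and> f x \<le> hi))"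

text \<open>Stochastic boundedness at rate \<open>r\<close>. The event is controlled through a measurable superset, that
  is, in outer probability; for measurable \<open>Z n\<close> this is the usual notion.\<close>

definition bigO_in_prob :: "'w measure \<Rightarrow> (nat \<Rightarrow> 'w \<Rightarrow> real) \<Rightarrow> (nat \<Rightarrow> real) \<Rightarrow> bool" where
  "bigO_in_prob M Z r \<longleftrightarrow>
     (\<forall>\<epsilon>>0. \<exists>K>0. \<forall>\<^sub>F n in sequentially.
        \<exists>A\<in>sets M. measure M A \<le> \<epsilon> \<and> {\<omega> \<in> space M. \<bar>Z n \<omega>\<bar> > K * r n} \<subseteq> A)"

definition is_cdf :: "(real \<Rightarrow> real) \<Rightarrow> bool" where
  "is_cdf G \<longleftrightarrow> (\<exists>D. real_distribution D \<and> G = cdf D)"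

text \<open>Functions on \<open>C \<times> \<real>\<close> are represented by total functions that are unconstrained off \<open>C\<close>. The
  values on \<open>C \<times> \<real>\<close> lie in \<open>[0, 1]\<close> because each \<open>F z\<close> is a distribution function.\<close>

definition antitone_cdfs :: "real set \<Rightarrow> (real \<Rightarrow> real \<Rightarrow> real) set" where
  "antitone_cdfs C = {F. (\<forall>z\<in>C. is_cdf (F z)) \<and> (\<forall>y. antimono_on C (\<lambda>z. F z y))}"

definition index_class ::
  "(real ^ 'd) set \<Rightarrow> ((real \<Rightarrow> real \<Rightarrow> real) \<times> (real ^ 'd)) set"
where
  "index_class S =
     {(F, \<alpha>). \<alpha> \<in> sphere 0 1 \<and> F \<in> antitone_cdfs ((\<lambda>x. \<alpha> \<bullet> x) ` S)}"

definition index_loss ::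
  "real measure \<Rightarrow> nat \<Rightarrow> (nat \<Rightarrow> real ^ 'd) \<Rightarrow> (nat \<Rightarrow> real) \<Rightarrow>
   (real \<Rightarrow> real \<Rightarrow> real) \<Rightarrow> real ^ 'd \<Rightarrow> real"
where
  "index_loss Q n x y F \<alpha> =
     1 / real n * (\<Sum>i<n. LINT t|Q. (of_bool (y i \<le> t) - F (\<alpha> \<bullet> x i) t)\<^sup>2)"

text \<open>Distinct values of the index in increasing order, positions starting at \<open>0\<close>.\<close>

definition index_values :: "nat \<Rightarrow> (nat \<Rightarrow> real ^ 'd) \<Rightarrow> real ^ 'd \<Rightarrow> real list" where
  "index_values n x \<alpha> = sorted_list_of_set ((\<lambda>s. \<alpha> \<bullet> x s) ` {..<n})"

definition min_max_fit ::
  "nat \<Rightarrow> (nat \<Rightarrow> real ^ 'd) \<Rightarrow> (nat \<Rightarrow> real) \<Rightarrow> real ^ 'd \<Rightarrow> nat \<Rightarrow> real \<Rightarrow> real"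
where
  "min_max_fit n x y \<alpha> i t =
     (let z = index_values n x \<alpha>; m = length z;
          I = (\<lambda>j. {s. s < n \<and> \<alpha> \<bullet> x s = z ! j})
      in MIN k\<in>{..i}. MAX l\<in>{i..<m}.
           (\<Sum>j=k..l. \<Sum>s\<in>I j. of_bool (y s \<le> t)) / real (\<Sum>j=k..l. card (I j)))"

text \<open>\<open>(F, \<alpha>)\<close> is an admissible estimate from the sample \<open>(x 0, y 0), \<dots>, (x (n - 1), y (n - 1))\<close>. The
  last conjunct says that \<open>F\<close> is extended to all of \<open>\<real> \<times> \<real>\<close>; the extension is otherwise arbitrary.\<close>

definition is_index_estimate ::
  "real measure \<Rightarrow> (real ^ 'd) set \<Rightarrow> nat \<Rightarrow> (nat \<Rightarrow> real ^ 'd) \<Rightarrow> (nat \<Rightarrow> real) \<Rightarrow>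
   (real \<Rightarrow> real \<Rightarrow> real) \<Rightarrow> real ^ 'd \<Rightarrow> bool"
where
  "is_index_estimate Q S n x y F \<alpha> \<longleftrightarrow>
     (F, \<alpha>) \<in> index_class S \<and>
     (\<forall>(G, \<beta>)\<in>index_class S. index_loss Q n x y F \<alpha> \<le> index_loss Q n x y G \<beta>) \<and>
     inj_on (\<lambda>i. \<alpha> \<bullet> x i) {..<n} \<and>
     (\<forall>i<length (index_values n x \<alpha>). \<forall>t\<in>msupport Q.
        F (index_values n x \<alpha> ! i) t = min_max_fit n x y \<alpha> i t) \<and>
     F \<in> antitone_cdfs UNIV"

text \<open>In the next two definitions \<open>P\<close> is the law of \<open>(X, Y)\<close>, so \<open>fst\<close> is the covariate and \<open>snd\<close>
  the response.\<close>

definition discrete_weight_condition ::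
  "((real ^ 'd) \<times> real) measure \<Rightarrow> (real ^ 'd) set \<Rightarrow> real measure \<Rightarrow> bool"
where
  "discrete_weight_condition P S Q \<longleftrightarrow>
     (\<exists>lo>0. \<exists>hi. has_bounded_density (distr P borel fst) S lo hi) \<and>
     (\<exists>T. finite T \<and> emeasure Q (- T) = 0)"

definition continuous_weight_condition ::
  "((real ^ 'd) \<times> real) measure \<Rightarrow> (real ^ 'd) set \<Rightarrow> real measure \<Rightarrow> bool"
where
  "continuous_weight_condition P S Q \<longleftrightarrow>
     (\<exists>\<kappa>. is_cond_distr P fst snd \<kappa> \<and>
        (\<exists>lo>0. \<exists>hi. \<forall>y\<in>msupport (distr P borel snd). has_bounded_density (\<kappa> y) S lo hi)) \<and>
     (\<exists>a b. msupport Q \<subseteq> {a..b}) \<and>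
     (\<exists>c. \<exists>q\<in>borel_measurable borel.
        Q = density lborel (\<lambda>t. ennreal (q t)) \<and> (\<forall>t. 0 \<le> q t \<and> q t \<le> c))"

text \<open>The nonnegative integral is used so that \<open>S\<close> need not be Borel and the values of \<open>F0\<close> at indices
  outside the range over \<open>S\<close> are immaterial. For distribution functions and a finite \<open>Q\<close> it is finite,
  so \<open>enn2real\<close> loses nothing.\<close>

definition L2_error ::
  "((real ^ 'd) \<times> real) measure \<Rightarrow> (real ^ 'd) set \<Rightarrow> real measure \<Rightarrow>
   (real \<Rightarrow> real \<Rightarrow> real) \<Rightarrow> real ^ 'd \<Rightarrow> (real \<Rightarrow> real \<Rightarrow> real) \<Rightarrow> real ^ 'd \<Rightarrow> real"
where
  "L2_error P S Q F \<alpha> F0 \<alpha>0 =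
     sqrt (enn2real (\<integral>\<^sup>+t. (\<integral>\<^sup>+x\<in>S. ennreal ((F (\<alpha> \<bullet> x) t - F0 (\<alpha>0 \<bullet> x) t)\<^sup>2)
       \<partial>distr P borel fst) \<partial>Q))"

end

theory Submission
  imports Defs
begin

text \<open>Fix a threshold \<open>t\<close>. The function \<open>x \<mapsto> F0 (\<alpha>0 \<bullet> x) t\<close> is the regression function of the indicator
\<open>of_bool (Y \<le> t)\<close> on \<open>X\<close>, and the loss of an estimate is the integral over \<open>t\<close> of the empirical
squared error in this regression. Because the estimate does not lose against the truth, its
population excess risk, which is the squared \<open>L2\<close> error, is at most an empirical process
evaluated at the estimate. The process is controlled for each \<open>t\<close> separately, after a fraction of
the error is subtracted from it: the bound needed is that
\<open>sup\<^sub>v ((P - P\<^sub>n) \<phi>(v) - \<parallel>v - g\<parallel>\<^sup>2 / 4)\<close> has expectation \<open>O(n powr (- 2/3))\<close>, where \<open>v\<close> ranges over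
antitone functions of a linear form, \<open>g\<close> is the regression function and \<open>\<phi>(v)\<close> is a Lipschitz
function of \<open>v\<close> that vanishes at \<open>g\<close>. The supremum is nonnegative, so expectations can be
integrated over \<open>t\<close>, and Markov's inequality gives the rate. The quadratic offset takes the place of
an argument that peels the class into shells around \<open>g\<close>.

The supremum is over an infinite class, and its measurability would be a problem. It is avoided by
a finite class of step functions of \<open>a \<bullet> x\<close>, with \<open>a\<close> in a grid of polynomially many directions
(\<open>ridge_bracket\<close>): every antitone function of \<open>\<alpha> \<bullet> x\<close> with values in the unit interval lies
between two members whose distance in \<open>L1(P)\<close> is \<open>O(1/n)\<close>. This is where the density of \<open>X\<close> is
needed: shifting the argument of an antitone function with values in the unit interval by \<open>s\<close> changes
its integral over a ball only by the volume of a shell of width proportional to \<open>s\<close>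
(\<open>ridge_shift_integral_le\<close>). For each \<open>y\<close>, the loss \<open>(s - of_bool (y \<le> t))\<^sup>2\<close> is monotone in \<open>s\<close> on
the unit interval, so the two bracketing functions bound the
empirical loss of the estimate (\<open>squeezed_error_le\<close>).

For the finite class, a symmetrization that keeps the offset (\<open>offset_symmetrization\<close>) reduces the
expectation to Rademacher averages for a fixed sample. On a sample, a direction acts only through
the order in which it arranges the points, and antitone sequences of length \<open>n\<close> have, for every
\<open>m\<close>, a net with at most \<open>2 ^ (5 * m + 1)\<close> elements at root mean square distance \<open>2 / m\<close>
(\<open>card_antitone_net\<close>, \<open>antitone_net_approx\<close>). Such entropy is small enough for chaining: a level
with net parameter \<open>m\<close> contributes a constant times \<open>1 / sqrt (m * n)\<close>, and these contributions are
summable. The chain starts at \<open>m \<approx> n powr (1/3)\<close>, where the offset absorbs the fluctuation of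
the top net, so that the whole bound is \<open>O(n powr (- 2/3))\<close> (\<open>offset_rademacher_bound\<close>). The
polynomially many directions add only \<open>O(log n)\<close> to an entropy of order \<open>n powr (1/3)\<close>.\<close>

section \<open>Covering numbers of antitone sequences\<close>

definition antitone_lists :: "nat \<Rightarrow> nat \<Rightarrow> nat list set" where
  "antitone_lists N m = {xs. length xs = N \<and> set xs \<subseteq> {..m} \<and> sorted_wrt (\<ge>) xs}"

lemma antitone_lists_0: "antitone_lists 0 m = {[]}"
  by (auto simp: antitone_lists_def)

lemma antitone_lists_Suc_0: "antitone_lists N 0 \<subseteq> {replicate N 0}"
proof
  fix xs assume "xs \<in> antitone_lists N 0"
  then have "length xs = N" "\<forall>x\<in>set xs. x = 0" by (auto simp: antitone_lists_def)
  then show "xs \<in> {replicate N 0}" by (simp add: replicate_eqI)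
qed

lemma antitone_lists_Suc_Suc:
  "antitone_lists (Suc N) (Suc m) \<subseteq>
     antitone_lists (Suc N) m \<union> (#) (Suc m) ` antitone_lists N (Suc m)"
proof
  fix xs assume xs: "xs \<in> antitone_lists (Suc N) (Suc m)"
  then obtain a ys where [simp]: "xs = a # ys"
    by (auto simp: antitone_lists_def length_Suc_conv)
  show "xs \<in> antitone_lists (Suc N) m \<union> (#) (Suc m) ` antitone_lists N (Suc m)"
  proof (cases "a = Suc m")
    case True
    then show ?thesis using xs by (auto simp: antitone_lists_def)
  next
    case False
    then have "a \<le> m" using xs by (auto simp: antitone_lists_def)
    moreover have "\<forall>y\<in>set ys. y \<le> a" using xs by (auto simp: antitone_lists_def)
    ultimately have "set ys \<subseteq> {..m}" by force
    then show ?thesis using xs \<open>a \<le> m\<close> by (auto simp: antitone_lists_def)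
  qed
qed

text \<open>The bound is that of a Pascal-type recursion: either the first entry is \<open>m\<close> and the rest is a
shorter list, or all entries are at most \<open>m - 1\<close>.\<close>

lemma card_antitone_lists: "finite (antitone_lists N m) \<and> card (antitone_lists N m) \<le> 2 ^ (N + m)"
proof (induction N arbitrary: m)
  case 0
  then show ?case by (simp add: antitone_lists_0)
next
  case (Suc N)
  note IHN = Suc.IH
  show ?case
  proof (induction m)
    case 0
    have "card (antitone_lists (Suc N) 0) \<le> card {replicate (Suc N) (0::nat)}"
      by (rule card_mono[OF _ antitone_lists_Suc_0]) simp
    also have "\<dots> \<le> 2 ^ (Suc N + 0)" by simp
    finally show ?case using finite_subset[OF antitone_lists_Suc_0] by blast
  next
    case (Suc m)
    let ?A = "antitone_lists (Suc N) m" and ?B = "(#) (Suc m) ` antitone_lists N (Suc m)"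
    have fin: "finite (?A \<union> ?B)" using Suc IHN by simp
    have "card (antitone_lists (Suc N) (Suc m)) \<le> card (?A \<union> ?B)"
      by (rule card_mono[OF fin antitone_lists_Suc_Suc])
    also have "\<dots> \<le> card ?A + card ?B" by (rule card_Un_le)
    also have "card ?B \<le> card (antitone_lists N (Suc m))"
      by (rule card_image_le) (use IHN in simp)
    also have "card ?A + card (antitone_lists N (Suc m)) \<le> 2 ^ (Suc N + m) + 2 ^ (N + Suc m)"
      using conjunct2[OF Suc.IH] conjunct2[OF IHN[of "Suc m"]] by (intro add_mono)
    also have "\<dots> = 2 ^ (Suc N + Suc m)" by simp
    finally show ?case using finite_subset[OF antitone_lists_Suc_Suc fin] by simp
  qed
qed

lemma antitone_lists_nth:
  assumes "xs \<in> antitone_lists N m" "i \<le> j" "j < N"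
  shows "xs ! j \<le> xs ! i" "xs ! i \<le> m"
proof -
  show "xs ! i \<le> m" using assms by (auto simp: antitone_lists_def subset_eq)
  show "xs ! j \<le> xs ! i"
    using assms sorted_wrt_iff_nth_less[of "(\<ge>)" xs] by (cases "i = j") (auto simp: antitone_lists_def)
qed

text \<open>The value is \<open>n\<close> if \<open>q\<close> does not reach \<open>j\<close> before \<open>n\<close>. Sequences are extended by \<open>0\<close> from \<open>n\<close> on,
so that they are antitone and read \<open>0\<close> there.\<close>

definition first_at :: "nat \<Rightarrow> (nat \<Rightarrow> nat) \<Rightarrow> nat \<Rightarrow> nat" where
  "first_at n q j = (LEAST r. n \<le> r \<or> j \<le> q r)"

lemma first_at_prop: "n \<le> first_at n q j \<or> j \<le> q (first_at n q j)"
  unfolding first_at_def by (rule LeastI[of _ n]) simp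

lemma first_at_le: "n \<le> r \<or> j \<le> q r \<Longrightarrow> first_at n q j \<le> r"
  unfolding first_at_def by (rule Least_le)

lemma first_at_mono: "i \<le> j \<Longrightarrow> first_at n q i \<le> first_at n q j"
  using first_at_prop[of n q j] by (intro first_at_le) auto

lemma less_first_at_Suc:
  assumes "mono_on {..<n} q" "r < n"
  shows "r < first_at n q (Suc (q r))"
proof (rule ccontr)
  assume *: "\<not> ?thesis"
  let ?f = "first_at n q (Suc (q r))"
  have "?f < n" using * assms by simp
  then have "q ?f \<le> q r" using * assms by (intro mono_onD[OF assms(1)]) auto
  then show False using first_at_prop[of n q "Suc (q r)"] \<open>?f < n\<close> by simp
qed

lemma first_at_self:
  assumes "mono_on {..<n} q" "r < n"
  shows "first_at n q (q r) \<le> r" "q (first_at n q (q r)) = q r"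
proof -
  show le: "first_at n q (q r) \<le> r" by (rule first_at_le) simp
  then have "q (first_at n q (q r)) \<le> q r" using assms by (intro mono_onD[OF assms(1)]) auto
  then show "q (first_at n q (q r)) = q r"
    using first_at_prop[of n q "q r"] le assms by simp
qed

lemma antitone_code:
  assumes "antimono h" "\<And>r. h r \<le> m"
  shows "map (\<lambda>j. h (first_at n q j)) [0..<N] \<in> antitone_lists N m"
  using assms by (auto simp: antitone_lists_def sorted_wrt_iff_nth_less
      intro!: antimonoD[OF assms(1)] first_at_mono)

text \<open>An adaptive partition of \<open>{..<n}\<close>. There are \<open>m\<close> cells of nearly equal length. If \<open>p\<close> lists the values
of a sequence at the beginnings of the cells, then a cell over which it drops by \<open>j\<close> is divided into
\<open>j + 1\<close> equal subcells, so that steep parts are resolved better while the number of subcells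
stays at most \<open>2 * m\<close> for values in \<open>{..m}\<close>. Subcells are numbered consecutively: by telescoping,
\<open>(p ! 0 - p ! c) + c\<close> of them lie before cell \<open>c\<close>.\<close>

definition cell_of :: "nat \<Rightarrow> nat \<Rightarrow> nat \<Rightarrow> nat" where
  "cell_of n m r = r * m div n"

definition subcell_index :: "nat \<Rightarrow> nat \<Rightarrow> nat list \<Rightarrow> nat \<Rightarrow> nat" where
  "subcell_index n m p r =
     (let c = cell_of n m r
      in (p ! 0 - p ! c) + c + (p ! c - p ! Suc c + 1) * (r * m mod n) div n)"

text \<open>The rounded values \<open>p\<close> at the beginnings of the cells determine the partition into subcells, and \<open>s\<close>
gives the rounded value on each subcell. Two lists of length \<open>O(m)\<close> with entries in \<open>{..m}\<close> carry
only \<open>O(m)\<close> bits, whereas recording arbitrary positions of jumps would cost a logarithmic factor,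
which would appear in the rate.\<close>

definition antitone_net :: "nat \<Rightarrow> nat \<Rightarrow> (nat \<Rightarrow> real) set" where
  "antitone_net n m =
     (\<lambda>(p, s). \<lambda>r. real (s ! subcell_index n m p r) / real m) `
       (antitone_lists (Suc m) m \<times> antitone_lists (2 * m) m)"

lemma finite_antitone_net: "finite (antitone_net n m)"
  by (simp add: antitone_net_def card_antitone_lists)

lemma card_antitone_net: "card (antitone_net n m) \<le> 2 ^ (5 * m + 1)"
proof -
  have "card (antitone_net n m) \<le> card (antitone_lists (Suc m) m \<times> antitone_lists (2 * m) m)"
    unfolding antitone_net_def by (rule card_image_le) (simp add: card_antitone_lists)
  also have "\<dots> \<le> 2 ^ (Suc m + m) * 2 ^ (2 * m + m)"
    unfolding card_cartesian_product
    by (intro mult_mono conjunct2[OF card_antitone_lists]) auto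
  also have "\<dots> = 2 ^ (5 * m + 1)" by (simp flip: power_add)
  finally show ?thesis .
qed

context
  fixes n m :: nat and p :: "nat list"
  assumes n: "0 < n" and m: "0 < m" and p: "p \<in> antitone_lists (Suc m) m"
begin

lemma cell_of_less: "r < n \<Longrightarrow> cell_of n m r < m"
  unfolding cell_of_def using n m by (simp add: less_mult_imp_div_less mult.commute)

lemma cell_of_mono: "r \<le> r' \<Longrightarrow> cell_of n m r \<le> cell_of n m r'"
  unfolding cell_of_def by (simp add: div_le_mono)

lemma subcell_offset_less: "(p ! c - p ! Suc c + 1) * (r * m mod n) div n < p ! c - p ! Suc c + 1"
  by (intro less_mult_imp_div_less mult_strict_left_mono) (use n in auto)

lemma subcell_index_less_cell:
  assumes "r < n" "r' < n" "cell_of n m r < cell_of n m r'"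
  shows "subcell_index n m p r < subcell_index n m p r'"
proof -
  let ?c = "cell_of n m r" and ?c' = "cell_of n m r'"
  have c': "?c' < m" by (rule cell_of_less[OF assms(2)])
  have "p ! ?c \<le> p ! 0" "p ! Suc ?c \<le> p ! ?c" "p ! ?c' \<le> p ! Suc ?c"
    using c' assms(3) by (auto intro!: antitone_lists_nth[OF p])
  then show ?thesis
    using subcell_offset_less[of ?c r] assms(3) by (simp add: subcell_index_def Let_def)
qed

lemma mod_mono_in_cell:
  assumes "r \<le> r'" "cell_of n m r = cell_of n m r'"
  shows "r' * m mod n = r * m mod n + (r' - r) * m"
proof -
  have "r' * m = r * m + (r' - r) * m" using assms(1) by (simp flip: add_mult_distrib)
  moreover have "r' * m = cell_of n m r * n + r' * m mod n"
    unfolding assms(2) unfolding cell_of_def by (rule div_mult_mod_eq[symmetric])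
  moreover have "r * m = cell_of n m r * n + r * m mod n"
    unfolding cell_of_def by (rule div_mult_mod_eq[symmetric])
  ultimately show ?thesis by linarith
qed

lemma subcell_index_mono: "mono_on {..<n} (subcell_index n m p)"
proof (rule mono_onI)
  fix r r' assume r: "r \<in> {..<n}" "r' \<in> {..<n}" "r \<le> r'"
  show "subcell_index n m p r \<le> subcell_index n m p r'"
  proof (cases "cell_of n m r = cell_of n m r'")
    case True
    then have "r * m mod n \<le> r' * m mod n" by (simp add: mod_mono_in_cell[OF r(3) True])
    then show ?thesis unfolding subcell_index_def Let_def True
      by (intro add_left_mono div_le_mono mult_le_mono2)
  next
    case False
    then have "cell_of n m r < cell_of n m r'" using cell_of_mono[OF r(3)] by simp
    then show ?thesis using subcell_index_less_cell r by (simp add: less_imp_le)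
  qed
qed

lemma same_subcell_same_cell:
  assumes "r < n" "r' < n" "subcell_index n m p r = subcell_index n m p r'"
  shows "cell_of n m r = cell_of n m r'"
proof (cases "cell_of n m r" "cell_of n m r'" rule: linorder_cases)
  case less
  then show ?thesis using subcell_index_less_cell[OF assms(1,2)] assms(3) by simp
next
  case greater
  then show ?thesis using subcell_index_less_cell[OF assms(2,1)] assms(3) by simp
qed

lemma subcell_index_less: "r < n \<Longrightarrow> subcell_index n m p r < 2 * m"
proof -
  assume "r < n"
  let ?c = "cell_of n m r"
  have c: "?c < m" by (rule cell_of_less) fact
  have "p ! ?c \<le> p ! 0" "p ! Suc ?c \<le> p ! ?c" "p ! 0 \<le> m"
    using c by (auto intro!: antitone_lists_nth[OF p])
  then show ?thesis
    using subcell_offset_less[of ?c r] c by (simp add: subcell_index_def Let_def)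
qed

lemma subcell_length:
  assumes "r \<le> r'" "r' < n" "subcell_index n m p r = subcell_index n m p r'"
    and c_def: "c = cell_of n m r"
  shows "(p ! c - p ! Suc c + 1) * m * (r' - r) < n"
proof -
  have c: "cell_of n m r = cell_of n m r'"
    by (rule same_subcell_same_cell) (use assms(1-3) in auto)
  let ?J = "p ! c - p ! Suc c + 1"
  have 1: "?J * (r' * m mod n) div n = ?J * (r * m mod n) div n"
    using assms(3) unfolding subcell_index_def Let_def c_def c by (simp only: add_left_cancel)
  have 2: "?J * (r' * m mod n) = ?J * (r * m mod n) + ?J * m * (r' - r)"
    unfolding mod_mono_in_cell[OF assms(1) c] by (simp add: algebra_simps)
  have "?J * (r' * m mod n) < n + ?J * (r' * m mod n) div n * n"
    by (rule dividend_less_div_times[OF n])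
  then have "?J * (r * m mod n) + ?J * m * (r' - r) < n + ?J * (r * m mod n) div n * n"
    unfolding 1 unfolding 2 .
  moreover have "?J * (r * m mod n) div n * n \<le> ?J * (r * m mod n)" by (rule div_times_less_eq_dividend)
  ultimately show ?thesis by linarith
qed

end

lemma antitone_net_range:
  assumes "0 < n" "0 < m" "g \<in> antitone_net n m" "r < n"
  shows "0 \<le> g r" "g r \<le> 1"
proof -
  obtain p s where g: "g = (\<lambda>r. real (s ! subcell_index n m p r) / real m)"
    and p: "p \<in> antitone_lists (Suc m) m" and s: "s \<in> antitone_lists (2 * m) m"
    using assms(3) by (auto simp: antitone_net_def)
  have "s ! subcell_index n m p r \<le> m"
    using subcell_index_less[OF assms(1,2) p assms(4)] by (rule antitone_lists_nth(2)[OF s le_refl])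
  then show "0 \<le> g r" "g r \<le> 1" using assms by (auto simp: g)
qed

text \<open>Replacing \<open>h\<close> on each subcell by its value at the first point makes no error at that point. In a cell
with drop \<open>j\<close> the error at the other points is at most \<open>j\<close> and at most the drop \<open>d\<close> over the subcell,
and there are at most \<open>n / (m * (j + 1))\<close> other points in a subcell. Hence a subcell contributes at
most \<open>(n / m) * d\<close>, and the drops \<open>d\<close> sum up to at most \<open>m\<close>.\<close>

lemma antitone_nat_approx:
  fixes h :: "nat \<Rightarrow> nat"
  assumes n: "0 < n" and m: "0 < m" and h: "antimono h" "\<And>r. h r \<le> m"
  defines "p \<equiv> map (\<lambda>c. h (first_at n (cell_of n m) c)) [0..<Suc m]"
  defines "q \<equiv> subcell_index n m p"
  shows "(\<Sum>r<n. (real (h (first_at n q (q r))) - real (h r))\<^sup>2) \<le> real n"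
proof -
  let ?drop = "\<lambda>r. real (h (first_at n q (q r))) - real (h r)"
  have p: "p \<in> antitone_lists (Suc m) m"
    unfolding p_def by (rule antitone_code[OF h])
  have q_mono: "mono_on {..<n} q" unfolding q_def by (rule subcell_index_mono[OF n m p])
  have c_mono: "mono_on {..<n} (cell_of n m)"
    by (rule mono_onI) (simp add: cell_of_mono[OF n m p])
  define d where "d j = real (h (first_at n q j)) - real (h (first_at n q (Suc j)))" for j
  have d_nonneg: "0 \<le> d j" for j
    unfolding d_def by (simp add: antimonoD[OF h(1)] first_at_mono)
  have class_bound: "(\<Sum>r | r < n \<and> q r = j. (?drop r)\<^sup>2)
      \<le> real n / real m * d j" for j
  proof (cases "{r. r < n \<and> q r = j} = {}")
    case True
    then show ?thesis using d_nonneg by (simp only: True) simp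
  next
    case False
    then obtain r0 where r0: "r0 < n" "q r0 = j" by blast
    define a where "a = first_at n q j"
    have a: "a \<le> r0" "q a = j" "a < n"
      using first_at_self[OF q_mono r0(1)] r0 by (auto simp: a_def)
    define c where "c = cell_of n m a"
    define J where "J = p ! c - p ! Suc c + 1"
    have c: "c < m" unfolding c_def by (rule cell_of_less[OF n m p a(3)])
    have pc: "p ! c = h (first_at n (cell_of n m) c)"
      "p ! Suc c = h (first_at n (cell_of n m) (Suc c))"
      using c by (auto simp: p_def simp del: upt_Suc)
    have ge: "a \<le> r" if "r < n" "q r = j" for r
      unfolding a_def by (rule first_at_le) (simp add: that)
    have drop: "(real (h a) - real (h r))\<^sup>2 \<le> real J * d j" if r: "r < n" "q r = j" for r
    proof -
      have "h r \<le> h a" by (rule antimonoD[OF h(1) ge[OF r]])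
      have cr: "cell_of n m r = c"
        unfolding c_def using same_subcell_same_cell[OF n m p, of r a] r a by (simp add: q_def)
      have "h a \<le> p ! c"
        unfolding pc by (rule antimonoD[OF h(1)], rule first_at_le) (simp add: c_def)
      moreover have "p ! Suc c \<le> h r"
        unfolding pc using less_first_at_Suc[OF c_mono r(1)] cr
        by (intro antimonoD[OF h(1)]) simp
      ultimately have 1: "real (h a) - real (h r) \<le> real J"
        unfolding J_def by linarith
      have "h (first_at n q (Suc j)) \<le> h r"
        using less_first_at_Suc[OF q_mono r(1)] r by (intro antimonoD[OF h(1)]) simp
      then have 2: "real (h a) - real (h r) \<le> d j" by (simp add: d_def a_def)
      show ?thesis unfolding power2_eq_square
        using 1 2 \<open>h r \<le> h a\<close> by (intro mult_mono) auto
    qed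
    have card: "real (card ({r. r < n \<and> q r = j} - {a})) * real J \<le> real n / real m"
    proof -
      have sub: "{r. r < n \<and> q r = j} - {a} \<subseteq> {a<..a + n div (J * m)}"
      proof
        fix r assume r: "r \<in> {r. r < n \<and> q r = j} - {a}"
        then have "a < r" using ge[of r] by auto
        have "J * m * (r - a) < n"
          unfolding J_def using r \<open>a < r\<close> a
          by (intro subcell_length[OF n m p]) (auto simp: q_def c_def)
        then have "r - a \<le> n div (J * m)"
          using m by (subst less_eq_div_iff_mult_less_eq) (simp_all add: J_def mult.commute)
        then show "r \<in> {a<..a + n div (J * m)}" using \<open>a < r\<close> by auto
      qed
      have "card ({r. r < n \<and> q r = j} - {a}) \<le> n div (J * m)"
        using card_mono[OF _ sub] by simp
      then have "card ({r. r < n \<and> q r = j} - {a}) * (J * m) \<le> n"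
        using div_times_less_eq_dividend[of n "J * m"] mult_le_mono1 le_trans by blast
      then have "real (card ({r. r < n \<and> q r = j} - {a}) * (J * m)) \<le> real n"
        by (rule of_nat_mono)
      then show ?thesis using m by (simp add: field_simps)
    qed
    have "(\<Sum>r | r < n \<and> q r = j. (?drop r)\<^sup>2)
        = (\<Sum>r | r < n \<and> q r = j. (real (h a) - real (h r))\<^sup>2)"
      by (rule sum.cong) (auto simp: a_def)
    also have "\<dots> = (\<Sum>r \<in> {r. r < n \<and> q r = j} - {a}. (real (h a) - real (h r))\<^sup>2)"
      by (rule sum.mono_neutral_right) auto
    also have "\<dots> \<le> (\<Sum>r \<in> {r. r < n \<and> q r = j} - {a}. real J * d j)"
      by (rule sum_mono) (use drop in auto)
    also have "\<dots> = real (card ({r. r < n \<and> q r = j} - {a})) * real J * d j" by simp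
    also have "\<dots> \<le> real n / real m * d j"
      by (rule mult_right_mono[OF card d_nonneg])
    finally show ?thesis .
  qed
  have "(\<Sum>r<n. (?drop r)\<^sup>2)
      = (\<Sum>j<2*m. \<Sum>r | r \<in> {..<n} \<and> q r = j. (?drop r)\<^sup>2)"
    by (rule sum.group[symmetric]) (auto simp: q_def intro!: subcell_index_less[OF n m p])
  also have "\<dots> \<le> (\<Sum>j<2*m. real n / real m * d j)"
    using class_bound by (intro sum_mono) simp
  also have "\<dots> = real n / real m * (\<Sum>j<2*m. d j)" by (simp add: sum_distrib_left)
  also have "(\<Sum>j<2*m. d j) = real (h (first_at n q 0)) - real (h (first_at n q (2*m)))"
    unfolding d_def by (rule sum_lessThan_telescope')
  also have "real n / real m * \<dots> \<le> real n / real m * real m"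
    using h(2)[of "first_at n q 0"] by (intro mult_left_mono) auto
  also have "\<dots> = real n" using m by simp
  finally show ?thesis .
qed

lemma antitone_net_approx:
  fixes f :: "nat \<Rightarrow> real"
  assumes n: "0 < n" and m: "0 < m" and f: "antimono_on {..<n} f" "\<And>r. r < n \<Longrightarrow> f r \<in> {0..1}"
  shows "\<exists>g\<in>antitone_net n m. (\<Sum>r<n. (f r - g r)\<^sup>2) \<le> 4 * real n / (real m)\<^sup>2"
proof -
  define h where "h r = (if r < n then nat \<lfloor>real m * f r\<rfloor> else 0)" for r
  have h: "antimono h"
  proof (rule antimonoI)
    fix r s :: nat assume "r \<le> s"
    show "h s \<le> h r"
    proof (cases "s < n")
      case True
      then have "f s \<le> f r" using monotone_onD[OF f(1), of r s] \<open>r \<le> s\<close> by simp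
      then have "nat \<lfloor>real m * f s\<rfloor> \<le> nat \<lfloor>real m * f r\<rfloor>"
        by (intro nat_mono floor_mono mult_left_mono) auto
      then show ?thesis using True \<open>r \<le> s\<close> by (simp add: h_def)
    qed (simp add: h_def)
  qed
  have hm: "h r \<le> m" for r
  proof (cases "r < n")
    case True
    have "real m * f r \<le> real m * 1" using f(2)[OF True] by (intro mult_left_mono) auto
    then have "\<lfloor>real m * f r\<rfloor> \<le> int m" by linarith
    then show ?thesis using True by (simp add: h_def)
  qed (simp add: h_def)
  define p where "p = map (\<lambda>c. h (first_at n (cell_of n m) c)) [0..<Suc m]"
  define q where "q = subcell_index n m p"
  define s where "s = map (\<lambda>j. h (first_at n q j)) [0..<2 * m]"
  have p: "p \<in> antitone_lists (Suc m) m" and s: "s \<in> antitone_lists (2 * m) m"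
    unfolding p_def s_def by (rule antitone_code[OF h hm])+
  define g where "g r = real (s ! q r) / real m" for r
  have "g \<in> antitone_net n m"
    unfolding antitone_net_def
    by (rule image_eqI[of _ _ "(p, s)"]) (use p s in \<open>auto simp: g_def q_def\<close>)
  moreover have "(\<Sum>r<n. (f r - g r)\<^sup>2) \<le> 4 * real n / (real m)\<^sup>2"
  proof -
    have "(f r - g r)\<^sup>2 \<le> 2 / (real m)\<^sup>2 +
        2 / (real m)\<^sup>2 * (real (h (first_at n q (q r))) - real (h r))\<^sup>2" if r: "r < n" for r
    proof -
      have g: "g r = real (h (first_at n q (q r))) / real m"
        using subcell_index_less[OF n m p r] by (simp add: g_def s_def q_def)
      have "0 \<le> real m * f r" using f(2)[OF r] by simp
      then have "\<bar>real m * f r - real (h r)\<bar> \<le> 1"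
        using r by (simp add: h_def) linarith
      then have 1: "(real m * f r - real (h r))\<^sup>2 \<le> 1" by (simp add: abs_square_le_1)
      have "(real m * (f r - g r))\<^sup>2
          = ((real m * f r - real (h r)) - (real (h (first_at n q (q r))) - real (h r)))\<^sup>2"
        using m by (simp add: g algebra_simps)
      also have "\<dots> \<le> 2 * (real m * f r - real (h r))\<^sup>2
          + 2 * (real (h (first_at n q (q r))) - real (h r))\<^sup>2"
        using sum_squares_ge_zero[of "(real m * f r - real (h r)) + (real (h (first_at n q (q r))) - real (h r))" 0]
        by (simp add: power2_eq_square algebra_simps)
      also have "\<dots> \<le> 2 + 2 * (real (h (first_at n q (q r))) - real (h r))\<^sup>2" using 1 by simp
      finally show ?thesis using m unfolding power_mult_distrib by (simp add: field_simps)
    qed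
    then have "(\<Sum>r<n. (f r - g r)\<^sup>2) \<le> (\<Sum>r<n. 2 / (real m)\<^sup>2 +
        2 / (real m)\<^sup>2 * (real (h (first_at n q (q r))) - real (h r))\<^sup>2)"
      by (intro sum_mono) simp
    also have "\<dots> = 2 * real n / (real m)\<^sup>2 +
        2 / (real m)\<^sup>2 * (\<Sum>r<n. (real (h (first_at n q (q r))) - real (h r))\<^sup>2)"
      by (simp add: sum.distrib sum_distrib_left)
    also have "\<dots> \<le> 2 * real n / (real m)\<^sup>2 + 2 / (real m)\<^sup>2 * real n"
      using antitone_nat_approx[OF n m h hm] unfolding p_def q_def
      by (intro add_left_mono mult_left_mono) auto
    finally show ?thesis by simp
  qed
  ultimately show ?thesis by blast
qed

text \<open>The net depends on the scores \<open>u\<close> only through an ordering of the indices that sorts them.\<close>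

lemma antitone_of_score_net:
  fixes u :: "nat \<Rightarrow> real"
  assumes n: "0 < n" and m: "0 < m"
  obtains T where "finite T" "card T \<le> 2 ^ (5 * m + 1)"
    "\<And>g i. g \<in> T \<Longrightarrow> i < n \<Longrightarrow> g i \<in> {0..1}"
    "\<And>w. antimono w \<Longrightarrow> (\<And>z. w z \<in> {0..1::real}) \<Longrightarrow>
       \<exists>g\<in>T. (\<Sum>i<n. (w (u i) - g i)\<^sup>2) \<le> 4 * real n / (real m)\<^sup>2"
proof -
  define xs where "xs = sort_key u [0..<n]"
  have len: "length xs = n" and dist: "distinct xs" and set: "set xs = {..<n}"
    by (auto simp: xs_def)
  have srt: "sorted (map u xs)" by (simp add: xs_def)
  have bij: "bij_betw ((!) xs) {..<n} {..<n}"
    using bij_betw_nth[OF dist] len set by simp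
  define rk where "rk = the_inv_into {..<n} ((!) xs)"
  have rk: "rk i < n" "xs ! rk i = i" if "i < n" for i
    using bij that by (auto simp: rk_def bij_betw_def f_the_inv_into_f
        dest: the_inv_into_into[of "(!) xs" "{..<n}" i "{..<n}"])
  have rk_nth: "rk (xs ! r) = r" if "r < n" for r
    using bij that by (auto simp: rk_def bij_betw_def intro: the_inv_into_f_f)
  define T where "T = (\<lambda>g i. g (rk i)) ` antitone_net n m"
  show thesis
  proof (rule that)
    show "finite T" by (simp add: T_def finite_antitone_net)
    show "card T \<le> 2 ^ (5 * m + 1)"
      unfolding T_def using card_image_le[OF finite_antitone_net] card_antitone_net le_trans by blast
    show "g i \<in> {0..1}" if "g \<in> T" "i < n" for g i
      using that antitone_net_range[OF n m] rk by (auto simp: T_def)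
    fix w :: "real \<Rightarrow> real" assume w: "antimono w" "\<And>z. w z \<in> {0..1}"
    have "antimono_on {..<n} (\<lambda>r. w (u (xs ! r)))"
    proof (rule monotone_onI)
      fix r s assume rs: "r \<in> {..<n}" "s \<in> {..<n}" "r \<le> s"
      then have "u (xs ! r) \<le> u (xs ! s)"
        using sorted_nth_mono[OF srt, of r s] len by simp
      then show "w (u (xs ! s)) \<le> w (u (xs ! r))" by (rule antimonoD[OF w(1)])
    qed
    from antitone_net_approx[OF n m this w(2)] obtain g where g: "g \<in> antitone_net n m"
      "(\<Sum>r<n. (w (u (xs ! r)) - g r)\<^sup>2) \<le> 4 * real n / (real m)\<^sup>2" by blast
    have "(\<Sum>i<n. (w (u i) - g (rk i))\<^sup>2) = (\<Sum>r<n. (w (u (xs ! r)) - g (rk (xs ! r)))\<^sup>2)"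
      by (rule sum.reindex_bij_betw[OF bij, symmetric])
    also have "\<dots> = (\<Sum>r<n. (w (u (xs ! r)) - g r)\<^sup>2)" by (simp add: rk_nth)
    finally show "\<exists>g\<in>T. (\<Sum>i<n. (w (u i) - g i)\<^sup>2) \<le> 4 * real n / (real m)\<^sup>2"
      using g unfolding T_def by (intro bexI[of _ "\<lambda>i. g (rk i)"]) auto
  qed
qed

section \<open>Chaining for Rademacher averages with a quadratic offset\<close>

text \<open>Expectations over independent uniform signs are finite averages, which needs no measure space.\<close>

definition signs :: "nat \<Rightarrow> (nat \<Rightarrow> real) set" where
  "signs n = (\<Pi>\<^sub>E i\<in>{..<n}. {- 1, 1})"

definition sign_avg :: "nat \<Rightarrow> ((nat \<Rightarrow> real) \<Rightarrow> real) \<Rightarrow> real" where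
  "sign_avg n G = (\<Sum>\<sigma>\<in>signs n. G \<sigma>) / 2 ^ n"

lemma finite_signs [simp]: "finite (signs n)"
  unfolding signs_def by (rule finite_PiE) auto

lemma card_signs: "card (signs n) = 2 ^ n"
  unfolding signs_def by (subst card_PiE) (auto simp: numeral_2_eq_2)

lemma sign_avg_const [simp]: "sign_avg n (\<lambda>_. c) = c"
  by (simp add: sign_avg_def card_signs)

lemma sign_avg_add: "sign_avg n (\<lambda>\<sigma>. F \<sigma> + G \<sigma>) = sign_avg n F + sign_avg n G"
  by (simp add: sign_avg_def sum.distrib add_divide_distrib)

lemma sign_avg_sum: "sign_avg n (\<lambda>\<sigma>. \<Sum>k\<in>A. F k \<sigma>) = (\<Sum>k\<in>A. sign_avg n (F k))"
  unfolding sign_avg_def by (subst sum.swap) (simp add: sum_divide_distrib)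

lemma sign_avg_cmult: "sign_avg n (\<lambda>\<sigma>. c * G \<sigma>) = c * sign_avg n G"
  by (simp add: sign_avg_def sum_distrib_left)

lemma sign_avg_mono:
  "(\<And>\<sigma>. \<sigma> \<in> signs n \<Longrightarrow> F \<sigma> \<le> G \<sigma>) \<Longrightarrow> sign_avg n F \<le> sign_avg n G"
  unfolding sign_avg_def by (intro divide_right_mono sum_mono) auto

lemma cosh_le_exp_half_square: "cosh (x::real) \<le> exp (x\<^sup>2 / 2)"
proof -
  have cosh_sums: "(\<lambda>k. x ^ (2 * k) /\<^sub>R fact (2 * k)) sums cosh x"
  proof -
    have "(\<lambda>k. if even (2 * k) then x ^ (2 * k) /\<^sub>R fact (2 * k) else 0) sums cosh x"
    proof (rule sums_mono_reindex[THEN iffD2, OF _ _ cosh_converges])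
      show "strict_mono (\<lambda>k::nat. 2 * k)" by (simp add: strict_mono_def)
      show "(if even k then x ^ k /\<^sub>R fact k else 0) = 0" if "k \<notin> range (\<lambda>k::nat. 2 * k)" for k
        using that by auto
    qed
    then show ?thesis by simp
  qed
  have exp_sums: "(\<lambda>k. (x\<^sup>2 / 2) ^ k /\<^sub>R fact k) sums exp (x\<^sup>2 / 2)" by (rule exp_converges)
  have le: "x ^ (2 * k) /\<^sub>R fact (2 * k) \<le> (x\<^sup>2 / 2) ^ k /\<^sub>R fact k" for k
  proof -
    have "(2::real) ^ k * fact k \<le> fact (2 * k)"
    proof (induction k)
      case (Suc k)
      have "(2::real) ^ Suc k * fact (Suc k) = (2 * (real k + 1)) * (2 ^ k * fact k)"
        by (simp add: algebra_simps)
      also have "\<dots> \<le> ((2 * real k + 2) * (2 * real k + 1)) * fact (2 * k)"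
        using Suc by (intro mult_mono) (auto simp: algebra_simps)
      also have "\<dots> = fact (2 * Suc k)" by (simp add: algebra_simps)
      finally show ?case .
    qed simp
    then have "x ^ (2 * k) / fact (2 * k) \<le> x ^ (2 * k) / (2 ^ k * fact k)"
      by (intro divide_left_mono) (auto simp: power_mult)
    moreover have "x ^ (2 * k) /\<^sub>R fact (2 * k) = x ^ (2 * k) / fact (2 * k)"
      by (simp add: field_simps)
    moreover have "(x\<^sup>2 / 2) ^ k /\<^sub>R fact k = x ^ (2 * k) / (2 ^ k * fact k)"
      by (simp add: power_divide field_simps flip: power_mult)
    ultimately show ?thesis by simp
  qed
  show ?thesis by (rule sums_le[OF le cosh_sums exp_sums])
qed

lemma sign_avg_exp_le:
  "sign_avg n (\<lambda>\<sigma>. exp (\<Sum>i<n. \<sigma> i * a i)) \<le> exp ((\<Sum>i<n. (a i)\<^sup>2) / 2)"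
proof -
  have "(\<Sum>\<sigma>\<in>signs n. exp (\<Sum>i<n. \<sigma> i * a i)) = (\<Sum>\<sigma>\<in>signs n. \<Prod>i<n. exp (\<sigma> i * a i))"
    by (simp add: exp_sum)
  also have "\<dots> = (\<Prod>i<n. \<Sum>s\<in>{- 1, 1}. exp (s * a i))"
    unfolding signs_def by (rule prod_sum_PiE[symmetric]) auto
  also have "\<dots> = (\<Prod>i<n. 2 * cosh (a i))"
    by (intro prod.cong) (auto simp: cosh_def)
  also have "\<dots> = 2 ^ n * (\<Prod>i<n. cosh (a i))" by (simp add: prod.distrib)
  finally have "sign_avg n (\<lambda>\<sigma>. exp (\<Sum>i<n. \<sigma> i * a i)) = (\<Prod>i<n. cosh (a i))"
    by (simp add: sign_avg_def)
  also have "\<dots> \<le> (\<Prod>i<n. exp ((a i)\<^sup>2 / 2))"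
    by (intro prod_mono) (auto simp: cosh_le_exp_half_square)
  also have "\<dots> = exp ((\<Sum>i<n. (a i)\<^sup>2) / 2)"
    by (simp add: exp_sum sum_divide_distrib)
  finally show ?thesis .
qed

text \<open>A maximal inequality in the form in which chaining uses it: \<open>j \<sigma>\<close> may be chosen from \<open>J\<close> after the
signs are known. It follows from \<open>1 + x \<le> exp x\<close> with \<open>x = l * G \<sigma> (j \<sigma>) - (B + D)\<close>, where the
exponential at \<open>j \<sigma>\<close> is at most the sum over all of \<open>J\<close>.\<close>

lemma sign_avg_select_le:
  assumes J: "finite J" "J \<noteq> {}" and l: "0 < l" and B: "real (card J) \<le> exp B"
    and mgf: "\<And>j. j \<in> J \<Longrightarrow> sign_avg n (\<lambda>\<sigma>. exp (l * G \<sigma> j)) \<le> exp D"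
    and sel: "\<And>\<sigma>. \<sigma> \<in> signs n \<Longrightarrow> j \<sigma> \<in> J"
  shows "sign_avg n (\<lambda>\<sigma>. G \<sigma> (j \<sigma>)) \<le> (B + D) / l"
proof -
  have "l * sign_avg n (\<lambda>\<sigma>. G \<sigma> (j \<sigma>)) + (1 - (B + D))
      = sign_avg n (\<lambda>\<sigma>. l * G \<sigma> (j \<sigma>) + (1 - (B + D)))"
    by (simp add: sign_avg_add sign_avg_cmult)
  also have "\<dots> \<le> sign_avg n (\<lambda>\<sigma>. \<Sum>i\<in>J. exp (- (B + D)) * exp (l * G \<sigma> i))"
  proof (rule sign_avg_mono)
    fix \<sigma> assume "\<sigma> \<in> signs n"
    have "l * G \<sigma> (j \<sigma>) + (1 - (B + D)) \<le> exp (l * G \<sigma> (j \<sigma>) - (B + D))"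
      using exp_ge_add_one_self[of "l * G \<sigma> (j \<sigma>) - (B + D)"] by linarith
    also have "\<dots> = exp (- (B + D)) * exp (l * G \<sigma> (j \<sigma>))" by (simp flip: exp_add)
    also have "\<dots> \<le> (\<Sum>i\<in>J. exp (- (B + D)) * exp (l * G \<sigma> i))"
      by (rule member_le_sum) (use J sel[OF \<open>\<sigma> \<in> signs n\<close>] in auto)
    finally show "l * G \<sigma> (j \<sigma>) + (1 - (B + D)) \<le> (\<Sum>i\<in>J. exp (- (B + D)) * exp (l * G \<sigma> i))" .
  qed
  also have "\<dots> = exp (- (B + D)) * (\<Sum>i\<in>J. sign_avg n (\<lambda>\<sigma>. exp (l * G \<sigma> i)))"
    by (simp add: sign_avg_sum sign_avg_cmult sum_distrib_left)
  also have "\<dots> \<le> exp (- (B + D)) * (\<Sum>i\<in>J. exp D)"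
    by (intro mult_left_mono sum_mono mgf) auto
  also have "\<dots> = exp (- (B + D)) * (real (card J) * exp D)" by simp
  also have "\<dots> \<le> exp (- (B + D)) * (exp B * exp D)"
    by (intro mult_left_mono mult_right_mono B) auto
  also have "\<dots> = 1" by (simp flip: exp_add)
  finally show ?thesis using l by (simp add: field_simps)
qed

lemma square_add_le: "((a::real) + b)\<^sup>2 \<le> 2 * a\<^sup>2 + 2 * b\<^sup>2"
  using sum_squares_ge_zero[of "a - b" 0] by (simp add: power2_eq_square algebra_simps)

text \<open>The chaining setup for a fixed sample. Elements of \<open>V\<close> are the vectors of values of candidate functions
at the \<open>n\<close> sample points, \<open>f\<close> is the vector of the true regression function, and \<open>\<psi> i\<close> turns a value
at the sample point \<open>i\<close> into a contribution to the process. The net with parameter \<open>m\<close> has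
log-cardinality \<open>c * m\<close> and accuracy \<open>2 / m\<close> in root mean square, which is entropy of order
\<open>1 / \<epsilon>\<close> at accuracy \<open>\<epsilon>\<close>. The coarsest net used has accuracy of the order of the rate
\<open>n powr (- 1/3)\<close>.\<close>

locale rademacher_chain =
  fixes n :: nat and V :: "(nat \<Rightarrow> real) set" and net :: "nat \<Rightarrow> (nat \<Rightarrow> real) set"
    and c :: real and f :: "nat \<Rightarrow> real" and \<psi> :: "nat \<Rightarrow> real \<Rightarrow> real" and m0 :: nat
  assumes n: "0 < n" and c: "0 \<le> c"
    and m0: "real n powr (1/3) \<le> real m0" "real m0 \<le> 2 * real n powr (1/3)"
    and net_fin: "\<And>m. m0 \<le> m \<Longrightarrow> finite (net m)"
    and net_card: "\<And>m. m0 \<le> m \<Longrightarrow> real (card (net m)) \<le> exp (c * real m)"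
    and net_range: "\<And>m w i. m0 \<le> m \<Longrightarrow> w \<in> net m \<Longrightarrow> i < n \<Longrightarrow> w i \<in> {0..1}"
    and net_approx: "\<And>m v. m0 \<le> m \<Longrightarrow> v \<in> V \<Longrightarrow>
        \<exists>w\<in>net m. (\<Sum>i<n. (v i - w i)\<^sup>2) \<le> 4 * real n / (real m)\<^sup>2"
    and V_range: "\<And>v i. v \<in> V \<Longrightarrow> i < n \<Longrightarrow> v i \<in> {0..1}"
    and f_range: "\<And>i. i < n \<Longrightarrow> f i \<in> {0..1}"
    and lip: "\<And>i a b. i < n \<Longrightarrow> a \<in> {0..1} \<Longrightarrow> b \<in> {0..1} \<Longrightarrow> \<bar>\<psi> i a - \<psi> i b\<bar> \<le> 3 * \<bar>a - b\<bar>"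
    and zero: "\<And>i. i < n \<Longrightarrow> \<psi> i (f i) = 0"
begin

text \<open>The link between two levels costs \<open>1 / sqrt m\<close>; with the factor \<open>4\<close> the costs are halved from one
level to the next.\<close>

definition level :: "nat \<Rightarrow> nat" where "level k = m0 * 4 ^ k"

definition proj :: "nat \<Rightarrow> (nat \<Rightarrow> real) \<Rightarrow> nat \<Rightarrow> real" where
  "proj k v = (SOME w. w \<in> net (level k) \<and>
     (\<Sum>i<n. (v i - w i)\<^sup>2) \<le> 4 * real n / (real (level k))\<^sup>2)"

lemma n_root: "1 \<le> real n powr (1/3)"
  using n by (simp add: ge_one_powr_ge_zero)

lemma m0_pos: "0 < m0" "1 \<le> real m0"
  using m0(1) n_root by linarith+

lemma level_ge: "m0 \<le> level k" by (simp add: level_def)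

lemma level_pos: "0 < level k" using m0_pos by (simp add: level_def)

lemma proj:
  assumes "v \<in> V"
  shows "proj k v \<in> net (level k)"
    and "(\<Sum>i<n. (v i - proj k v i)\<^sup>2) \<le> 4 * real n / (real (level k))\<^sup>2"
  unfolding proj_def
  using someI_ex[OF net_approx[OF level_ge assms, of k, unfolded Bex_def]] by blast+

lemma proj_range: "v \<in> V \<Longrightarrow> i < n \<Longrightarrow> proj k v i \<in> {0..1}"
  using net_range[OF level_ge proj(1)] .

definition rad :: "(nat \<Rightarrow> real) \<Rightarrow> (nat \<Rightarrow> real) \<Rightarrow> real" where
  "rad \<sigma> v = (\<Sum>i<n. \<sigma> i * \<psi> i (v i)) / real n"

text \<open>At the coarsest level the offset is used in place of a bound on the size of the vectors: the quadratic
term that the exponential moment of the Rademacher sum produces is cancelled by the offset, and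
only the log-cardinality remains.\<close>

lemma top_level:
  assumes sel: "\<And>\<sigma>. \<sigma> \<in> signs n \<Longrightarrow> w \<sigma> \<in> net m0"
  shows "sign_avg n (\<lambda>\<sigma>. rad \<sigma> (w \<sigma>) - (\<Sum>i<n. (w \<sigma> i - f i)\<^sup>2) / (16 * real n))
    \<le> 144 * c * real n powr (- 2/3)"
proof -
  have "signs n \<noteq> {}" using card_signs[of n] by auto
  then have ne: "net m0 \<noteq> {}" using sel by blast
  \<comment> \<open>For a net point at squared distance \<open>D\<close> from \<open>f\<close>, exponent \<open>n / 72\<close> gives \<open>9 * D / (2 * 72\<^sup>2) = D / (16 * 72)\<close>, exactly the offset.\<close>
  have "sign_avg n (\<lambda>\<sigma>. rad \<sigma> (w \<sigma>) - (\<Sum>i<n. (w \<sigma> i - f i)\<^sup>2) / (16 * real n))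
      \<le> (c * real m0 + 0) / (real n / 72)"
  proof (rule sign_avg_select_le[where J = "net m0" and
        G = "\<lambda>\<sigma> w. rad \<sigma> w - (\<Sum>i<n. (w i - f i)\<^sup>2) / (16 * real n)"])
    fix v assume v: "v \<in> net m0"
    define D where "D = (\<Sum>i<n. (v i - f i)\<^sup>2)"
    have "real n / 72 * (rad \<sigma> v - D / (16 * real n))
        = - D / (16 * 72) + (\<Sum>i<n. \<sigma> i * (\<psi> i (v i) / 72))" for \<sigma>
    proof -
      have "real n / 72 * (rad \<sigma> v - D / (16 * real n)) = (real n * rad \<sigma> v) / 72 - D / (16 * 72)"
        using n by (simp add: field_simps)
      also have "real n * rad \<sigma> v = (\<Sum>i<n. \<sigma> i * \<psi> i (v i))" using n by (simp add: rad_def)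
      finally show ?thesis by (simp add: sum_divide_distrib)
    qed
    then have "sign_avg n (\<lambda>\<sigma>. exp (real n / 72 * (rad \<sigma> v - D / (16 * real n))))
        = exp (- D / (16 * 72)) * sign_avg n (\<lambda>\<sigma>. exp (\<Sum>i<n. \<sigma> i * (\<psi> i (v i) / 72)))"
      by (simp only: exp_add sign_avg_cmult)
    also have "\<dots> \<le> exp (- D / (16 * 72)) * exp ((\<Sum>i<n. (\<psi> i (v i) / 72)\<^sup>2) / 2)"
      by (intro mult_left_mono sign_avg_exp_le) auto
    also have "\<dots> \<le> exp (- D / (16 * 72)) * exp (D / (16 * 72))"
    proof (intro mult_left_mono)
      have "(\<psi> i (v i) / 72)\<^sup>2 \<le> (3 * (v i - f i) / 72)\<^sup>2" if "i < n" for i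
      proof -
        have "\<bar>\<psi> i (v i)\<bar> \<le> 3 * \<bar>v i - f i\<bar>"
          using lip[OF that net_range[OF le_refl v that] f_range[OF that]] zero[OF that] by simp
        then have "\<bar>\<psi> i (v i) / 72\<bar> \<le> \<bar>3 * (v i - f i) / 72\<bar>"
          unfolding abs_divide abs_mult by simp
        then show ?thesis by (simp only: abs_le_square_iff)
      qed
      then have "(\<Sum>i<n. (\<psi> i (v i) / 72)\<^sup>2) \<le> (\<Sum>i<n. (3 * (v i - f i) / 72)\<^sup>2)"
        by (intro sum_mono) simp
      also have "\<dots> = D / (16 * 36)"
        unfolding D_def sum_divide_distrib
        by (intro sum.cong) (simp_all add: power2_eq_square field_simps)
      finally show "exp ((\<Sum>i<n. (\<psi> i (v i) / 72)\<^sup>2) / 2) \<le> exp (D / (16 * 72))" by simp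
    qed auto
    also have "\<dots> = exp 0" by (simp flip: exp_add)
    finally show "sign_avg n (\<lambda>\<sigma>. exp (real n / 72 * (rad \<sigma> v - (\<Sum>i<n. (v i - f i)\<^sup>2) / (16 * real n)))) \<le> exp 0"
      by (simp add: D_def)
  qed (use net_fin[OF le_refl] net_card[OF le_refl] n ne sel in auto)
  also have "\<dots> = 72 * c * (real m0 / real n)" using n by simp
  also have "\<dots> \<le> 72 * c * (2 * real n powr (1/3) / real n)"
    using m0 c n by (intro mult_left_mono divide_right_mono) auto
  also have "\<dots> = 144 * c * (real n powr (1/3) / real n powr 1)" using n by simp
  also have "real n powr (1/3) / real n powr 1 = real n powr (- 2/3)"
    unfolding powr_diff[symmetric] by simp
  finally show ?thesis .
qed

text \<open>Consecutive projections differ by a vector of norm \<open>O(1 / m)\<close> in root mean square, taken from at most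
\<open>exp (5 * c * m)\<close> pairs, so their difference is bounded without any offset by a constant times
\<open>1 / sqrt (m * n)\<close>, and \<open>m\<close> is at least \<open>n powr (1/3)\<close>.\<close>

lemma link:
  assumes sel: "\<And>\<sigma>. \<sigma> \<in> signs n \<Longrightarrow> v \<sigma> \<in> V"
  shows "sign_avg n (\<lambda>\<sigma>. rad \<sigma> (proj (Suc k) (v \<sigma>)) - rad \<sigma> (proj k (v \<sigma>)))
    \<le> (5 * c + 90) * real n powr (- 2/3) * (1/2) ^ k"
proof -
  define m where "m = real (level k)"
  have m: "0 < m" by (simp add: m_def level_pos)
  have m': "real (level (Suc k)) = 4 * m" by (simp add: m_def level_def)
  define J where "J = {(w, w') \<in> net (level k) \<times> net (level (Suc k)).
     (\<Sum>i<n. (w i - w' i)\<^sup>2) \<le> 20 * real n / m\<^sup>2}"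
  have finp: "finite (net (level k) \<times> net (level (Suc k)))"
    using net_fin[OF level_ge] by simp
  have finJ: "finite J" unfolding J_def by (rule finite_subset[OF _ finp]) auto
  have "card J \<le> card (net (level k) \<times> net (level (Suc k)))"
    unfolding J_def by (rule card_mono[OF finp]) auto
  then have "real (card J) \<le> real (card (net (level k))) * real (card (net (level (Suc k))))"
    by (simp add: card_cartesian_product flip: of_nat_mult)
  also have "\<dots> \<le> exp (c * m) * exp (c * (4 * m))"
    using net_card[OF level_ge, of k] net_card[OF level_ge, of "Suc k"]
    unfolding m' m_def[symmetric] by (intro mult_mono) auto
  also have "\<dots> = exp (5 * c * m)" by (simp flip: exp_add)
  finally have cardJ: "real (card J) \<le> exp (5 * c * m)" .
  have selJ: "(proj k (v \<sigma>), proj (Suc k) (v \<sigma>)) \<in> J" if "\<sigma> \<in> signs n" for \<sigma>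
  proof -
    let ?v = "v \<sigma>"
    have "(\<Sum>i<n. (proj k ?v i - proj (Suc k) ?v i)\<^sup>2)
        \<le> (\<Sum>i<n. 2 * (?v i - proj k ?v i)\<^sup>2 + 2 * (?v i - proj (Suc k) ?v i)\<^sup>2)"
    proof (rule sum_mono)
      fix i
      show "(proj k ?v i - proj (Suc k) ?v i)\<^sup>2
          \<le> 2 * (?v i - proj k ?v i)\<^sup>2 + 2 * (?v i - proj (Suc k) ?v i)\<^sup>2"
        using square_add_le[of "- (?v i - proj k ?v i)" "?v i - proj (Suc k) ?v i"] by (simp del: minus_diff_eq)
    qed
    also have "\<dots> \<le> 2 * (4 * real n / m\<^sup>2) + 2 * (4 * real n / (4 * m)\<^sup>2)"
      using proj(2)[OF sel[OF that], of k] proj(2)[OF sel[OF that], of "Suc k"]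
      unfolding m' m_def[symmetric] by (simp add: sum.distrib flip: sum_distrib_left)
    also have "\<dots> \<le> 20 * real n / m\<^sup>2" using m by (simp add: field_simps)
    finally show ?thesis using proj(1)[OF sel[OF that]] by (simp add: J_def)
  qed
  have "signs n \<noteq> {}" using card_signs[of n] by auto
  then have ne: "J \<noteq> {}" using selJ by blast
  \<comment> \<open>This exponent balances the log-cardinality \<open>m / l\<close> against the variance \<open>l / (n * m\<^sup>2)\<close>.\<close>
  define l where "l = real n powr (1/2) * m powr (3/2)"
  have l: "0 < l" using n m by (simp add: l_def)
  have "sign_avg n (\<lambda>\<sigma>. (\<lambda>(w, w'). rad \<sigma> w' - rad \<sigma> w) (proj k (v \<sigma>), proj (Suc k) (v \<sigma>)))
      \<le> (5 * c * m + 90 * l\<^sup>2 / (real n * m\<^sup>2)) / l"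
  proof (rule sign_avg_select_le[where J = J and G = "\<lambda>\<sigma> (w, w'). rad \<sigma> w' - rad \<sigma> w"])
    fix j assume "j \<in> J"
    then obtain w w' where j: "j = (w, w')" and w: "w \<in> net (level k)" "w' \<in> net (level (Suc k))"
      and d: "(\<Sum>i<n. (w i - w' i)\<^sup>2) \<le> 20 * real n / m\<^sup>2" by (auto simp: J_def)
    have "l * (rad \<sigma> w' - rad \<sigma> w) = (\<Sum>i<n. \<sigma> i * (l / real n * (\<psi> i (w' i) - \<psi> i (w i))))" for \<sigma>
    proof -
      have "l * (rad \<sigma> w' - rad \<sigma> w)
          = l / real n * ((\<Sum>i<n. \<sigma> i * \<psi> i (w' i)) - (\<Sum>i<n. \<sigma> i * \<psi> i (w i)))"
        by (simp add: rad_def diff_divide_distrib right_diff_distrib)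
      then show ?thesis by (simp only: sum_subtractf[symmetric] sum_distrib_left) (simp add: algebra_simps)
    qed
    then have "sign_avg n (\<lambda>\<sigma>. exp (l * (rad \<sigma> w' - rad \<sigma> w)))
        = sign_avg n (\<lambda>\<sigma>. exp (\<Sum>i<n. \<sigma> i * (l / real n * (\<psi> i (w' i) - \<psi> i (w i)))))"
      by (simp only:)
    also have "\<dots> \<le> exp ((\<Sum>i<n. (l / real n * (\<psi> i (w' i) - \<psi> i (w i)))\<^sup>2) / 2)"
      by (rule sign_avg_exp_le)
    also have "\<dots> \<le> exp ((\<Sum>i<n. (l / real n)\<^sup>2 * (9 * (w i - w' i)\<^sup>2)) / 2)"
    proof -
      have "(\<psi> i (w' i) - \<psi> i (w i))\<^sup>2 \<le> 9 * (w i - w' i)\<^sup>2" if "i < n" for i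
      proof -
        have "\<bar>\<psi> i (w' i) - \<psi> i (w i)\<bar> \<le> \<bar>3 * (w i - w' i)\<bar>"
          using lip[OF that net_range[OF level_ge w(2) that] net_range[OF level_ge w(1) that]]
          unfolding abs_mult by (simp add: abs_minus_commute)
        then have "(\<psi> i (w' i) - \<psi> i (w i))\<^sup>2 \<le> (3 * (w i - w' i))\<^sup>2" by (simp only: abs_le_square_iff)
        then show ?thesis unfolding power_mult_distrib by simp
      qed
      then show ?thesis
        unfolding power_mult_distrib exp_le_cancel_iff
        by (intro divide_right_mono sum_mono mult_left_mono) auto
    qed
    also have "\<dots> = exp (9 * l\<^sup>2 / (2 * (real n)\<^sup>2) * (\<Sum>i<n. (w i - w' i)\<^sup>2))"
      by (simp add: sum_distrib_left power_divide sum_divide_distrib mult_ac)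
    also have "\<dots> \<le> exp (9 * l\<^sup>2 / (2 * (real n)\<^sup>2) * (20 * real n / m\<^sup>2))"
      unfolding exp_le_cancel_iff by (intro mult_left_mono d) auto
    also have "\<dots> = exp (90 * l\<^sup>2 / (real n * m\<^sup>2))"
      using n by (simp add: power2_eq_square)
    finally show "sign_avg n (\<lambda>\<sigma>. exp (l * (case j of (w, w') \<Rightarrow> rad \<sigma> w' - rad \<sigma> w)))
        \<le> exp (90 * l\<^sup>2 / (real n * m\<^sup>2))" by (simp add: j)
  qed (use finJ ne l cardJ selJ in auto)
  also have "\<dots> = (5 * c + 90) * (real n powr (- 1/2) * m powr (- 1/2))"
  proof -
    have "(real n powr (1/2))\<^sup>2 = real n" by (simp add: powr_half_sqrt)
    moreover have "(m powr (3/2))\<^sup>2 = m ^ 3" using m by (simp add: powr_power)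
    ultimately have l2: "l\<^sup>2 = real n * m ^ 3" unfolding l_def power_mult_distrib by simp
    have "real n powr (- 1/2) = 1 / real n powr (1/2)"
      using powr_minus_divide[of "real n" "1/2"] by simp
    then have "m / l = real n powr (- 1/2) * (m powr 1 / m powr (3/2))"
      using m unfolding l_def by simp
    also have "m powr 1 / m powr (3/2) = m powr (- 1/2)" unfolding powr_diff[symmetric] by simp
    finally have ml: "m / l = real n powr (- 1/2) * m powr (- 1/2)" .
    have "(5 * c * m + 90 * l\<^sup>2 / (real n * m\<^sup>2)) / l = (5 * c + 90) * (m / l)"
      unfolding l2 using n m by (simp add: power2_eq_square power3_eq_cube field_simps)
    then show ?thesis by (simp add: ml)
  qed
  also have "\<dots> \<le> (5 * c + 90) * (real n powr (- 1/2) * (real n powr (- 1/6) * (1/2) ^ k))"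
  proof (intro mult_left_mono)
    have "m powr (- 1/2) = real m0 powr (- 1/2) * (4 ^ k) powr (- 1/2)"
      by (simp add: m_def level_def powr_mult)
    also have "((4::real) ^ k) powr (- 1/2) = (1/2) ^ k"
    proof -
      have "(4::real) ^ k = (2 ^ k)\<^sup>2" by (simp add: power2_eq_square flip: power_mult_distrib)
      also have "\<dots> = (2 ^ k) powr 2" by (simp add: powr_numeral)
      also have "\<dots> powr (- 1/2) = (2 ^ k) powr (- 1)" unfolding powr_powr by simp
      also have "\<dots> = (1/2) ^ k" by (simp add: powr_minus power_one_over inverse_eq_divide)
      finally show ?thesis .
    qed
    also have "real m0 powr (- 1/2) \<le> (real n powr (1/3)) powr (- 1/2)"
      using m0(1) n by (intro powr_mono2') auto
    also have "\<dots> = real n powr (- 1/6)" by (simp add: powr_powr)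
    finally show "m powr (- 1/2) \<le> real n powr (- 1/6) * (1/2) ^ k" by simp
  qed (use c in auto)
  also have "\<dots> = (5 * c + 90) * (real n powr (- 1/2) * real n powr (- 1/6)) * (1/2) ^ k" by simp
  also have "real n powr (- 1/2) * real n powr (- 1/6) = real n powr (- 2/3)"
    unfolding powr_add[symmetric] by simp
  finally show ?thesis by simp
qed

text \<open>The remainder below level \<open>n\<close> is bounded without using the randomness of the signs: since
\<open>n \<le> 4 ^ n\<close>, the accuracy of the last net is of order \<open>1 / n\<close>.\<close>

lemma bottom_level:
  assumes v: "v \<in> V" and \<sigma>: "\<sigma> \<in> signs n"
  shows "rad \<sigma> v - rad \<sigma> (proj n v) \<le> 9 * real n powr (- 2/3)"
proof -
  define s where "s = 1 / real n"
  have s: "0 < s" using n by (simp add: s_def)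
  have \<sigma>1: "\<bar>\<sigma> i\<bar> = 1" if "i < n" for i
  proof -
    have "\<sigma> i \<in> {- 1, 1}" using \<sigma> that by (auto simp: signs_def PiE_iff)
    then show ?thesis by auto
  qed
  have "n \<le> 2 ^ n" by (rule less_imp_le[OF less_exp])
  also have "(2::nat) ^ n \<le> 4 ^ n" by (rule power_mono) auto
  also have "\<dots> \<le> level n" using m0_pos(1) by (simp add: level_def)
  finally have "n \<le> level n" .
  have "(\<Sum>i<n. \<sigma> i * (\<psi> i (v i) - \<psi> i (proj n v i))) \<le> (\<Sum>i<n. 3 / 2 * (s + (v i - proj n v i)\<^sup>2 / s))"
  proof (rule sum_mono)
    fix i assume "i \<in> {..<n}"
    then have i: "i < n" by simp
    let ?d = "\<bar>v i - proj n v i\<bar>"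
    have "\<sigma> i * (\<psi> i (v i) - \<psi> i (proj n v i)) \<le> \<bar>\<sigma> i\<bar> * \<bar>\<psi> i (v i) - \<psi> i (proj n v i)\<bar>"
      by (metis abs_ge_self abs_mult)
    also have "\<dots> \<le> 3 * ?d"
      using \<sigma>1[OF i] lip[OF i V_range[OF v i] proj_range[OF v i]] by simp
    also have "?d \<le> 1 / 2 * (s + ?d\<^sup>2 / s)"
    proof -
      have "0 \<le> (?d - s)\<^sup>2" by simp
      then have "2 * ?d * s \<le> s * s + ?d\<^sup>2" by (simp add: power2_eq_square algebra_simps)
      then show ?thesis using s by (simp add: field_simps)
    qed
    finally show "\<sigma> i * (\<psi> i (v i) - \<psi> i (proj n v i)) \<le> 3 / 2 * (s + (v i - proj n v i)\<^sup>2 / s)" by simp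
  qed
  also have "\<dots> = 3 / 2 * (real n * s + (\<Sum>i<n. (v i - proj n v i)\<^sup>2) / s)"
    unfolding sum_distrib_left[symmetric] sum.distrib sum_divide_distrib[symmetric] by simp
  also have "\<dots> \<le> 3 / 2 * (1 + (4 * real n / (real n)\<^sup>2) / s)"
  proof -
    have "(\<Sum>i<n. (v i - proj n v i)\<^sup>2) \<le> 4 * real n / (real n)\<^sup>2"
      using proj(2)[OF v, of n] \<open>n \<le> level n\<close> n
      by (elim order_trans) (intro divide_left_mono power_mono mult_pos_pos zero_less_power, auto)
    then show ?thesis using s by (intro mult_left_mono add_mono divide_right_mono) (auto simp: s_def)
  qed
  also have "\<dots> \<le> 9" using n by (simp add: s_def power2_eq_square)
  finally have "rad \<sigma> v - rad \<sigma> (proj n v) \<le> 9 / real n"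
    using n by (simp add: rad_def right_diff_distrib sum_subtractf divide_simps)
  also have "9 / real n = 9 * real n powr (- 1)" using n by (simp add: powr_minus_divide)
  also have "\<dots> \<le> 9 * real n powr (- 2/3)"
    using n by (intro mult_left_mono powr_mono) auto
  finally show ?thesis .
qed

theorem offset_rademacher_bound:
  assumes sel: "\<And>\<sigma>. \<sigma> \<in> signs n \<Longrightarrow> v \<sigma> \<in> V"
  shows "sign_avg n (\<lambda>\<sigma>. rad \<sigma> (v \<sigma>) - (\<Sum>i<n. (v \<sigma> i - f i)\<^sup>2) / (8 * real n))
    \<le> (154 * c + 190) * real n powr (- 2/3)"
proof -
  let ?r = "real n powr (- 2/3)"
  let ?top = "\<lambda>\<sigma>. rad \<sigma> (proj 0 (v \<sigma>)) - (\<Sum>i<n. (proj 0 (v \<sigma>) i - f i)\<^sup>2) / (16 * real n)"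
  have "sign_avg n (\<lambda>\<sigma>. rad \<sigma> (v \<sigma>) - (\<Sum>i<n. (v \<sigma> i - f i)\<^sup>2) / (8 * real n))
     \<le> sign_avg n (\<lambda>\<sigma>. ?top \<sigma> + ((\<Sum>k<n. rad \<sigma> (proj (Suc k) (v \<sigma>)) - rad \<sigma> (proj k (v \<sigma>)))
          + 10 * ?r))"
  proof (rule sign_avg_mono)
    fix \<sigma> assume \<sigma>: "\<sigma> \<in> signs n"
    let ?v = "v \<sigma>"
    have "(\<Sum>i<n. (proj 0 ?v i - f i)\<^sup>2) \<le> (\<Sum>i<n. 2 * (?v i - f i)\<^sup>2 + 2 * (?v i - proj 0 ?v i)\<^sup>2)"
    proof (rule sum_mono)
      fix i
      show "(proj 0 ?v i - f i)\<^sup>2 \<le> 2 * (?v i - f i)\<^sup>2 + 2 * (?v i - proj 0 ?v i)\<^sup>2"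
        using square_add_le[of "?v i - f i" "- (?v i - proj 0 ?v i)"] by (simp del: minus_diff_eq)
    qed
    also have "\<dots> = 2 * (\<Sum>i<n. (?v i - f i)\<^sup>2) + 2 * (\<Sum>i<n. (?v i - proj 0 ?v i)\<^sup>2)"
      by (simp add: sum.distrib flip: sum_distrib_left)
    also have "(\<Sum>i<n. (?v i - proj 0 ?v i)\<^sup>2) \<le> 4 * real n / (real m0)\<^sup>2"
      using proj(2)[OF sel[OF \<sigma>], of 0] by (simp add: level_def)
    finally have *: "- (\<Sum>i<n. (?v i - f i)\<^sup>2) / (8 * real n)
        \<le> - (\<Sum>i<n. (proj 0 ?v i - f i)\<^sup>2) / (16 * real n) + (1/2) * (1 / (real m0)\<^sup>2)"
      using n by (simp add: field_simps)
    have "1 / (real m0)\<^sup>2 \<le> 1 / (real n powr (1/3))\<^sup>2"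
      using m0(1) n by (intro divide_left_mono power_mono mult_pos_pos zero_less_power) (use m0_pos in auto)
    also have "\<dots> = ?r" using n by (simp add: powr_power powr_minus_divide)
    finally have "- (\<Sum>i<n. (?v i - f i)\<^sup>2) / (8 * real n)
        \<le> - (\<Sum>i<n. (proj 0 ?v i - f i)\<^sup>2) / (16 * real n) + ?r"
      using * powr_ge_zero[of "real n" "- 2/3"] by linarith
    moreover have "(\<Sum>k<n. rad \<sigma> (proj (Suc k) ?v) - rad \<sigma> (proj k ?v))
        = rad \<sigma> (proj n ?v) - rad \<sigma> (proj 0 ?v)"
      by (rule sum_lessThan_telescope)
    ultimately show "rad \<sigma> ?v - (\<Sum>i<n. (?v i - f i)\<^sup>2) / (8 * real n)
        \<le> ?top \<sigma> + ((\<Sum>k<n. rad \<sigma> (proj (Suc k) ?v) - rad \<sigma> (proj k ?v)) + 10 * ?r)"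
      using bottom_level[OF sel[OF \<sigma>] \<sigma>] by simp
  qed
  also have "\<dots> = sign_avg n ?top
      + ((\<Sum>k<n. sign_avg n (\<lambda>\<sigma>. rad \<sigma> (proj (Suc k) (v \<sigma>)) - rad \<sigma> (proj k (v \<sigma>)))) + 10 * ?r)"
    by (simp only: sign_avg_add sign_avg_sum sign_avg_const)
  also have "\<dots> \<le> 144 * c * ?r + ((\<Sum>k<n. (5 * c + 90) * ?r * (1/2) ^ k) + 10 * ?r)"
    using proj(1)[OF sel, of _ 0]
    by (intro add_mono top_level sum_mono link sel) (auto simp: level_def)
  also have "(\<Sum>k<n. (5 * c + 90) * ?r * (1/2) ^ k) = (5 * c + 90) * ?r * (\<Sum>k<n. (1/2) ^ k)"
    by (simp add: sum_distrib_left)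
  also have "\<dots> \<le> (5 * c + 90) * ?r * 2"
    unfolding sum_gp_strict using c by (intro mult_left_mono) auto
  also have "144 * c * ?r + ((5 * c + 90) * ?r * 2 + 10 * ?r) = (154 * c + 190) * ?r"
    by (simp add: algebra_simps)
  finally show ?thesis by simp
qed

end

section \<open>Symmetrization with an offset\<close>

lemma sign_avg_reflect:
  assumes "\<And>\<sigma> \<tau>. (\<And>i. i < n \<Longrightarrow> \<tau> i = - \<sigma> i) \<Longrightarrow> F \<tau> = G \<sigma>"
  shows "sign_avg n F = sign_avg n G"
proof -
  let ?r = "\<lambda>\<sigma>::nat \<Rightarrow> real. restrict (\<lambda>i. - \<sigma> i) {..<n}"
  have "(\<Sum>\<sigma>\<in>signs n. F \<sigma>) = (\<Sum>\<sigma>\<in>signs n. G \<sigma>)"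
  proof (rule sum.reindex_bij_witness[where i = ?r and j = ?r])
    fix \<sigma> assume \<sigma>: "\<sigma> \<in> signs n"
    have *: "\<sigma> \<in> extensional {..<n}" using \<sigma> by (simp add: signs_def PiE_def)
    show "?r (?r \<sigma>) = \<sigma>" "?r (?r \<sigma>) = \<sigma>"
      using * by (auto simp: fun_eq_iff extensional_def)
    show "?r \<sigma> \<in> signs n" "?r \<sigma> \<in> signs n"
      using \<sigma> by (auto simp: signs_def PiE_iff)
    show "G (?r \<sigma>) = F \<sigma>" by (rule assms[symmetric]) simp
  qed
  then show ?thesis by (simp add: sign_avg_def)
qed

lemma Max_image_add_le:
  fixes F G :: "'v \<Rightarrow> real"
  assumes "finite V" "V \<noteq> {}"
  shows "(MAX v\<in>V. F v + G v) \<le> (MAX v\<in>V. F v) + (MAX v\<in>V. G v)"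
  using assms by (subst Max_le_iff) (auto intro!: add_mono Max_ge)

lemma abs_Max_image_le:
  fixes F :: "'v \<Rightarrow> real"
  assumes "finite V" "V \<noteq> {}" "\<And>v. v \<in> V \<Longrightarrow> \<bar>F v\<bar> \<le> b"
  shows "\<bar>MAX v\<in>V. F v\<bar> \<le> b"
proof -
  have "Max (F ` V) \<in> F ` V" using assms by (intro Max_in) auto
  then obtain v where "v \<in> V" "Max (F ` V) = F v" by blast
  then show ?thesis using assms(3) by simp
qed

lemma (in prob_space) abs_expectation_le:
  fixes g :: "'a \<Rightarrow> real"
  assumes "integrable M g" "\<And>x. x \<in> space M \<Longrightarrow> \<bar>g x\<bar> \<le> b"
  shows "\<bar>expectation g\<bar> \<le> b"
proof -
  have "g x \<le> b" "- b \<le> g x" if "x \<in> space M" for x using assms(2)[OF that] by auto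
  then have "expectation g \<le> expectation (\<lambda>_. b)" "expectation (\<lambda>_. - b) \<le> expectation g"
    by (intro integral_mono assms(1) integrable_const; simp)+
  then show ?thesis by (simp add: prob_space)
qed

text \<open>The expectation under \<open>P\<close> is an average over an independent ghost sample, and the maximum of
averages is at most the average of the maximum. Exchanging point \<open>i\<close> of the sample with its ghost
changes the sign of the difference in \<open>\<psi>\<close>, but not the sum in \<open>e\<close>. The offset must therefore contain
\<open>P e\<close> and \<open>P\<^sub>n e\<close> in equal parts, and then each half of the doubled sample keeps its own empirical offset.
Sample and ghost sample together are a point of the product over \<open>{..<2*n}\<close>, point \<open>i\<close> having
ghost \<open>i + n\<close>.\<close>

lemma offset_symmetrization:
  fixes P :: "'z measure" and \<psi> e :: "'v \<Rightarrow> 'z \<Rightarrow> real"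
  assumes P: "prob_space P" and n: "0 < n" and V: "finite V" "V \<noteq> {}"
    and meas: "\<And>v. v \<in> V \<Longrightarrow> \<psi> v \<in> borel_measurable P" "\<And>v. v \<in> V \<Longrightarrow> e v \<in> borel_measurable P"
    and bdd: "\<And>v z. v \<in> V \<Longrightarrow> z \<in> space P \<Longrightarrow> \<bar>\<psi> v z\<bar> \<le> b"
      "\<And>v z. v \<in> V \<Longrightarrow> z \<in> space P \<Longrightarrow> \<bar>e v z\<bar> \<le> b"
    and rad: "\<And>z. (\<And>i. i < n \<Longrightarrow> z i \<in> space P) \<Longrightarrow>
      sign_avg n (\<lambda>\<sigma>. MAX v\<in>V. (\<Sum>i<n. \<sigma> i * \<psi> v (z i)) / real n - (\<Sum>i<n. e v (z i)) / real n) \<le> B"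
  shows "(\<integral>z. (MAX v\<in>V. (\<integral>x. \<psi> v x \<partial>P) - (\<Sum>i<n. \<psi> v (z i)) / real n
      - ((\<integral>x. e v x \<partial>P) + (\<Sum>i<n. e v (z i)) / real n)) \<partial>PiM {..<n} (\<lambda>_. P)) \<le> 2 * B"
proof -
  let ?D = "\<lambda>z v. (\<integral>x. \<psi> v x \<partial>P) - (\<Sum>i<n. \<psi> v (z i)) / real n
      - ((\<integral>x. e v x \<partial>P) + (\<Sum>i<n. e v (z i)) / real n)"
  interpret P: prob_space P by (rule P)
  interpret PP: product_sigma_finite "\<lambda>_::nat. P"
    by (simp add: product_sigma_finite_def P.sigma_finite_measure_axioms)
  define I J K where "I = {..<n}" and "J = {n..<2*n}" and "K = {..<2*n}"
  have IJ: "I \<inter> J = {}" "finite I" "finite J" "I \<union> J = K" "finite K"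
    by (auto simp: I_def J_def K_def)
  let ?PI = "PiM I (\<lambda>_. P)" and ?PJ = "PiM J (\<lambda>_. P)" and ?PK = "PiM K (\<lambda>_. P)"
  interpret D: prob_space "?PK" by (rule prob_space_PiM) (rule P)
  interpret DI: prob_space "?PI" by (rule prob_space_PiM) (rule P)
  interpret DJ: prob_space "?PJ" by (rule prob_space_PiM) (rule P)
  note meas[measurable]
  have b: "0 \<le> b"
    using V bdd(1) P.not_empty by (metis abs_ge_zero all_not_in_conv order_trans)
  define H where "H z = (MAX v\<in>V. (\<Sum>i<n. (\<psi> v (z (i + n)) - \<psi> v (z i)) - (e v (z (i + n)) + e v (z i))) / real n)"
    for z :: "nat \<Rightarrow> 'z"
  define L where "L z = (MAX v\<in>V. ?D z v)" for z
  have comp: "(\<lambda>z. g (z i)) \<in> borel_measurable (PiM A (\<lambda>_. P))"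
    if "g \<in> borel_measurable P" "i \<in> A" for g :: "'z \<Rightarrow> real" and i :: nat and A
    using measurable_component_singleton[OF that(2), of "\<lambda>_. P"] that(1) by (rule measurable_compose)
  have H_meas: "H \<in> borel_measurable ?PK"
    unfolding H_def using meas V
    by (intro borel_measurable_Max borel_measurable_divide borel_measurable_sum
        borel_measurable_diff borel_measurable_add comp borel_measurable_const) (auto simp: K_def)
  have L_meas: "L \<in> borel_measurable ?PI"
    unfolding L_def using meas V
    by (intro borel_measurable_Max borel_measurable_divide borel_measurable_sum
        borel_measurable_diff borel_measurable_add comp borel_measurable_const) (auto simp: I_def)
  have avg_bdd: "\<bar>(\<Sum>i<n. g i) / real n\<bar> \<le> c" if "\<And>i. i < n \<Longrightarrow> \<bar>g i\<bar> \<le> c" for g and c :: real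
  proof -
    have "\<bar>\<Sum>i<n. g i\<bar> \<le> (\<Sum>i<n. c)" by (rule order_trans[OF sum_abs sum_mono]) (use that in auto)
    then show ?thesis using n by (simp add: field_simps)
  qed
  have H_bdd: "\<bar>H z\<bar> \<le> 4 * b" if "\<And>k. k \<in> K \<Longrightarrow> z k \<in> space P" for z
    unfolding H_def
  proof (intro abs_Max_image_le V avg_bdd)
    fix v i assume "v \<in> V" "i < n"
    then have "z i \<in> space P" "z (i + n) \<in> space P" using that by (auto simp: K_def)
    then show "\<bar>\<psi> v (z (i + n)) - \<psi> v (z i) - (e v (z (i + n)) + e v (z i))\<bar> \<le> 4 * b"
      using bdd[OF \<open>v \<in> V\<close>, of "z i"] bdd[OF \<open>v \<in> V\<close>, of "z (i + n)"] by linarith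
  qed
  have int_bdd: "\<bar>\<integral>x. g x \<partial>P\<bar> \<le> b" if "\<And>x. x \<in> space P \<Longrightarrow> \<bar>g x\<bar> \<le> b" "g \<in> borel_measurable P" for g
  proof -
    have "integrable P g" by (rule P.integrable_const_bound[where B = b]) (use that in auto)
    then show ?thesis using that(1) by (rule P.abs_expectation_le)
  qed
  have L_bdd: "\<bar>L z\<bar> \<le> 4 * b" if "\<And>i. i \<in> I \<Longrightarrow> z i \<in> space P" for z
    unfolding L_def
  proof (intro abs_Max_image_le V)
    fix v assume v: "v \<in> V"
    have "\<bar>\<integral>x. \<psi> v x \<partial>P\<bar> \<le> b" "\<bar>\<integral>x. e v x \<partial>P\<bar> \<le> b"
      by (rule int_bdd; use bdd v meas in simp)+
    moreover have "\<bar>(\<Sum>i<n. \<psi> v (z i)) / real n\<bar> \<le> b" "\<bar>(\<Sum>i<n. e v (z i)) / real n\<bar> \<le> b"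
      by (rule avg_bdd; use bdd v that in \<open>simp add: I_def\<close>)+
    ultimately show "\<bar>?D z v\<bar> \<le> 4 * b" by linarith
  qed
  have H_int: "integrable ?PK H"
    by (rule D.integrable_const_bound[where B = "4 * b"])
      (auto intro!: AE_I2 H_bdd H_meas simp: space_PiM)
  have L_int: "integrable ?PI L"
    by (rule DI.integrable_const_bound[where B = "4 * b"])
      (auto intro!: AE_I2 L_bdd L_meas simp: space_PiM)

  have merge_section: "integrable ?PJ (\<lambda>y. H (merge I J (x, y)))"
      "\<And>y. y \<in> space ?PJ \<Longrightarrow> \<bar>H (merge I J (x, y))\<bar> \<le> 4 * b"
    if x: "x \<in> space ?PI" for x
  proof -
    show bd: "\<bar>H (merge I J (x, y))\<bar> \<le> 4 * b" if "y \<in> space ?PJ" for y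
      using x that by (intro H_bdd) (auto simp: merge_def space_PiM PiE_iff IJ(4)[symmetric])
    have "(\<lambda>y. merge I J (x, y)) \<in> ?PJ \<rightarrow>\<^sub>M ?PK"
      unfolding IJ(4)[symmetric]
      by (rule measurable_compose[OF measurable_Pair1'[OF x] measurable_merge])
    then have "(\<lambda>y. H (merge I J (x, y))) \<in> borel_measurable ?PJ"
      using H_meas by (rule measurable_compose)
    then show "integrable ?PJ (\<lambda>y. H (merge I J (x, y)))"
      by (intro DJ.integrable_const_bound[where B = "4 * b"]) (auto intro!: AE_I2 bd)
  qed

  have ghost: "L x \<le> (\<integral>y. H (merge I J (x, y)) \<partial>?PJ)" if x: "x \<in> space ?PI" for x
    unfolding L_def
  proof (subst Max_le_iff, (use V in auto)[2], safe)
    fix v assume v: "v \<in> V"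
    have m1: "merge I J (x, y) i = x i" "merge I J (x, y) (i + n) = y (i + n)" if "i < n" for y i
      using that by (auto simp: merge_def I_def J_def)
    define S where "S y = (\<Sum>i<n. (\<psi> v (y (i + n)) - \<psi> v (x i)) - (e v (y (i + n)) + e v (x i))) / real n" for y
    have coord: "integrable ?PJ (\<lambda>y. g (y (i + n)))"
        "(\<integral>y. g (y (i + n)) \<partial>?PJ) = (\<integral>z. g z \<partial>P)"
      if "i < n" "\<And>z. z \<in> space P \<Longrightarrow> \<bar>g z\<bar> \<le> b" "g \<in> borel_measurable P" for g i
    proof -
      have iJ: "i + n \<in> J" using that by (simp add: J_def)
      have d: "distr ?PJ P (\<lambda>y. y (i + n)) = P"
        by (rule distr_PiM_component) (use iJ P in auto)
      have "integrable P g" by (rule P.integrable_const_bound[where B = b]) (use that in auto)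
      then have "integrable (distr ?PJ P (\<lambda>y. y (i + n))) g" by (simp only: d)
      then show "integrable ?PJ (\<lambda>y. g (y (i + n)))"
        by (rule integrable_distr[rotated]) (rule measurable_component_singleton[OF iJ])
      have "(\<integral>z. g z \<partial>P) = (\<integral>z. g z \<partial>distr ?PJ P (\<lambda>y. y (i + n)))" by (simp only: d)
      also have "\<dots> = (\<integral>y. g (y (i + n)) \<partial>?PJ)"
        by (rule integral_distr[OF measurable_component_singleton[OF iJ] that(3)])
      finally show "(\<integral>y. g (y (i + n)) \<partial>?PJ) = (\<integral>z. g z \<partial>P)" ..
    qed
    have c\<psi>: "integrable ?PJ (\<lambda>y. \<psi> v (y (i + n)))"
        "(\<integral>y. \<psi> v (y (i + n)) \<partial>?PJ) = (\<integral>z. \<psi> v z \<partial>P)" if "i < n" for i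
      by (rule coord; use that bdd v meas in simp)+
    have ce: "integrable ?PJ (\<lambda>y. e v (y (i + n)))"
        "(\<integral>y. e v (y (i + n)) \<partial>?PJ) = (\<integral>z. e v z \<partial>P)" if "i < n" for i
      by (rule coord; use that bdd v meas in simp)+
    have S_int: "integrable ?PJ S"
      unfolding S_def using c\<psi>(1) ce(1)
      by (intro Bochner_Integration.integrable_divide Bochner_Integration.integrable_sum
          Bochner_Integration.integrable_diff Bochner_Integration.integrable_add DJ.integrable_const) auto
    have "(\<integral>y. S y \<partial>?PJ) = (\<Sum>i<n. ((\<integral>x. \<psi> v x \<partial>P) - \<psi> v (x i))
          - ((\<integral>x. e v x \<partial>P) + e v (x i))) / real n"
      unfolding S_def using c\<psi> ce
      by (simp add: Bochner_Integration.integral_sum Bochner_Integration.integral_diff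
          Bochner_Integration.integral_add DJ.prob_space)
    also have "\<dots> = ?D x v"
      using n by (simp add: sum_subtractf sum.distrib field_simps)
    finally have "?D x v = (\<integral>y. S y \<partial>?PJ)" ..
    also have "\<dots> \<le> (\<integral>y. H (merge I J (x, y)) \<partial>?PJ)"
    proof (rule integral_mono[OF S_int merge_section(1)[OF x]])
      fix y
      have "S y = (\<Sum>i<n. (\<psi> v (merge I J (x, y) (i + n)) - \<psi> v (merge I J (x, y) i))
          - (e v (merge I J (x, y) (i + n)) + e v (merge I J (x, y) i))) / real n"
        unfolding S_def by (intro arg_cong2[where f = "(/)"] sum.cong refl) (simp add: m1)
      also have "\<dots> \<le> H (merge I J (x, y))"
        unfolding H_def using V v by (intro Max_ge) auto
      finally show "S y \<le> H (merge I J (x, y))" .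
    qed
    finally show "?D x v
      \<le> (\<integral>y. H (merge I J (x, y)) \<partial>?PJ)" .
  qed
  have merge_bdd: "\<bar>\<integral>y. H (merge I J (x, y)) \<partial>?PJ\<bar> \<le> 4 * b"
    if "x \<in> space ?PI" for x
    by (rule DJ.abs_expectation_le[OF merge_section[OF that]])
  have "(\<integral>z. L z \<partial>?PI) \<le> (\<integral>x. (\<integral>y. H (merge I J (x, y)) \<partial>?PJ) \<partial>?PI)"
  proof (rule integral_mono[OF L_int _ ghost])
    have "(\<lambda>(x, y). H (merge I J (x, y))) \<in> borel_measurable (?PI \<Otimes>\<^sub>M ?PJ)"
      using measurable_compose[OF measurable_merge H_meas[folded IJ(4)]] by (simp add: case_prod_beta')
    then have "(\<lambda>x. \<integral>y. H (merge I J (x, y)) \<partial>?PJ) \<in> borel_measurable ?PI"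
      by (rule DJ.borel_measurable_lebesgue_integral)
    then show "integrable ?PI (\<lambda>x. \<integral>y. H (merge I J (x, y)) \<partial>?PJ)"
      by (intro DI.integrable_const_bound[where B = "4 * b"]) (auto intro!: AE_I2 merge_bdd)
  qed
  also have "\<dots> = (\<integral>z. H z \<partial>?PK)"
    using PP.product_integral_fold[OF IJ(1-3), of H] H_int by (simp add: IJ(4))
  also have "\<dots> \<le> 2 * B"
  proof -
    \<comment> \<open>\<open>\<tau> \<sigma>\<close> exchanges \<open>i\<close> with its ghost \<open>i + n\<close> whenever \<open>\<sigma> i = - 1\<close>.\<close>
    define \<tau> where "\<tau> \<sigma> k = (if k < n then (if \<sigma> k = - 1 then k + n else k)
        else (if \<sigma> (k - n) = - 1 then k - n else k))" for \<sigma> :: "nat \<Rightarrow> real" and k :: nat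
    have \<tau>K: "\<tau> \<sigma> \<in> K \<rightarrow> K" for \<sigma> by (auto simp: \<tau>_def K_def)
    have \<tau>2: "\<tau> \<sigma> (\<tau> \<sigma> k) = k" if "k \<in> K" for \<sigma> k using that by (auto simp: \<tau>_def K_def)
    have \<tau>inj: "inj_on (\<tau> \<sigma>) K" for \<sigma> by (rule inj_on_inverseI[of _ "\<tau> \<sigma>"]) (rule \<tau>2)
    define R where "R \<sigma> z = restrict (\<lambda>k. z (\<tau> \<sigma> k)) K" for \<sigma> and z :: "nat \<Rightarrow> 'z"
    have R_distr: "distr ?PK ?PK (R \<sigma>) = ?PK" for \<sigma>
      unfolding R_def by (rule distr_PiM_reindex[OF _ \<tau>inj \<tau>K]) (rule P)
    have R_meas: "R \<sigma> \<in> ?PK \<rightarrow>\<^sub>M ?PK" for \<sigma>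
      unfolding R_def using \<tau>K
      by (intro measurable_restrict measurable_component_singleton) auto
    have H_R: "(\<integral>z. H z \<partial>?PK) = (\<integral>z. H (R \<sigma> z) \<partial>?PK)" for \<sigma>
      using integral_distr[OF R_meas[of \<sigma>] H_meas] by (simp add: R_distr)
    have HR_int: "integrable ?PK (\<lambda>z. H (R \<sigma> z))" for \<sigma>
      by (rule integrable_distr[OF R_meas]) (simp add: R_distr H_int)
    have "(\<integral>z. H z \<partial>?PK) = sign_avg n (\<lambda>\<sigma>. \<integral>z. H (R \<sigma> z) \<partial>?PK)"
      by (simp flip: H_R)
    also have "\<dots> = (\<integral>z. sign_avg n (\<lambda>\<sigma>. H (R \<sigma> z)) \<partial>?PK)"
      unfolding sign_avg_def using HR_int by simp
    also have "\<dots> \<le> (\<integral>z. 2 * B \<partial>?PK)"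
    proof (rule integral_mono)
      show "integrable ?PK (\<lambda>z. sign_avg n (\<lambda>\<sigma>. H (R \<sigma> z)))"
        unfolding sign_avg_def using HR_int by simp
      fix z assume z: "z \<in> space ?PK"
      let ?G = "\<lambda>z \<sigma>. MAX v\<in>V. (\<Sum>i<n. \<sigma> i * \<psi> v (z i)) / real n - (\<Sum>i<n. e v (z i)) / real n"
      have "sign_avg n (\<lambda>\<sigma>. H (R \<sigma> z)) \<le> sign_avg n (\<lambda>\<sigma>. ?G (\<lambda>i. z (i + n)) \<sigma> + ?G z (\<lambda>i. - \<sigma> i))"
      proof (rule sign_avg_mono)
        fix \<sigma> assume "\<sigma> \<in> signs n"
        then have \<sigma>: "\<sigma> i = 1 \<or> \<sigma> i = - 1" if "i < n" for i
          using that by (auto simp: signs_def PiE_iff)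
        have RR: "R \<sigma> z i = z (\<tau> \<sigma> i)" "R \<sigma> z (i + n) = z (\<tau> \<sigma> (i + n))" if "i < n" for i
          using that by (auto simp: R_def K_def)
        have "H (R \<sigma> z) = (MAX v\<in>V. ((\<Sum>i<n. \<sigma> i * \<psi> v (z (i + n))) / real n - (\<Sum>i<n. e v (z (i + n))) / real n)
           + ((\<Sum>i<n. - \<sigma> i * \<psi> v (z i)) / real n - (\<Sum>i<n. e v (z i)) / real n))"
          unfolding H_def
        proof (intro arg_cong[where f = Max] image_cong refl)
          fix v assume "v \<in> V"
          have "(\<Sum>i<n. \<psi> v (R \<sigma> z (i + n)) - \<psi> v (R \<sigma> z i) - (e v (R \<sigma> z (i + n)) + e v (R \<sigma> z i)))
            = (\<Sum>i<n. \<sigma> i * \<psi> v (z (i + n)) - \<sigma> i * \<psi> v (z i) - (e v (z (i + n)) + e v (z i)))"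
          proof (rule sum.cong)
            fix i assume "i \<in> {..<n}"
            then have i: "i < n" by simp
            show "\<psi> v (R \<sigma> z (i + n)) - \<psi> v (R \<sigma> z i) - (e v (R \<sigma> z (i + n)) + e v (R \<sigma> z i))
              = \<sigma> i * \<psi> v (z (i + n)) - \<sigma> i * \<psi> v (z i) - (e v (z (i + n)) + e v (z i))"
              using \<sigma>[OF i] i by (auto simp: RR \<tau>_def)
          qed simp
          then show "(\<Sum>i<n. \<psi> v (R \<sigma> z (i + n)) - \<psi> v (R \<sigma> z i) - (e v (R \<sigma> z (i + n)) + e v (R \<sigma> z i))) / real n
            = ((\<Sum>i<n. \<sigma> i * \<psi> v (z (i + n))) / real n - (\<Sum>i<n. e v (z (i + n))) / real n)
           + ((\<Sum>i<n. - \<sigma> i * \<psi> v (z i)) / real n - (\<Sum>i<n. e v (z i)) / real n)"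
            by (simp add: sum_subtractf sum.distrib sum_negf diff_divide_distrib add_divide_distrib)
        qed
        also have "\<dots> \<le> ?G (\<lambda>i. z (i + n)) \<sigma> + ?G z (\<lambda>i. - \<sigma> i)"
          by (rule Max_image_add_le[OF V])
        finally show "H (R \<sigma> z) \<le> ?G (\<lambda>i. z (i + n)) \<sigma> + ?G z (\<lambda>i. - \<sigma> i)" .
      qed
      also have "\<dots> = sign_avg n (?G (\<lambda>i. z (i + n))) + sign_avg n (?G z)"
        unfolding sign_avg_add
        by (intro arg_cong2[where f = "(+)"] refl sign_avg_reflect) (auto intro!: arg_cong[where f = Max] image_cong)
      also have "\<dots> \<le> B + B"
        using z by (intro add_mono rad) (auto simp: space_PiM K_def PiE_iff)
      finally show "sign_avg n (\<lambda>\<sigma>. H (R \<sigma> z)) \<le> 2 * B" by simp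
    qed simp
    also have "\<dots> = 2 * B" by (simp add: D.prob_space)
    finally show ?thesis .
  qed
  finally show ?thesis by (simp add: L_def I_def)
qed

section \<open>Ridge classes\<close>

lemma ridge_class_net:
  fixes z :: "nat \<Rightarrow> 'z" and W U :: "('z \<Rightarrow> real) set"
  assumes n: "0 < n" and m: "0 < m" and U: "finite U"
    and ridge: "\<And>v. v \<in> W \<Longrightarrow>
      \<exists>u\<in>U. \<exists>w. antimono w \<and> (\<forall>t. w t \<in> {0..1::real}) \<and> v = (\<lambda>x. w (u x))"
  obtains T where "finite T" "card T \<le> card U * 2 ^ (5 * m + 1)"
    "\<And>g i. g \<in> T \<Longrightarrow> i < n \<Longrightarrow> g i \<in> {0..1}"
    "\<And>v. v \<in> W \<Longrightarrow> \<exists>g\<in>T. (\<Sum>i<n. (v (z i) - g i)\<^sup>2) \<le> 4 * real n / (real m)\<^sup>2"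
proof -
  define good where "good u T \<longleftrightarrow> finite T \<and> card T \<le> 2 ^ (5 * m + 1) \<and>
      (\<forall>g\<in>T. \<forall>i<n. g i \<in> {0..1}) \<and>
      (\<forall>w. antimono w \<longrightarrow> (\<forall>t. w t \<in> {0..1::real}) \<longrightarrow>
        (\<exists>g\<in>T. (\<Sum>i<n. (w (u (z i)) - g i)\<^sup>2) \<le> 4 * real n / (real m)\<^sup>2))"
    for u :: "'z \<Rightarrow> real" and T
  have "\<exists>T. good u T" for u
    by (rule antitone_of_score_net[OF n m, of "\<lambda>i. u (z i)"]) (unfold good_def, blast)
  then obtain T where "\<And>u. good u (T u)" by metis
  then have T: "finite (T u)" "card (T u) \<le> 2 ^ (5 * m + 1)"
    "g \<in> T u \<Longrightarrow> i < n \<Longrightarrow> g i \<in> {0..1}"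
    "antimono w \<Longrightarrow> (\<And>t. w t \<in> {0..1::real}) \<Longrightarrow>
        \<exists>g\<in>T u. (\<Sum>i<n. (w (u (z i)) - g i)\<^sup>2) \<le> 4 * real n / (real m)\<^sup>2" for u g i w
    unfolding good_def by blast+
  show thesis
  proof (rule that)
    show "finite (\<Union>u\<in>U. T u)" using U T(1) by blast
    have "card (\<Union>u\<in>U. T u) \<le> (\<Sum>u\<in>U. card (T u))" by (rule card_UN_le[OF U])
    also have "\<dots> \<le> (\<Sum>u\<in>U. 2 ^ (5 * m + 1))" by (rule sum_mono) (rule T(2))
    finally show "card (\<Union>u\<in>U. T u) \<le> card U * 2 ^ (5 * m + 1)" by simp
    show "g i \<in> {0..1}" if "g \<in> (\<Union>u\<in>U. T u)" "i < n" for g i using that T(3) by blast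
    fix v assume "v \<in> W"
    from ridge[OF this] obtain u w where uw: "u \<in> U" "antimono w" "\<And>t. w t \<in> {0..1}" "v = (\<lambda>x. w (u x))"
      by blast
    from T(4)[OF uw(2,3), of u] uw(1)
    show "\<exists>g\<in>(\<Union>u\<in>U. T u). (\<Sum>i<n. (v (z i) - g i)\<^sup>2) \<le> 4 * real n / (real m)\<^sup>2"
      unfolding uw(4) by blast
  qed
qed

text \<open>The nets of the single scores are united, and the vector of \<open>f0\<close> itself is added, because \<open>f0\<close> is a
candidate of its own: its presence makes the maxima below nonnegative. Together with the number of scores this
changes the constant in the log-cardinality to \<open>a + 7\<close>. The function \<open>\<psi>\<close> is Lipschitz with constant
\<open>3\<close>, of which \<open>2\<close> comes from \<open>\<phi>\<close> and the rest from the square.\<close>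

lemma sample_rademacher_bound:
  fixes z :: "nat \<Rightarrow> 'z" and W U :: "('z \<Rightarrow> real) set" and \<phi> :: "'z \<Rightarrow> real \<Rightarrow> real"
  assumes n: "0 < n" and U: "finite U"
    and cardU: "real (card U) \<le> exp (a * real n powr (1/3))" and a: "0 \<le> a"
    and W: "\<And>v x. v \<in> W \<Longrightarrow> v x \<in> {0..1}" and f0: "\<And>x. f0 x \<in> {0..1}"
    and ridge: "\<And>v. v \<in> W \<Longrightarrow>
      \<exists>u\<in>U. \<exists>w. antimono w \<and> (\<forall>t. w t \<in> {0..1::real}) \<and> v = (\<lambda>x. w (u x))"
    and lip: "\<And>x s t. s \<in> {0..1} \<Longrightarrow> t \<in> {0..1} \<Longrightarrow> \<bar>\<phi> x s - \<phi> x t\<bar> \<le> 2 * \<bar>s - t\<bar>"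
    and zero: "\<And>x. \<phi> x (f0 x) = 0"
    and sel: "\<And>\<sigma>. \<sigma> \<in> signs n \<Longrightarrow> v \<sigma> \<in> insert f0 W"
  shows "sign_avg n (\<lambda>\<sigma>. (\<Sum>i<n. \<sigma> i * (\<phi> (z i) (v \<sigma> (z i)) - (v \<sigma> (z i) - f0 (z i))\<^sup>2 / 8)) / real n
      - (\<Sum>i<n. (v \<sigma> (z i) - f0 (z i))\<^sup>2 / 8) / real n) \<le> (154 * a + 1268) * real n powr (- 2/3)"
proof -
  define m0 where "m0 = nat \<lceil>real n powr (1/3)\<rceil>"
  have root: "1 \<le> real n powr (1/3)" using n by (simp add: ge_one_powr_ge_zero)
  have m0: "real n powr (1/3) \<le> real m0" "real m0 \<le> 2 * real n powr (1/3)"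
    using root unfolding m0_def by linarith+
  define good where "good m T \<longleftrightarrow> finite T \<and> real (card T) \<le> exp ((a + 7) * real m) \<and>
      (\<forall>g\<in>T. \<forall>i<n. g i \<in> {0..1}) \<and>
      (\<forall>v\<in>insert f0 W. \<exists>g\<in>T. (\<Sum>i<n. (v (z i) - g i)\<^sup>2) \<le> 4 * real n / (real m)\<^sup>2)"
    for m :: nat and T
  have "\<exists>T. good m T"
    if m: "m0 \<le> m" for m
  proof -
    have m1: "1 \<le> real m" "real n powr (1/3) \<le> real m" using m m0 root by linarith+
    then have "0 < m" by simp
    obtain T where T: "finite T" "card T \<le> card U * 2 ^ (5 * m + 1)"
      "\<And>g i. g \<in> T \<Longrightarrow> i < n \<Longrightarrow> g i \<in> {0..1}"
      "\<And>v. v \<in> W \<Longrightarrow> \<exists>g\<in>T. (\<Sum>i<n. (v (z i) - g i)\<^sup>2) \<le> 4 * real n / (real m)\<^sup>2"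
      by (rule ridge_class_net[OF n \<open>0 < m\<close> U ridge, of W z]) auto
    let ?T = "insert (\<lambda>i. f0 (z i)) T"
    have 2: "(2::real) ^ k \<le> exp (real k)" for k
    proof -
      have "(2::real) ^ k \<le> exp 1 ^ k" using exp_ge_add_one_self[of 1] by (intro power_mono) auto
      then show ?thesis by (simp flip: exp_of_nat_mult)
    qed
    have "real (card ?T) \<le> 1 + real (card T)"
      using card_insert_le_m1[of "Suc (card T)" T "\<lambda>i. f0 (z i)"] T(1) by (simp add: card_insert_if)
    also have "real (card T) \<le> real (card U) * 2 ^ (5 * m + 1)"
      using of_nat_mono[OF T(2), where 'a = real] by simp
    also have "\<dots> \<le> exp (a * real m) * exp (real (5 * m + 1))"
    proof (intro mult_mono 2)
      show "real (card U) \<le> exp (a * real m)"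
        using cardU mult_left_mono[OF m1(2) a] exp_le_cancel_iff order_trans by blast
    qed auto
    also have "1 + \<dots> \<le> exp (a * real m) * exp (real (5 * m + 1)) + exp (a * real m) * exp (real (5 * m + 1))"
      using a by (intro add_mono order_refl) (simp flip: exp_add)
    also have "\<dots> \<le> exp 1 * (exp (a * real m) * exp (real (5 * m + 1)))"
      using mult_right_mono[of 2 "exp 1" "exp (a * real m) * exp (real (5 * m + 1))"]
        exp_ge_add_one_self[of 1] by simp
    also have "\<dots> = exp (a * real m + 5 * real m + 2)" by (simp flip: exp_add)
    also have "\<dots> \<le> exp ((a + 7) * real m)" using m1 by (simp add: algebra_simps)
    finally have "real (card ?T) \<le> exp ((a + 7) * real m)" by simp
    moreover have "\<forall>v\<in>insert f0 W. \<exists>g\<in>?T. (\<Sum>i<n. (v (z i) - g i)\<^sup>2) \<le> 4 * real n / (real m)\<^sup>2"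
      using T(4) by auto
    ultimately show ?thesis using T(1,3) f0 unfolding good_def by (intro exI[of _ ?T]) auto
  qed
  then obtain net where "\<And>m. m0 \<le> m \<Longrightarrow> good m (net m)" by metis
  then have net: "m0 \<le> m \<Longrightarrow> finite (net m)"
    "m0 \<le> m \<Longrightarrow> real (card (net m)) \<le> exp ((a + 7) * real m)"
    "m0 \<le> m \<Longrightarrow> g \<in> net m \<Longrightarrow> i < n \<Longrightarrow> g i \<in> {0..1}"
    "m0 \<le> m \<Longrightarrow> v \<in> insert f0 W \<Longrightarrow>
      \<exists>g\<in>net m. (\<Sum>i<n. (v (z i) - g i)\<^sup>2) \<le> 4 * real n / (real m)\<^sup>2" for m g i v
    unfolding good_def by blast+
  let ?\<psi> = "\<lambda>i s. \<phi> (z i) s - (s - f0 (z i))\<^sup>2 / 8"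
  interpret rademacher_chain n "(\<lambda>v i. v (z i)) ` insert f0 W" net "a + 7" "\<lambda>i. f0 (z i)" ?\<psi> m0
  proof
    fix i and s t :: real assume st: "s \<in> {0..1}" "t \<in> {0..1}"
    have "\<bar>(s - f0 (z i))\<^sup>2 / 8 - (t - f0 (z i))\<^sup>2 / 8\<bar> = \<bar>s - t\<bar> * \<bar>s + t - 2 * f0 (z i)\<bar> / 8"
      unfolding abs_mult[symmetric] by (simp add: power2_eq_square algebra_simps flip: diff_divide_distrib)
    also have "\<dots> \<le> \<bar>s - t\<bar> * 4 / 8"
      using st f0[of "z i"] by (intro divide_right_mono mult_left_mono) auto
    finally show "\<bar>?\<psi> i s - ?\<psi> i t\<bar> \<le> 3 * \<bar>s - t\<bar>" using lip[OF st, of "z i"] by linarith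
  qed (use n a m0 net W f0 zero in auto)
  have "sign_avg n (\<lambda>\<sigma>. rad \<sigma> (\<lambda>i. v \<sigma> (z i))
      - (\<Sum>i<n. (v \<sigma> (z i) - f0 (z i))\<^sup>2) / (8 * real n)) \<le> (154 * (a + 7) + 190) * real n powr (- 2/3)"
    using offset_rademacher_bound[of "\<lambda>\<sigma> i. v \<sigma> (z i)"] sel by blast
  then show ?thesis by (simp add: rad_def sum_divide_distrib algebra_simps)
qed

text \<open>One eighth of the squared distance is moved into the process: for \<open>E = (v - f0)\<^sup>2\<close>,
\<open>(P - P\<^sub>n) \<phi> - P E / 4 = (P - P\<^sub>n) (\<phi> - E / 8) - (P E + P\<^sub>n E) / 8\<close>, which is the balanced
offset that the symmetrization requires.\<close>

theorem expected_offset_max: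
  fixes P :: "'z measure" and W U :: "('z \<Rightarrow> real) set" and \<phi> :: "'z \<Rightarrow> real \<Rightarrow> real"
  assumes P: "prob_space P" and n: "0 < n" and U: "finite U"
    and cardU: "real (card U) \<le> exp (a * real n powr (1/3))" and a: "0 \<le> a"
    and W: "finite W" "\<And>v x. v \<in> W \<Longrightarrow> v x \<in> {0..1}" "\<And>v. v \<in> W \<Longrightarrow> v \<in> borel_measurable P"
    and f0: "\<And>x. f0 x \<in> {0..1}" "f0 \<in> borel_measurable P"
    and ridge: "\<And>v. v \<in> W \<Longrightarrow>
      \<exists>u\<in>U. \<exists>w. antimono w \<and> (\<forall>t. w t \<in> {0..1::real}) \<and> v = (\<lambda>x. w (u x))"
    and \<phi>: "\<And>v. v \<in> insert f0 W \<Longrightarrow> (\<lambda>x. \<phi> x (v x)) \<in> borel_measurable P"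
    and lip: "\<And>x s t. s \<in> {0..1} \<Longrightarrow> t \<in> {0..1} \<Longrightarrow> \<bar>\<phi> x s - \<phi> x t\<bar> \<le> 2 * \<bar>s - t\<bar>"
    and zero: "\<And>x. \<phi> x (f0 x) = 0"
  shows "(\<integral>z. (MAX v\<in>insert f0 W. (\<integral>x. \<phi> x (v x) \<partial>P) - (\<Sum>i<n. \<phi> (z i) (v (z i))) / real n
      - (\<integral>x. (v x - f0 x)\<^sup>2 \<partial>P) / 4) \<partial>PiM {..<n} (\<lambda>_. P)) \<le> (308 * a + 2536) * real n powr (- 2/3)"
proof -
  interpret P: prob_space P by (rule P)
  define V where "V = insert f0 W"
  have V: "finite V" "V \<noteq> {}" using W by (auto simp: V_def)
  have V01: "v x \<in> {0..1}" if "v \<in> V" for v x using that W f0 by (auto simp: V_def)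
  have Vm: "v \<in> borel_measurable P" if "v \<in> V" for v using that W f0 by (auto simp: V_def)
  define e where "e v x = (v x - f0 x)\<^sup>2 / 8" for v x
  define \<psi> where "\<psi> v x = \<phi> x (v x) - e v x" for v x
  define B where "B = (154 * a + 1268) * real n powr (- 2/3)"
  have e1: "\<bar>e v x\<bar> \<le> 1" if "v \<in> V" for v x
  proof -
    have "(v x - f0 x)\<^sup>2 \<le> 1" using V01[OF that, of x] f0(1)[of x] by (simp add: abs_square_le_1 abs_le_iff)
    then show ?thesis by (simp add: e_def)
  qed
  have \<phi>2: "\<bar>\<phi> x (v x)\<bar> \<le> 2" if "v \<in> V" for v x
  proof -
    have "\<bar>v x - f0 x\<bar> \<le> 1" using V01[OF that, of x] f0(1)[of x] by (auto simp: abs_le_iff)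
    then show ?thesis using lip[OF V01[OF that] f0(1), of x x x] unfolding zero by simp
  qed
  have em: "e v \<in> borel_measurable P" if "v \<in> V" for v
    unfolding e_def[abs_def] using Vm[OF that] f0(2) by measurable
  have \<phi>m: "(\<lambda>x. \<phi> x (v x)) \<in> borel_measurable P" if "v \<in> V" for v
    using \<phi> that by (simp add: V_def)
  have e_int: "integrable P (e v)" and \<phi>_int: "integrable P (\<lambda>x. \<phi> x (v x))" if "v \<in> V" for v
    by (rule P.integrable_const_bound[where B = 1] P.integrable_const_bound[where B = 2];
        use em[OF that] \<phi>m[OF that] e1[OF that] \<phi>2[OF that] in simp)+
  have "(\<integral>z. (MAX v\<in>V. (\<integral>x. \<psi> v x \<partial>P) - (\<Sum>i<n. \<psi> v (z i)) / real n
      - ((\<integral>x. e v x \<partial>P) + (\<Sum>i<n. e v (z i)) / real n)) \<partial>PiM {..<n} (\<lambda>_. P)) \<le> 2 * B"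
  proof (rule offset_symmetrization[OF P n V, where b = 3])
    fix v assume v: "v \<in> V"
    show "\<psi> v \<in> borel_measurable P" unfolding \<psi>_def[abs_def] using em[OF v] \<phi>m[OF v] by measurable
    show "e v \<in> borel_measurable P" by (rule em[OF v])
    show "\<bar>\<psi> v x\<bar> \<le> 3" "\<bar>e v x\<bar> \<le> 3" for x using e1[OF v, of x] \<phi>2[OF v, of x] by (auto simp: \<psi>_def)
  next
    fix z :: "nat \<Rightarrow> 'z"
    let ?G = "\<lambda>\<sigma> v. (\<Sum>i<n. \<sigma> i * \<psi> v (z i)) / real n - (\<Sum>i<n. e v (z i)) / real n"
    define best where "best \<sigma> v \<longleftrightarrow> v \<in> V \<and> (MAX v\<in>V. ?G \<sigma> v) = ?G \<sigma> v" for \<sigma> v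
    have "\<exists>v. best \<sigma> v" for \<sigma>
    proof -
      have "(MAX v\<in>V. ?G \<sigma> v) \<in> ?G \<sigma> ` V" using V by (intro Max_in) auto
      then show ?thesis unfolding best_def by blast
    qed
    then obtain v where "\<And>\<sigma>. best \<sigma> (v \<sigma>)" by metis
    then have v: "v \<sigma> \<in> V" "(MAX v\<in>V. ?G \<sigma> v) = ?G \<sigma> (v \<sigma>)" for \<sigma>
      unfolding best_def by blast+
    have "sign_avg n (\<lambda>\<sigma>. MAX v\<in>V. ?G \<sigma> v) = sign_avg n (\<lambda>\<sigma>. ?G \<sigma> (v \<sigma>))"
      by (rule arg_cong[where f = "sign_avg n"]) (rule ext, rule v(2))
    also have "\<dots> \<le> B"
      unfolding B_def \<psi>_def e_def
    proof (rule sample_rademacher_bound[where W = W and U = U and \<phi> = \<phi> and ?f0.0 = f0 and v = v and z = z])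
      show "v \<sigma> \<in> insert f0 W" for \<sigma> using v(1)[of \<sigma>] by (simp add: V_def)
    qed (fact n U cardU a W(2) f0(1) zero | erule ridge | erule (1) lip)+
    finally show "sign_avg n (\<lambda>\<sigma>. MAX v\<in>V. ?G \<sigma> v) \<le> B" .
  qed
  also have "(\<lambda>z. MAX v\<in>V. (\<integral>x. \<psi> v x \<partial>P) - (\<Sum>i<n. \<psi> v (z i)) / real n
      - ((\<integral>x. e v x \<partial>P) + (\<Sum>i<n. e v (z i)) / real n))
    = (\<lambda>z. MAX v\<in>V. (\<integral>x. \<phi> x (v x) \<partial>P) - (\<Sum>i<n. \<phi> (z i) (v (z i))) / real n
      - (\<integral>x. (v x - f0 x)\<^sup>2 \<partial>P) / 4)"
  proof (intro ext arg_cong[where f = Max] image_cong refl)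
    fix z :: "nat \<Rightarrow> 'z" and v assume v: "v \<in> V"
    have "(\<integral>x. \<psi> v x \<partial>P) = (\<integral>x. \<phi> x (v x) \<partial>P) - (\<integral>x. e v x \<partial>P)"
      unfolding \<psi>_def using e_int[OF v] \<phi>_int[OF v] by simp
    moreover have "(\<integral>x. e v x \<partial>P) = (\<integral>x. (v x - f0 x)\<^sup>2 \<partial>P) / 8" unfolding e_def by simp
    moreover have "(\<Sum>i<n. \<psi> v (z i)) = (\<Sum>i<n. \<phi> (z i) (v (z i))) - (\<Sum>i<n. e v (z i))"
      unfolding \<psi>_def by (rule sum_subtractf)
    ultimately show "(\<integral>x. \<psi> v x \<partial>P) - (\<Sum>i<n. \<psi> v (z i)) / real n
      - ((\<integral>x. e v x \<partial>P) + (\<Sum>i<n. e v (z i)) / real n)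
      = (\<integral>x. \<phi> x (v x) \<partial>P) - (\<Sum>i<n. \<phi> (z i) (v (z i))) / real n
      - (\<integral>x. (v x - f0 x)\<^sup>2 \<partial>P) / 4"
      by (simp add: diff_divide_distrib)
  qed
  finally show ?thesis by (simp add: B_def V_def algebra_simps)
qed

section \<open>The law of the covariate\<close>

text \<open>The complement of the support is a union of open null sets, and countably many members of a
countable basis suffice to cover it.\<close>

lemma AE_in_msupport:
  fixes M :: "'a::second_countable_topology measure"
  assumes "sets M = sets borel"
  shows "AE x in M. x \<in> msupport M"
proof -
  obtain B :: "'a set set" where B: "topological_basis B" "countable B"
    using ex_countable_basis by blast
  let ?N = "\<Union>U\<in>{U\<in>B. emeasure M U = 0}. U"
  have "?N \<in> null_sets M"
    using B(2) topological_basis_open[OF B(1)] assms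
    by (intro null_sets_UN') (auto simp: null_sets_def)
  moreover have "{x \<in> space M. x \<notin> msupport M} \<subseteq> ?N"
  proof
    fix x assume "x \<in> {x \<in> space M. x \<notin> msupport M}"
    then obtain U where U: "open U" "x \<in> U" "emeasure M U = 0"
      by (auto simp: msupport_def)
    obtain b where b: "b \<in> B" "x \<in> b" "b \<subseteq> U"
      using topological_basisE[OF B(1) U(1,2)] by blast
    have "emeasure M b \<le> emeasure M U" using b U(1) assms by (intro emeasure_mono) auto
    then show "x \<in> ?N" using b U(3) by auto
  qed
  ultimately show ?thesis by (rule AE_I')
qed

text \<open>The set \<open>S\<close> need not be Borel, so the density bound is stated on its closure. The part that is added
belongs to the boundary of a convex set and is Lebesgue-null.\<close>

lemma bounded_density_closure_le:
  fixes \<nu> :: "'a::euclidean_space measure"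
  assumes d: "has_bounded_density \<nu> S lo hi" and S: "convex S" and A: "A \<in> sets borel"
  shows "emeasure \<nu> (A \<inter> closure S) \<le> ennreal hi * emeasure lborel (A \<inter> closure S)"
proof -
  obtain f where f[measurable]: "f \<in> borel_measurable borel"
    and \<nu>: "\<nu> = density lborel (\<lambda>x. ennreal (f x))" and hi: "\<And>x. x \<in> S \<Longrightarrow> f x \<le> hi"
    using d by (auto simp: has_bounded_density_def)
  have [measurable]: "A \<inter> closure S \<in> sets borel" using A by simp
  have "frontier S \<in> null_sets lborel"
    using negligible_convex_frontier[OF S]
    by (simp add: negligible_iff_null_sets null_sets_completion_iff frontier_closed borel_closed)
  then have ae: "AE x in lborel. x \<notin> frontier S" by (rule AE_not_in)
  have "emeasure \<nu> (A \<inter> closure S) = (\<integral>\<^sup>+x\<in>A \<inter> closure S. ennreal (f x) \<partial>lborel)"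
    unfolding \<nu> by (subst emeasure_density) auto
  also have "\<dots> \<le> (\<integral>\<^sup>+x. ennreal hi * indicator (A \<inter> closure S) x \<partial>lborel)"
  proof (rule nn_integral_mono_AE, use ae in eventually_elim)
    fix x assume "x \<notin> frontier S"
    then have "x \<in> closure S \<Longrightarrow> x \<in> S"
      using interior_subset by (auto simp: frontier_def)
    then show "ennreal (f x) * indicator (A \<inter> closure S) x \<le> ennreal hi * indicator (A \<inter> closure S) x"
      using hi[of x] by (auto simp: indicator_def intro: ennreal_leI)
  qed
  also have "\<dots> = ennreal hi * emeasure lborel (A \<inter> closure S)"
    by (subst nn_integral_cmult_indicator) auto
  finally show ?thesis .
qed

lemma measurable_fst_borel [measurable]:
  "fst \<in> borel \<rightarrow>\<^sub>M (borel :: 'a::topological_space measure)"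

  by (rule borel_measurable_continuous_onI) (intro continuous_intros)

lemma measurable_snd_borel [measurable]:
  "snd \<in> borel \<rightarrow>\<^sub>M (borel :: 'a::topological_space measure)"
  by (rule borel_measurable_continuous_onI) (intro continuous_intros)

text \<open>The form in which the density assumptions enter the rate: the law of \<open>X\<close> is dominated by a multiple of
Lebesgue measure on a ball. Under \<open>continuous_weight_condition\<close> the law of \<open>X\<close> is a mixture of the conditional laws of
\<open>X\<close> given \<open>Y = y\<close>, which share the bound for almost every \<open>y\<close>.\<close>

lemma covariate_law_le:
  fixes P :: "((real ^ 'd) \<times> real) measure"
  assumes P: "prob_space P" "sets P = sets borel" and S: "convex S" "bounded S"
    and AE_S: "AE p in P. fst p \<in> S"
    and cond: "discrete_weight_condition P S Q \<or> continuous_weight_condition P S Q"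
  shows "\<exists>C R. 0 \<le> C \<and> S \<subseteq> cball 0 (real R) \<and> 0 < R \<and>
    (\<forall>g\<in>borel_measurable borel.
      (\<integral>\<^sup>+x. g x \<partial>distr P borel fst) \<le> ennreal C * (\<integral>\<^sup>+x\<in>cball 0 (real R). g x \<partial>lborel))"
proof -
  interpret P: prob_space P by (rule P(1))
  have fst_P[measurable]: "fst \<in> P \<rightarrow>\<^sub>M borel" and snd_P[measurable]: "snd \<in> P \<rightarrow>\<^sub>M borel"
    unfolding measurable_cong_sets[OF P(2) refl] by measurable
  let ?\<mu> = "distr P borel fst"
  obtain R0 where R0: "\<And>x. x \<in> S \<Longrightarrow> norm x \<le> R0"
    using S(2) by (auto simp: bounded_iff)
  define R where "R = nat \<lceil>R0\<rceil> + 1"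
  have R: "S \<subseteq> cball 0 (real R)"
  proof
    fix x assume "x \<in> S"
    then have "norm x \<le> real R" using R0[of x] unfolding R_def by linarith
    then show "x \<in> cball 0 (real R)" by simp
  qed
  then have cl: "closure S \<subseteq> cball 0 (real R)" by (rule closure_minimal) simp
  have "AE x in ?\<mu>. x \<in> closure S"
    using AE_S closure_subset by (subst AE_distr_iff) (auto elim!: eventually_mono)
  then have \<mu>_cl: "emeasure ?\<mu> A = emeasure ?\<mu> (A \<inter> closure S)" if "A \<in> sets borel" for A
    using that by (intro emeasure_eq_AE) (auto elim!: eventually_mono)
  have "\<exists>hi. \<forall>A\<in>sets borel. emeasure ?\<mu> (A \<inter> closure S) \<le> ennreal hi * emeasure lborel (A \<inter> closure S)"
    using cond
  proof
    assume "discrete_weight_condition P S Q"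
    then obtain lo hi where "has_bounded_density ?\<mu> S lo hi"
      by (auto simp: discrete_weight_condition_def)
    then show ?thesis using bounded_density_closure_le S(1) by blast
  next
    assume "continuous_weight_condition P S Q"
    then obtain \<kappa> lo hi where \<kappa>: "is_cond_distr P fst snd \<kappa>"
      and bd: "\<And>y. y \<in> msupport (distr P borel snd) \<Longrightarrow> has_bounded_density (\<kappa> y) S lo hi"
      unfolding continuous_weight_condition_def by blast
    interpret Y: prob_space "distr P borel snd" by (rule P.prob_space_distr) simp
    have "emeasure ?\<mu> (A \<inter> closure S) \<le> ennreal hi * emeasure lborel (A \<inter> closure S)"
      if A: "A \<in> sets borel" for A
    proof -
      have m: "A \<inter> closure S \<in> sets borel" using A by simp
      have "emeasure ?\<mu> (A \<inter> closure S) = emeasure P {p \<in> space P. fst p \<in> A \<inter> closure S \<and> snd p \<in> UNIV}"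
        using m by (subst emeasure_distr) (auto intro!: arg_cong[where f = "emeasure P"])
      also have "\<dots> = (\<integral>\<^sup>+y\<in>UNIV. emeasure (\<kappa> y) (A \<inter> closure S) \<partial>distr P borel snd)"
        by (rule \<kappa>[unfolded is_cond_distr_def, THEN conjunct2, rule_format, OF m]) simp
      also have "\<dots> \<le> (\<integral>\<^sup>+y. ennreal hi * emeasure lborel (A \<inter> closure S) \<partial>distr P borel snd)"
      proof (rule nn_integral_mono_AE)
        have "AE y in distr P borel snd. y \<in> msupport (distr P borel snd)"
          by (rule AE_in_msupport) simp
        then show "AE y in distr P borel snd. emeasure (\<kappa> y) (A \<inter> closure S) * indicator UNIV y
            \<le> ennreal hi * emeasure lborel (A \<inter> closure S)"
        proof eventually_elim
          case (elim y)
          then show ?case using bounded_density_closure_le[OF bd[OF elim] S(1) A] by simp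
        qed
      qed
      also have "\<dots> = ennreal hi * emeasure lborel (A \<inter> closure S)"
        by (simp add: Y.emeasure_space_1[simplified])
      finally show ?thesis .
    qed
    then show ?thesis by blast
  qed
  then obtain hi where hi: "\<And>A. A \<in> sets borel \<Longrightarrow>
      emeasure ?\<mu> (A \<inter> closure S) \<le> ennreal hi * emeasure lborel (A \<inter> closure S)" by blast
  define C where "C = max hi 0"
  define N where "N = density lborel (\<lambda>x::real^'d. ennreal C * indicator (cball 0 (real R)) x)"
  have ball_m: "(\<lambda>x::real^'d. ennreal C * indicator (cball 0 (real R)) x) \<in> borel_measurable borel"
    by (intro borel_measurable_times_ennreal borel_measurable_const borel_measurable_indicator borel_closed closed_cball)
  have "?\<mu> \<le> N"
  proof (subst le_measure)
    show "sets ?\<mu> = sets N" by (simp add: N_def)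
    show "\<forall>A\<in>sets ?\<mu>. emeasure ?\<mu> A \<le> emeasure N A"
    proof
      fix A assume "A \<in> sets ?\<mu>"
      then have A: "A \<in> sets borel" by simp
      have "emeasure ?\<mu> A \<le> ennreal hi * emeasure lborel (A \<inter> closure S)"
        using \<mu>_cl[OF A] hi[OF A] by simp
      also have "\<dots> \<le> ennreal C * emeasure lborel (A \<inter> cball 0 (real R))"
        using cl A by (intro mult_mono emeasure_mono ennreal_leI) (auto simp: C_def)
      also have "\<dots> = emeasure N A"
        unfolding N_def using A
        by (subst emeasure_density)
          (auto simp: ball_m mult.assoc indicator_inter_arith[symmetric] nn_integral_cmult_indicator Int_commute)
      finally show "emeasure ?\<mu> A \<le> emeasure N A" .
    qed
  qed
  then have le: "(\<integral>\<^sup>+x. g x \<partial>?\<mu>) \<le> (\<integral>\<^sup>+x. g x \<partial>N)" for g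
    by (rule nn_integral_mono_measure[rotated]) (simp add: N_def)
  show ?thesis
  proof (intro exI conjI ballI)
    show "0 \<le> C" "S \<subseteq> cball 0 (real R)" "0 < R" using R by (auto simp: C_def R_def)
    fix g :: "real ^ 'd \<Rightarrow> ennreal" assume [measurable]: "g \<in> borel_measurable borel"
    have "(\<integral>\<^sup>+x. g x \<partial>N) = (\<integral>\<^sup>+x. ennreal C * (g x * indicator (cball 0 (real R)) x) \<partial>lborel)"
      unfolding N_def by (subst nn_integral_density) (auto simp: ball_m ac_simps)
    also have "\<dots> = ennreal C * (\<integral>\<^sup>+x\<in>cball 0 (real R). g x \<partial>lborel)"
      by (subst nn_integral_cmult)
        (auto intro!: borel_measurable_times_ennreal borel_measurable_indicator borel_closed)
    finally show "(\<integral>\<^sup>+x. g x \<partial>?\<mu>) \<le> ennreal C * (\<integral>\<^sup>+x\<in>cball 0 (real R). g x \<partial>lborel)"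
      using le[of g] by simp
  qed
qed

text \<open>A linear bound for the volume of a thin spherical shell: as a function of \<open>t\<close> the left-hand side is
convex, and the right-hand side is its chord over the unit interval.\<close>

lemma power_add_le_linear:
  fixes r t :: real
  assumes "0 \<le> r" "0 \<le> t" "t \<le> 1"
  shows "(r + t) ^ d \<le> r ^ d + t * ((r + 1) ^ d - r ^ d)"
proof (induction d)
  case (Suc d)
  let ?c = "(r + 1) ^ d - r ^ d"
  have c: "0 \<le> ?c" using assms by (simp add: power_mono)
  have "(r + t) ^ Suc d \<le> (r + t) * (r ^ d + t * ?c)"
    using Suc assms by (auto intro: mult_left_mono)
  also have "\<dots> = r ^ Suc d + t * (r ^ d + r * ?c + t * ?c)" by (simp add: algebra_simps)
  also have "\<dots> \<le> r ^ Suc d + t * (r ^ d + r * ?c + 1 * ?c)"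
    using assms c by (intro add_left_mono mult_left_mono mult_right_mono) auto
  also have "\<dots> = r ^ Suc d + t * ((r + 1) ^ Suc d - r ^ Suc d)" by (simp add: algebra_simps)
  finally show ?case .
qed simp

lemma borel_measurable_antimono:
  fixes f :: "real \<Rightarrow> real"
  assumes "antimono f"
  shows "f \<in> borel_measurable borel"
proof -
  have "mono (\<lambda>x. - f x)" using assms by (auto simp: monotone_def)
  then have "(\<lambda>x. - f x) \<in> borel_measurable borel" by (rule borel_measurable_mono)
  then have "(\<lambda>x. - (- f x)) \<in> borel_measurable borel" by (rule borel_measurable_uminus)
  then show ?thesis by simp
qed

lemma integral_lborel_shift:
  fixes f :: "'a::euclidean_space \<Rightarrow> real"
  assumes "f \<in> borel_measurable borel"
  shows "(\<integral>x. f (c + x) \<partial>lborel) = (\<integral>x. f x \<partial>lborel)"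
proof -
  have "(\<integral>x. f x \<partial>distr lborel borel ((+) c)) = (\<integral>x. f (c + x) \<partial>lborel)"
    using assms by (intro integral_distr) auto
  then show ?thesis by (simp add: lborel_distr_plus)
qed

text \<open>Let \<open>\<delta>\<close> be the multiple of \<open>a\<close> with \<open>a \<bullet> \<delta> = s\<close>. Translating by \<open>\<delta>\<close> and by \<open>- \<delta>\<close> turns the difference of
the two integrals into the integral of \<open>G (a \<bullet> y)\<close> over the ball about \<open>- \<delta>\<close> minus the one over the ball
about \<open>\<delta>\<close>. Both balls lie in the ball of radius \<open>r + 2 * s\<close>, so the difference is at most
the volume between this ball and the one of radius \<open>r\<close>.\<close>

lemma ridge_shift_integral_le:
  fixes a :: "'a::euclidean_space" and G :: "real \<Rightarrow> real"
  assumes G: "antimono G" "\<And>t. G t \<in> {0..1}" and a: "1 / 2 \<le> norm a"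
    and s: "0 \<le> s" "2 * s \<le> 1" and r: "0 \<le> r"
  shows "(\<integral>\<^sup>+x\<in>cball 0 r. ennreal (G (a \<bullet> x - s) - G (a \<bullet> x + s)) \<partial>lborel)
    \<le> ennreal (2 * s * (unit_ball_vol (DIM('a)) * ((r + 1) ^ DIM('a) - r ^ DIM('a))))"
proof -
  define \<delta> where "\<delta> = (s / (norm a)\<^sup>2) *\<^sub>R a"
  have a0: "a \<noteq> 0" using a by auto
  have \<delta>_inner: "a \<bullet> \<delta> = s" using a0 by (simp add: \<delta>_def power2_norm_eq_inner)
  have "norm \<delta> = s / norm a" using a0 s by (simp add: \<delta>_def power2_eq_square)
  also have "\<dots> \<le> s / (1 / 2)" using a s a0 by (intro divide_left_mono) auto
  finally have \<delta>_norm: "norm \<delta> \<le> 2 * s" by simp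
  have [measurable]: "G \<in> borel_measurable borel" by (rule borel_measurable_antimono[OF G(1)])
  define B where "B = cball (0::'a) r"
  define B' where "B' = cball (0::'a) (r + 2 * s)"
  have fin: "emeasure lborel B < \<infinity>" "emeasure lborel B' < \<infinity>"
    using emeasure_bounded_finite[OF bounded_cball, of "0::'a"] by (simp_all add: B_def B'_def)
  have [measurable]: "B \<in> sets borel" "B' \<in> sets borel" by (auto simp: B_def B'_def)
  have int: "integrable lborel (\<lambda>x. indicator D (c + x) * g x)"
    if D: "D \<in> {B, B'}" and g: "g \<in> borel_measurable borel" "\<And>x. g x \<in> {0..1}"
    for D :: "'a set" and c and g :: "'a \<Rightarrow> real"
  proof -
    have [measurable]: "D \<in> sets borel" "g \<in> borel_measurable borel" using D g by auto
    have "emeasure lborel D < \<infinity>" using D fin by auto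
    then have "integrable (distr lborel borel ((+) c)) (indicator D :: 'a \<Rightarrow> real)"
      by (simp add: lborel_distr_plus integrable_indicator_iff)
    then have "integrable lborel (\<lambda>x. indicator D (c + x) :: real)"
      by (rule integrable_distr[rotated]) simp
    then show ?thesis
      by (rule Bochner_Integration.integrable_bound)
        (use g(2) in \<open>auto intro!: AE_I2 simp: indicator_def\<close>)
  qed
  have int0: "integrable lborel (\<lambda>x. indicator D x * g x)"
    if "D \<in> {B, B'}" "g \<in> borel_measurable borel" "\<And>x. g x \<in> {0..1}"
    for D :: "'a set" and g :: "'a \<Rightarrow> real"
    using int[OF that, of 0] by simp
  have sub: "indicator B (- \<delta> + y) \<le> (indicator B' y :: real)" "indicator B (\<delta> + y) \<le> (indicator B' y :: real)" for y
  proof -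
    have "norm y \<le> norm (- \<delta> + y) + norm \<delta>" using norm_triangle_ineq[of "- \<delta> + y" \<delta>] by simp
    moreover have "norm y \<le> norm (\<delta> + y) + norm \<delta>" using norm_triangle_ineq4[of "\<delta> + y" \<delta>] by simp
    ultimately show "indicator B (- \<delta> + y) \<le> (indicator B' y :: real)" "indicator B (\<delta> + y) \<le> (indicator B' y :: real)"
      using \<delta>_norm by (auto simp: indicator_def B_def B'_def)
  qed
  have I1: "(\<integral>x. indicator B x * G (a \<bullet> x - s) \<partial>lborel) = (\<integral>y. indicator B (\<delta> + y) * G (a \<bullet> y) \<partial>lborel)"
    using integral_lborel_shift[of "\<lambda>x. indicator B x * G (a \<bullet> x - s)" \<delta>]
    by (simp add: inner_add_right \<delta>_inner)
  have I2: "(\<integral>x. indicator B x * G (a \<bullet> x + s) \<partial>lborel) = (\<integral>y. indicator B (- \<delta> + y) * G (a \<bullet> y) \<partial>lborel)"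
    using integral_lborel_shift[of "\<lambda>x. indicator B x * G (a \<bullet> x + s)" "- \<delta>"]
    by (simp add: inner_diff_right \<delta>_inner)
  have I3: "(\<integral>y. indicator B (- \<delta> + y) \<partial>lborel) = measure lborel B"
    using integral_lborel_shift[of "indicator B :: 'a \<Rightarrow> real" "- \<delta>"] by simp
  have one: "integrable lborel (\<lambda>y. indicator B (- \<delta> + y) :: real)" "integrable lborel (indicator B' :: 'a \<Rightarrow> real)"
    using int[of B "\<lambda>_. 1" "- \<delta>"] int0[of B' "\<lambda>_. 1"] by auto
  have Gm: "(\<lambda>x. G (a \<bullet> x + c)) \<in> borel_measurable borel" for c by measurable
  have int_m: "integrable lborel (\<lambda>x. indicator B x * G (a \<bullet> x - s))"
    and int_p: "integrable lborel (\<lambda>x. indicator B x * G (a \<bullet> x + s))"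
    using int0[of B "\<lambda>x. G (a \<bullet> x + (- s))"] int0[of B "\<lambda>x. G (a \<bullet> x + s)"] Gm G(2) by auto
  have "(\<integral>\<^sup>+x\<in>cball 0 r. ennreal (G (a \<bullet> x - s) - G (a \<bullet> x + s)) \<partial>lborel)
      = (\<integral>\<^sup>+x. ennreal (indicator B x * G (a \<bullet> x - s) - indicator B x * G (a \<bullet> x + s)) \<partial>lborel)"
    by (intro nn_integral_cong) (auto simp: B_def indicator_def)
  also have "\<dots> = ennreal (\<integral>x. indicator B x * G (a \<bullet> x - s) - indicator B x * G (a \<bullet> x + s) \<partial>lborel)"
  proof (rule nn_integral_eq_integral)
    show "AE x in lborel. 0 \<le> indicator B x * G (a \<bullet> x - s) - indicator B x * G (a \<bullet> x + s)"
      using antimonoD[OF G(1)] s by (intro AE_I2) (auto simp: indicator_def)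
  qed (use int_m int_p in auto)
  also have "(\<integral>x. indicator B x * G (a \<bullet> x - s) - indicator B x * G (a \<bullet> x + s) \<partial>lborel)
      = (\<integral>y. indicator B (\<delta> + y) * G (a \<bullet> y) \<partial>lborel) - (\<integral>y. indicator B (- \<delta> + y) * G (a \<bullet> y) \<partial>lborel)"
    using int_m int_p by (simp add: I1 I2)
  also have "\<dots> = (\<integral>y. indicator B (\<delta> + y) * G (a \<bullet> y) - indicator B (- \<delta> + y) * G (a \<bullet> y) \<partial>lborel)"
    using int[of B "\<lambda>x. G (a \<bullet> x)" \<delta>] int[of B "\<lambda>x. G (a \<bullet> x)" "- \<delta>"] G(2)
    by (subst Bochner_Integration.integral_diff) auto
  also have "\<dots> \<le> (\<integral>y. indicator B' y - indicator B (- \<delta> + y) \<partial>lborel)"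
  proof (rule integral_mono)
    fix y
    have "indicator B (\<delta> + y) * G (a \<bullet> y) - indicator B (- \<delta> + y) * G (a \<bullet> y)
        \<le> (indicator B' y - indicator B (- \<delta> + y)) * G (a \<bullet> y)"
      using sub(2)[of y] G(2)[of "a \<bullet> y"] by (simp add: left_diff_distrib mult_right_mono)
    also have "\<dots> \<le> (indicator B' y - indicator B (- \<delta> + y)) * 1"
      using sub(1)[of y] G(2)[of "a \<bullet> y"] by (intro mult_left_mono) auto
    finally show "indicator B (\<delta> + y) * G (a \<bullet> y) - indicator B (- \<delta> + y) * G (a \<bullet> y)
        \<le> indicator B' y - indicator B (- \<delta> + y)" by simp
  qed (use int[of B "\<lambda>x. G (a \<bullet> x)" \<delta>] int[of B "\<lambda>x. G (a \<bullet> x)" "- \<delta>"] G(2) one in auto)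
  also have "\<dots> = measure lborel B' - measure lborel B"
    using one I3 by simp
  also have "\<dots> = unit_ball_vol (DIM('a)) * (r + 2 * s) ^ DIM('a) - unit_ball_vol (DIM('a)) * r ^ DIM('a)"
    using r s by (simp add: B_def B'_def content_cball)
  also have "\<dots> \<le> unit_ball_vol (DIM('a)) * (2 * s * ((r + 1) ^ DIM('a) - r ^ DIM('a)))"
    unfolding right_diff_distrib[symmetric]
    using power_add_le_linear[OF r, of "2 * s" "DIM('a)"] s by (intro mult_left_mono) auto
  finally show ?thesis by (simp add: ennreal_leI mult_ac)
qed

section \<open>A finite class that brackets all antitone ridge functions\<close>

definition dir_grid :: "nat \<Rightarrow> (real ^ 'd) set" where
  "dir_grid N = (\<lambda>k. \<chi> i. real_of_int (k i) / real N) ` (UNIV \<rightarrow>\<^sub>E {- int N..int N})"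

lemma finite_dir_grid: "finite (dir_grid N :: (real ^ 'd) set)"
  unfolding dir_grid_def by (intro finite_imageI finite_PiE) auto

lemma card_dir_grid: "card (dir_grid N :: (real ^ 'd) set) \<le> (2 * N + 1) ^ CARD('d)"
proof -
  have "card (dir_grid N :: (real ^ 'd) set) \<le> card ((UNIV :: 'd set) \<rightarrow>\<^sub>E {- int N..int N})"
    unfolding dir_grid_def by (intro card_image_le finite_PiE) auto
  also have "\<dots> = (2 * N + 1) ^ CARD('d)"
    by (subst card_PiE) (auto simp: nat_add_distrib nat_mult_distrib)
  finally show ?thesis .
qed

text \<open>Rounding every coordinate down gives a point of the grid. It is in general not a unit vector; only
its norm being bounded away from \<open>0\<close> matters for the shifts of ridge functions.\<close>

lemma dir_grid_approx:
  fixes \<alpha> :: "real ^ 'd"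
  assumes N: "0 < N" and \<alpha>: "norm \<alpha> = 1"
  shows "\<exists>a\<in>dir_grid N. norm (\<alpha> - a) \<le> real CARD('d) / real N"
proof -
  define k where "k i = \<lfloor>real N * \<alpha> $ i\<rfloor>" for i
  have k: "k i \<in> {- int N..int N}" for i
  proof -
    have "\<bar>\<alpha> $ i\<bar> \<le> 1" using component_le_norm_cart[of \<alpha> i] \<alpha> by simp
    then have "real N * \<alpha> $ i \<le> real N * 1" "real N * (- 1) \<le> real N * \<alpha> $ i"
      by (intro mult_left_mono; simp add: abs_le_iff)+
    then show ?thesis unfolding k_def by (simp add: le_floor_iff floor_le_iff)
  qed
  define a :: "real ^ 'd" where "a = (\<chi> i. real_of_int (k i) / real N)"
  have "a \<in> dir_grid N"
    unfolding dir_grid_def a_def using k by (intro image_eqI[of _ _ k]) auto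
  moreover have "norm (\<alpha> - a) \<le> real CARD('d) / real N"
  proof -
    have "norm (\<alpha> - a) \<le> (\<Sum>i\<in>UNIV. \<bar>(\<alpha> - a) $ i\<bar>)" by (rule norm_le_l1_cart)
    also have "\<dots> \<le> (\<Sum>i\<in>(UNIV :: 'd set). 1 / real N)"
    proof (rule sum_mono)
      fix i
      have "\<bar>real N * \<alpha> $ i - real_of_int (k i)\<bar> \<le> 1" unfolding k_def by linarith
      then have "\<bar>real N * (\<alpha> - a) $ i\<bar> \<le> 1" using N by (simp add: a_def right_diff_distrib)
      then have "real N * \<bar>(\<alpha> - a) $ i\<bar> \<le> 1" unfolding abs_mult by simp
      then show "\<bar>(\<alpha> - a) $ i\<bar> \<le> 1 / real N" using N by (simp add: pos_le_divide_eq mult.commute)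
    qed
    finally show ?thesis by simp
  qed
  ultimately show ?thesis by blast
qed

text \<open>Polynomially many directions in \<open>n\<close> are few compared with the entropy \<open>n powr (1/3)\<close> of the coarsest
net, since \<open>n = (n powr (1/3)) ^ 3 \<le> exp (3 * n powr (1/3))\<close>.\<close>

lemma dir_grid_exponential_bound:
  fixes r :: nat
  assumes n: "0 < n" and r: "0 < r"
  defines "D \<equiv> CARD('d)"
  shows "real (card (dir_grid (r * D * n) :: (real ^ 'd) set))
    \<le> exp (real (D * (3 * r * D + 3)) * real n powr (1/3))"
proof -
  let ?x = "real n powr (1/3)"
  have D: "0 < D" by (simp add: D_def)
  have x: "1 \<le> ?x" using n by (simp add: ge_one_powr_ge_zero)
  have N: "1 \<le> r * D * n" using n r D by simp
  have "real n = ?x ^ 3" using n by (simp add: powr_power)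
  also have "\<dots> \<le> exp ?x ^ 3"
    using exp_ge_add_one_self[of ?x] x by (intro power_mono) linarith+
  also have "\<dots> = exp (3 * ?x)" by (simp flip: exp_of_nat_mult)
  finally have n_le: "real n \<le> exp (3 * ?x)" .
  have "real (3 * r * D) \<le> exp (real (3 * r * D))"
    using exp_ge_add_one_self[of "real (3 * r * D)"] by linarith
  also have "\<dots> \<le> exp (real (3 * r * D) * ?x)"
    using mult_left_mono[OF x, of "real (3 * r * D)"] by simp
  finally have c_le: "real (3 * r * D) \<le> exp (real (3 * r * D) * ?x)" .
  have "real (card (dir_grid (r * D * n) :: (real ^ 'd) set)) \<le> real ((2 * (r * D * n) + 1) ^ D)"
    unfolding D_def by (intro of_nat_mono card_dir_grid)
  also have "\<dots> \<le> real ((3 * r * D * n) ^ D)"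
    using N by (intro of_nat_mono power_mono) auto
  also have "\<dots> = (real (3 * r * D) * real n) ^ D" by simp
  also have "\<dots> \<le> (exp (real (3 * r * D) * ?x) * exp (3 * ?x)) ^ D"
    using c_le n_le by (intro power_mono mult_mono) auto
  also have "\<dots> = exp (real D * (real (3 * r * D) * ?x + 3 * ?x))"
    by (simp add: exp_of_nat_mult flip: exp_add)
  finally show ?thesis by (simp add: algebra_simps)
qed

text \<open>Step functions on the grid of mesh \<open>1 / n\<close> with values on the same grid, constant beyond
\<open>k / n\<close> in absolute value.\<close>

definition grid_step :: "nat \<Rightarrow> nat \<Rightarrow> (int \<Rightarrow> nat) \<Rightarrow> real \<Rightarrow> real" where
  "grid_step k n h t = real (h (max (- int k) (min (int k) \<lfloor>real n * t\<rfloor>))) / real n"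

definition ridge_steps :: "(real ^ 'd) set \<Rightarrow> nat \<Rightarrow> nat \<Rightarrow> (real ^ 'd \<Rightarrow> real) set" where
  "ridge_steps A k n = (\<lambda>(a, h) x. grid_step k n h (a \<bullet> x)) `
     (A \<times> {h \<in> {- int k..int k} \<rightarrow>\<^sub>E {0..n}. antimono_on {- int k..int k} h})"

lemma finite_ridge_steps:
  assumes "finite A"
  shows "finite (ridge_steps A k n)"
proof -
  have "finite ({- int k..int k} \<rightarrow>\<^sub>E {0..n})" by (rule finite_PiE) auto
  then have "finite {h \<in> {- int k..int k} \<rightarrow>\<^sub>E {0..n}. antimono_on {- int k..int k} h}"
    by (rule rev_finite_subset) blast
  then show ?thesis using assms unfolding ridge_steps_def by blast
qed

lemma grid_step_props:
  assumes n: "0 < n" and h: "h \<in> {- int k..int k} \<rightarrow>\<^sub>E {0..n}" "antimono_on {- int k..int k} h"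
  shows "antimono (grid_step k n h)" "grid_step k n h t \<in> {0..1}"
proof -
  have in_k: "max (- int k) (min (int k) j) \<in> {- int k..int k}" for j by auto
  then have "h (max (- int k) (min (int k) \<lfloor>real n * t\<rfloor>)) \<in> {0..n}" using h(1) by (rule PiE_mem[rotated])
  then show "grid_step k n h t \<in> {0..1}" using n by (simp add: grid_step_def)
  show "antimono (grid_step k n h)"
  proof (rule antimonoI)
    fix s t :: real assume "s \<le> t"
    then have "\<lfloor>real n * s\<rfloor> \<le> \<lfloor>real n * t\<rfloor>" by (intro floor_mono mult_left_mono) auto
    then have "h (max (- int k) (min (int k) \<lfloor>real n * t\<rfloor>)) \<le> h (max (- int k) (min (int k) \<lfloor>real n * s\<rfloor>))"
      by (intro monotone_onD[OF h(2) in_k in_k]) auto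
    then show "grid_step k n h t \<le> grid_step k n h s" by (simp add: grid_step_def divide_right_mono)
  qed
qed

lemma ridge_stepsI:
  "a \<in> A \<Longrightarrow> h \<in> {- int k..int k} \<rightarrow>\<^sub>E {0..n} \<Longrightarrow> antimono_on {- int k..int k} h \<Longrightarrow>
    (\<lambda>x. grid_step k n h (a \<bullet> x)) \<in> ridge_steps A k n"
  unfolding ridge_steps_def by (rule image_eqI[of _ _ "(a, h)"]) simp_all

lemma ridge_steps_ridge:
  assumes "0 < n" "v \<in> ridge_steps A k n"
  shows "\<exists>a\<in>A. \<exists>w. antimono w \<and> (\<forall>t. w t \<in> {0..1::real}) \<and> v = (\<lambda>x. w (a \<bullet> x))"
proof -
  obtain p where p: "p \<in> A \<times> {h \<in> {- int k..int k} \<rightarrow>\<^sub>E {0..n}. antimono_on {- int k..int k} h}"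
    "v = (\<lambda>(a, h) x. grid_step k n h (a \<bullet> x)) p"
    using assms(2) unfolding ridge_steps_def by (elim imageE)
  define a h where "a = fst p" and "h = snd p"
  have a: "a \<in> A" and h: "h \<in> {- int k..int k} \<rightarrow>\<^sub>E {0..n}" "antimono_on {- int k..int k} h"
    and v: "v = (\<lambda>x. grid_step k n h (a \<bullet> x))"
    using p by (simp_all add: a_def h_def mem_Times_iff case_prod_beta)
  show ?thesis
  proof (rule bexI[OF _ a], rule exI[of _ "grid_step k n h"], intro conjI allI)
    show "antimono (grid_step k n h)" by (rule grid_step_props(1)[OF assms(1) h])
    show "grid_step k n h t \<in> {0..1}" for t by (rule grid_step_props(2)[OF assms(1) h])
  qed (rule v)
qed

text \<open>For \<open>x\<close> in the ball, \<open>\<alpha> \<bullet> x\<close> differs from \<open>a \<bullet> x\<close> by at most \<open>1 / n\<close>. If \<open>j\<close> is the grid index of \<open>a \<bullet> x\<close>,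
then \<open>\<alpha> \<bullet> x\<close> lies between \<open>(j - 1) / n\<close> and \<open>(j + 2) / n\<close>; the value of \<open>G\<close> at the first point rounded up
and the one at the second point rounded down bracket \<open>G (\<alpha> \<bullet> x)\<close>.\<close>

lemma ridge_bracket:
  fixes \<alpha> :: "real ^ 'd" and G :: "real \<Rightarrow> real"
  assumes n: "0 < n" and r: "0 < r" and G: "antimono G" "\<And>t. G t \<in> {0..1}"
    and \<alpha>: "norm \<alpha> = 1" and a: "a \<in> A" "norm (\<alpha> - a) \<le> 1 / real (r * n)"
  shows "\<exists>L\<in>ridge_steps A (2 * r * n) n. \<exists>U\<in>ridge_steps A (2 * r * n) n.
    \<forall>x. norm x \<le> real r \<longrightarrow> L x \<le> G (\<alpha> \<bullet> x) \<and> G (\<alpha> \<bullet> x) \<le> U x \<and>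
      U x - L x \<le> G (a \<bullet> x - 2 / real n) - G (a \<bullet> x + 2 / real n) + 2 / real n"
proof -
  define K where "K = {- int (2 * r * n)..int (2 * r * n)}"
  define hL where "hL = restrict (\<lambda>j. nat \<lfloor>real n * G ((real_of_int j + 2) / real n)\<rfloor>) K"
  define hU where "hU = restrict (\<lambda>j. nat \<lceil>real n * G ((real_of_int j - 1) / real n)\<rceil>) K"
  have nG: "real n * G t \<le> real n" "0 \<le> real n * G t" for t
    using G(2)[of t] mult_left_mono[of "G t" 1 "real n"] by auto
  have "nat \<lfloor>real n * G t\<rfloor> \<le> n" "nat \<lceil>real n * G t\<rceil> \<le> n" for t
    using nG(1)[of t] by linarith+
  then have "hL \<in> K \<rightarrow>\<^sub>E {0..n}" "hU \<in> K \<rightarrow>\<^sub>E {0..n}"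
    by (auto simp: hL_def hU_def)
  moreover have "antimono_on K hL" "antimono_on K hU"
  proof -
    have "G (t / real n) \<le> G (s / real n)" if "s \<le> t" for s t
      using that by (intro antimonoD[OF G(1)]) (simp add: divide_right_mono)
    then have "nat \<lfloor>real n * G (t / real n)\<rfloor> \<le> nat \<lfloor>real n * G (s / real n)\<rfloor>"
      "nat \<lceil>real n * G (t / real n)\<rceil> \<le> nat \<lceil>real n * G (s / real n)\<rceil>" if "s \<le> t" for s t
      using that by (intro nat_mono floor_mono ceiling_mono mult_left_mono; simp)+
    then show "antimono_on K hL" "antimono_on K hU"
      by (auto simp: hL_def hU_def monotone_on_def simp del: of_nat_ceiling)
  qed
  ultimately have mem: "(\<lambda>x. grid_step (2 * r * n) n hL (a \<bullet> x)) \<in> ridge_steps A (2 * r * n) n"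
    "(\<lambda>x. grid_step (2 * r * n) n hU (a \<bullet> x)) \<in> ridge_steps A (2 * r * n) n"
    unfolding K_def by - (rule ridge_stepsI[OF a(1)]; assumption)+
  show ?thesis
  proof (rule bexI[OF _ mem(1)], rule bexI[OF _ mem(2)], intro allI impI)
    fix x :: "real ^ 'd" assume x: "norm x \<le> real r"
    define z where "z = a \<bullet> x"
    define j where "j = \<lfloor>real n * z\<rfloor>"
    have rn: "0 < real r" "0 < real n" using r n by auto
    have "\<bar>\<alpha> \<bullet> x - z\<bar> = \<bar>(\<alpha> - a) \<bullet> x\<bar>" by (simp add: z_def inner_diff_left)
    also have "\<dots> \<le> norm (\<alpha> - a) * norm x" by (rule Cauchy_Schwarz_ineq2)
    also have "\<dots> \<le> 1 / real (r * n) * real r" using a(2) x by (intro mult_mono) auto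
    also have "\<dots> = 1 / real n" using rn by simp
    finally have az: "\<bar>\<alpha> \<bullet> x - z\<bar> \<le> 1 / real n" .
    have "\<bar>\<alpha> \<bullet> x\<bar> \<le> real r" using Cauchy_Schwarz_ineq2[of \<alpha> x] \<alpha> x by simp
    moreover have "1 / real n \<le> 1" using n by simp
    ultimately have "\<bar>z\<bar> \<le> real r + 1" using az by linarith
    then have "\<bar>z\<bar> \<le> 2 * real r" using r by simp
    then have "real n * \<bar>z\<bar> \<le> real n * (2 * real r)" by (intro mult_left_mono) auto
    then have "\<bar>real n * z\<bar> \<le> real (2 * r * n)" by (simp add: abs_mult mult_ac)
    then have jK: "j \<in> K" unfolding K_def j_def by (simp add: le_floor_iff floor_le_iff abs_le_iff)
    have step: "grid_step (2 * r * n) n h z = real (h j) / real n" for h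
      using jK by (simp add: grid_step_def K_def j_def)
    have jz: "real_of_int j \<le> real n * z" "real n * z < real_of_int j + 1" unfolding j_def by linarith+
    define e where "e = 1 / real n"
    have scaled: "(real_of_int j + 2) / real n = real_of_int j * e + 2 * e"
      "(real_of_int j - 1) / real n = real_of_int j * e - e" "2 / real n = 2 * e"
      by (simp_all add: e_def add_divide_distrib diff_divide_distrib)
    have "real_of_int j * e \<le> z" "z \<le> real_of_int j * e + e"
      using jz rn by (simp_all add: e_def field_simps)
    then have nz: "\<alpha> \<bullet> x \<le> (real_of_int j + 2) / real n" "(real_of_int j - 1) / real n \<le> \<alpha> \<bullet> x"
      "(real_of_int j + 2) / real n \<le> z + 2 / real n" "z - 2 / real n \<le> (real_of_int j - 1) / real n"
      using az[folded e_def] unfolding scaled by linarith+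
    have L: "real (hL j) / real n \<le> G ((real_of_int j + 2) / real n)"
      "G ((real_of_int j + 2) / real n) - 1 / real n \<le> real (hL j) / real n"
    proof -
      have "real (hL j) \<le> real n * G ((real_of_int j + 2) / real n)"
        "real n * G ((real_of_int j + 2) / real n) - 1 \<le> real (hL j)"
        using jK nG(2)[of "(real_of_int j + 2) / real n"] by (auto simp: hL_def)
      then have "real (hL j) / real n \<le> real n * G ((real_of_int j + 2) / real n) / real n"
        "(real n * G ((real_of_int j + 2) / real n) - 1) / real n \<le> real (hL j) / real n"
        by (intro divide_right_mono; simp)+
      then show "real (hL j) / real n \<le> G ((real_of_int j + 2) / real n)"
        "G ((real_of_int j + 2) / real n) - 1 / real n \<le> real (hL j) / real n"
        using rn by (simp_all add: diff_divide_distrib)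
    qed
    have U: "G ((real_of_int j - 1) / real n) \<le> real (hU j) / real n"
      "real (hU j) / real n \<le> G ((real_of_int j - 1) / real n) + 1 / real n"
    proof -
      have "real n * G ((real_of_int j - 1) / real n) \<le> real (hU j)"
        "real (hU j) \<le> real n * G ((real_of_int j - 1) / real n) + 1"
        using jK nG(2)[of "(real_of_int j - 1) / real n"] by (simp_all add: hU_def)
      then have "real n * G ((real_of_int j - 1) / real n) / real n \<le> real (hU j) / real n"
        "real (hU j) / real n \<le> (real n * G ((real_of_int j - 1) / real n) + 1) / real n"
        by (intro divide_right_mono; simp)+
      then show "G ((real_of_int j - 1) / real n) \<le> real (hU j) / real n"
        "real (hU j) / real n \<le> G ((real_of_int j - 1) / real n) + 1 / real n"
        using rn by (simp_all add: add_divide_distrib)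
    qed
    have G': "G ((real_of_int j + 2) / real n) \<le> G (\<alpha> \<bullet> x)" "G (\<alpha> \<bullet> x) \<le> G ((real_of_int j - 1) / real n)"
      "G (z + 2 / real n) \<le> G ((real_of_int j + 2) / real n)"
      "G ((real_of_int j - 1) / real n) \<le> G (z - 2 / real n)"
      by (rule antimonoD[OF G(1)], rule nz)+
    show "grid_step (2 * r * n) n hL (a \<bullet> x) \<le> G (\<alpha> \<bullet> x) \<and> G (\<alpha> \<bullet> x) \<le> grid_step (2 * r * n) n hU (a \<bullet> x) \<and>
      grid_step (2 * r * n) n hU (a \<bullet> x) - grid_step (2 * r * n) n hL (a \<bullet> x)
        \<le> G (a \<bullet> x - 2 / real n) - G (a \<bullet> x + 2 / real n) + 2 / real n"
      unfolding z_def[symmetric] step using L[folded e_def] U[folded e_def] G' unfolding scaled(3)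
      by (intro conjI; linarith)
  qed
qed

section \<open>Least squares against a conditional distribution function\<close>

lemma is_cdf_props:
  assumes "is_cdf G"
  shows "G \<in> borel_measurable borel" "G t \<in> {0..1}"
proof -
  obtain D where D: "real_distribution D" "G = cdf D" using assms by (auto simp: is_cdf_def)
  interpret real_distribution D by (rule D(1))
  have "mono (cdf D)" by (rule monoI) (rule cdf_nondecreasing)
  then show "G \<in> borel_measurable borel" unfolding D(2) by (rule borel_measurable_mono)
  show "G t \<in> {0..1}" unfolding D(2) using cdf_nonneg[of t] cdf_bounded_prob[of t] by simp
qed

text \<open>\<open>P\<close> is the law of \<open>(X, Y)\<close> and \<open>\<kappa>\<close> a version of the conditional law of \<open>Y\<close> given \<open>X\<close>. The conditional
distribution function \<open>cond_cdf\<close> is defined from \<open>\<kappa>\<close> for every \<open>x\<close>, so it is jointly measurable,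
whereas \<open>F0\<close> is constrained only at the indices of points of \<open>S\<close>.\<close>

locale conditional_cdf =
  fixes P :: "((real ^ 'd) \<times> real) measure" and \<kappa> :: "real ^ 'd \<Rightarrow> real measure"
  assumes prob_P: "prob_space P" and sets_P: "sets P = sets borel"
    and kernel: "is_cond_distr P snd fst \<kappa>"
begin

sublocale prob_space P by (rule prob_P)

definition cond_cdf :: "real \<Rightarrow> real ^ 'd \<Rightarrow> real" where
  "cond_cdf t x = measure (\<kappa> x) {..t}"

lemma kernel_measurable [measurable]: "\<kappa> \<in> borel \<rightarrow>\<^sub>M prob_algebra borel"
  using kernel by (simp add: is_cond_distr_def)

lemma fst_P [measurable]: "fst \<in> P \<rightarrow>\<^sub>M borel" and snd_P [measurable]: "snd \<in> P \<rightarrow>\<^sub>M borel"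
  unfolding measurable_cong_sets[OF sets_P refl] by measurable

lemma kernel_prob: "prob_space (\<kappa> x)"
  using measurable_space[OF kernel_measurable, of x] by (simp add: space_prob_algebra)

lemma cond_cdf_range: "cond_cdf t x \<in> {0..1}"
  using prob_space.prob_le_1[OF kernel_prob] by (simp add: cond_cdf_def)

lemma cond_cdf_measurable_pair:
  "(\<lambda>(t, x). cond_cdf t x) \<in> borel_measurable (borel \<Otimes>\<^sub>M borel)"
proof -
  have "{p \<in> space ((borel \<Otimes>\<^sub>M borel :: (real \<times> (real ^ 'd)) measure) \<Otimes>\<^sub>M (borel :: real measure)).
      snd p \<le> fst (fst p)} \<in> sets ((borel \<Otimes>\<^sub>M borel) \<Otimes>\<^sub>M borel)"
    by measurable
  then have "{p :: (real \<times> (real ^ 'd)) \<times> real. snd p \<le> fst (fst p)} \<in> sets ((borel \<Otimes>\<^sub>M borel) \<Otimes>\<^sub>M borel)"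
    by (simp add: space_pair_measure)
  moreover have "{p :: (real \<times> (real ^ 'd)) \<times> real. snd p \<le> fst (fst p)}
      = (SIGMA p:space (borel \<Otimes>\<^sub>M borel). {..fst p})"
    by (auto simp: space_pair_measure)
  ultimately have "(SIGMA p:space (borel \<Otimes>\<^sub>M borel :: (real \<times> (real ^ 'd)) measure). {..fst p})
      \<in> sets ((borel \<Otimes>\<^sub>M borel) \<Otimes>\<^sub>M borel)" by simp
  moreover have "(\<lambda>p::real \<times> (real ^ 'd). \<kappa> (snd p)) \<in> borel \<Otimes>\<^sub>M borel \<rightarrow>\<^sub>M subprob_algebra borel"
    by (rule measurable_compose[OF measurable_snd measurable_prob_algebraD[OF kernel_measurable]])
  ultimately have "(\<lambda>p::real \<times> (real ^ 'd). measure (\<kappa> (snd p)) {..fst p}) \<in> borel_measurable (borel \<Otimes>\<^sub>M borel)"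
    by (rule measure_measurable_subprob_algebra2)
  then show ?thesis by (simp add: cond_cdf_def case_prod_beta')
qed

lemma cond_cdf_measurable2:
  "f \<in> N \<rightarrow>\<^sub>M borel \<Longrightarrow> g \<in> N \<rightarrow>\<^sub>M borel \<Longrightarrow> (\<lambda>w. cond_cdf (f w) (g w)) \<in> borel_measurable N"
  using measurable_compose[OF measurable_Pair cond_cdf_measurable_pair] by simp

lemma cond_cdf_measurable [measurable]: "cond_cdf t \<in> borel_measurable borel"
  using cond_cdf_measurable2[of "\<lambda>_. t" borel "\<lambda>x. x"] by simp

text \<open>The regression property of the conditional distribution function. Both sides are integrals of \<open>h\<close>, one
with respect to the image of \<open>P\<close> restricted to \<open>Y \<le> t\<close>, the other with respect to the law of \<open>X\<close>
with density \<open>cond_cdf t\<close>, and the kernel property says that these measures agree.\<close>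

lemma conditional_mean:
  assumes [measurable]: "h \<in> borel_measurable borel"
  shows "(\<integral>p. h (fst p) * of_bool (snd p \<le> t) \<partial>P) = (\<integral>p. h (fst p) * cond_cdf t (fst p) \<partial>P)"
proof -
  let ?I = "\<lambda>p. of_bool (snd p \<le> t) :: real"
  have eq: "distr (density P (\<lambda>p. ennreal (?I p))) borel fst
      = density (distr P borel fst) (\<lambda>x. ennreal (cond_cdf t x))"
  proof (rule measure_eqI)
    fix A assume "A \<in> sets (distr (density P (\<lambda>p. ennreal (?I p))) borel fst)"
    then have A[measurable]: "A \<in> sets borel" by simp
    have "emeasure (distr (density P (\<lambda>p. ennreal (?I p))) borel fst) A
        = (\<integral>\<^sup>+p. ennreal (?I p) * indicator (fst -` A \<inter> space P) p \<partial>P)"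
      by (subst emeasure_distr) (auto simp: emeasure_density)
    also have "\<dots> = (\<integral>\<^sup>+p. indicator {p \<in> space P. snd p \<in> {..t} \<and> fst p \<in> A} p \<partial>P)"
      by (intro nn_integral_cong) (auto simp: indicator_def)
    also have "\<dots> = emeasure P {p \<in> space P. snd p \<in> {..t} \<and> fst p \<in> A}"
      by (rule nn_integral_indicator) measurable
    also have "\<dots> = (\<integral>\<^sup>+x\<in>A. emeasure (\<kappa> x) {..t} \<partial>distr P borel fst)"
      by (rule kernel[unfolded is_cond_distr_def, THEN conjunct2, rule_format]) auto
    also have "\<dots> = (\<integral>\<^sup>+x. ennreal (cond_cdf t x) * indicator A x \<partial>distr P borel fst)"
      by (intro nn_integral_cong arg_cong2[where f = times] refl)
        (simp add: cond_cdf_def finite_measure.emeasure_eq_measure[OF prob_space.finite_measure[OF kernel_prob]])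
    also have "\<dots> = emeasure (density (distr P borel fst) (\<lambda>x. ennreal (cond_cdf t x))) A"
      by (subst emeasure_density) auto
    finally show "emeasure (distr (density P (\<lambda>p. ennreal (?I p))) borel fst) A
      = emeasure (density (distr P borel fst) (\<lambda>x. ennreal (cond_cdf t x))) A" .
  qed simp
  have "(\<integral>p. h (fst p) * ?I p \<partial>P) = (\<integral>p. h (fst p) \<partial>density P (\<lambda>p. ennreal (?I p)))"
    by (subst integral_density) (auto simp: mult.commute)
  also have "\<dots> = (\<integral>x. h x \<partial>distr (density P (\<lambda>p. ennreal (?I p))) borel fst)"
    by (subst integral_distr) auto
  also have "\<dots> = (\<integral>x. cond_cdf t x * h x \<partial>distr P borel fst)"
    unfolding eq using cond_cdf_range by (subst integral_density) auto
  also have "\<dots> = (\<integral>p. h (fst p) * cond_cdf t (fst p) \<partial>P)"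
    by (subst integral_distr) (auto simp: mult.commute)
  finally show ?thesis .
qed

text \<open>The excess of the squared loss \<open>(s - of_bool (y \<le> t))\<^sup>2\<close> over its value at the conditional distribution
function, split by \<open>b = (y \<le> t)\<close>. On each part the loss is monotone in \<open>s\<close>: decreasing where
\<open>y \<le> t\<close>, and increasing elsewhere.\<close>

definition excess :: "bool \<Rightarrow> real \<Rightarrow> (real ^ 'd) \<times> real \<Rightarrow> real \<Rightarrow> real" where
  "excess b t p s =
    (if b then ((1 - s)\<^sup>2 - (1 - cond_cdf t (fst p))\<^sup>2) * of_bool (snd p \<le> t)
     else (s\<^sup>2 - (cond_cdf t (fst p))\<^sup>2) * of_bool (\<not> snd p \<le> t))"

lemma excess_self: "excess b t p (cond_cdf t (fst p)) = 0"
  by (simp add: excess_def)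

lemma excess_lipschitz:
  assumes "s \<in> {0..1}" "s' \<in> {0..1}"
  shows "\<bar>excess b t p s - excess b t p s'\<bar> \<le> 2 * \<bar>s - s'\<bar>"
proof -
  have "\<bar>s\<^sup>2 - s'\<^sup>2\<bar> = \<bar>s + s'\<bar> * \<bar>s - s'\<bar>"
    by (simp add: power2_eq_square algebra_simps flip: abs_mult)
  also have "\<dots> \<le> 2 * \<bar>s - s'\<bar>" using assms by (intro mult_right_mono) auto
  finally have 1: "\<bar>s\<^sup>2 - s'\<^sup>2\<bar> \<le> 2 * \<bar>s - s'\<bar>" .
  have "\<bar>(1 - s)\<^sup>2 - (1 - s')\<^sup>2\<bar> = \<bar>2 - s - s'\<bar> * \<bar>s - s'\<bar>"
    by (simp add: power2_eq_square algebra_simps flip: abs_mult)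
  also have "\<dots> \<le> 2 * \<bar>s - s'\<bar>" using assms by (intro mult_right_mono) auto
  finally have 2: "\<bar>(1 - s)\<^sup>2 - (1 - s')\<^sup>2\<bar> \<le> 2 * \<bar>s - s'\<bar>" .
  show ?thesis using 1 2 by (auto simp: excess_def)
qed

lemma excess_bounded:
  assumes "s \<in> {0..1}"
  shows "\<bar>excess b t p s\<bar> \<le> 2"
proof -
  have "\<bar>s - cond_cdf t (fst p)\<bar> \<le> 1"
    using assms cond_cdf_range[of t "fst p"] by (auto simp: abs_le_iff)
  then show ?thesis
    using excess_lipschitz[OF assms cond_cdf_range, of b t p t "fst p"] unfolding excess_self by simp
qed

lemma excess_measurable2:
  assumes "T \<in> N \<rightarrow>\<^sub>M borel" "Z \<in> N \<rightarrow>\<^sub>M borel" "V \<in> borel_measurable N"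
  shows "(\<lambda>w. excess b (T w) (Z w) (V w)) \<in> borel_measurable N"
proof -
  have [measurable]: "(\<lambda>w. fst (Z w)) \<in> N \<rightarrow>\<^sub>M borel" "(\<lambda>w. snd (Z w)) \<in> borel_measurable N"
    by (rule measurable_compose[OF assms(2)], measurable)+
  have [measurable]: "(\<lambda>w. cond_cdf (T w) (fst (Z w))) \<in> borel_measurable N"
    by (rule cond_cdf_measurable2[OF assms(1)]) measurable
  note assms[measurable]
  show ?thesis unfolding excess_def by (cases b) simp_all
qed

lemma integrable_P:
  fixes f :: "(real ^ 'd) \<times> real \<Rightarrow> real"
  assumes "f \<in> borel_measurable P" "\<And>p. \<bar>f p\<bar> \<le> B"
  shows "integrable P f"
  by (rule integrable_const_bound[where B = B]) (use assms in auto)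

text \<open>The candidate \<open>cond_cdf t\<close>, for which all three terms vanish, is included to make the supremum
nonnegative.\<close>

definition offset_sup :: "bool \<Rightarrow> real \<Rightarrow> (real ^ 'd \<Rightarrow> real) set \<Rightarrow> nat \<Rightarrow> (nat \<Rightarrow> (real ^ 'd) \<times> real) \<Rightarrow> real" where
  "offset_sup b t W n z = (MAX v\<in>insert (cond_cdf t) W.
     (\<integral>p. excess b t p (v (fst p)) \<partial>P) - (\<Sum>i<n. excess b t (z i) (v (fst (z i)))) / real n
     - (\<integral>p. (v (fst p) - cond_cdf t (fst p))\<^sup>2 \<partial>P) / 4)"

lemma offset_sup_ge:
  assumes "finite W" "v \<in> W"
  shows "(\<integral>p. excess b t p (v (fst p)) \<partial>P) - (\<Sum>i<n. excess b t (z i) (v (fst (z i)))) / real n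
     - (\<integral>p. (v (fst p) - cond_cdf t (fst p))\<^sup>2 \<partial>P) / 4 \<le> offset_sup b t W n z"
  unfolding offset_sup_def by (rule Max_ge) (use assms in auto)

lemma offset_sup_nonneg:
  assumes "finite W"
  shows "0 \<le> offset_sup b t W n z"
  unfolding offset_sup_def
  by (rule Max_ge) (use assms in \<open>auto simp: excess_self intro!: image_eqI[of _ _ "cond_cdf t"]\<close>)

text \<open>The basic inequality at one threshold. The empirical loss of \<open>f\<close> is bounded below by evaluating the
part \<open>y > t\<close> at \<open>L\<close> and the part \<open>y \<le> t\<close> at \<open>U\<close>. In the population, the resulting functional differs from
the squared error of \<open>L\<close>, and the latter from the squared error of \<open>U\<close>, by at most twice the mass
of the bracket. So the functional is, up to the bracket, at least half the sum of the two squared errors,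
and half of this remains after the offsets of the two suprema are subtracted.\<close>

lemma squeezed_error_le:
  fixes f L U :: "real ^ 'd \<Rightarrow> real"
  assumes n: "0 < n" and W: "finite W" "L \<in> W" "U \<in> W"
    and meas: "L \<in> borel_measurable borel" "U \<in> borel_measurable borel" "f \<in> borel_measurable borel"
    and range: "\<And>x. L x \<in> {0..1}" "\<And>x. U x \<in> {0..1}" "\<And>x. f x \<in> {0..1}"
    and squeeze_P: "AE p in P. L (fst p) \<le> f (fst p) \<and> f (fst p) \<le> U (fst p)"
    and squeeze_z: "\<And>i. i < n \<Longrightarrow> L (fst (z i)) \<le> f (fst (z i)) \<and> f (fst (z i)) \<le> U (fst (z i))"
  shows "(\<integral>p. (f (fst p) - cond_cdf t (fst p))\<^sup>2 \<partial>P)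
    \<le> 4 * (offset_sup False t W n z + offset_sup True t W n z)
      + 12 * (\<integral>p. U (fst p) - L (fst p) \<partial>P)
      + 4 * ((\<Sum>i<n. (of_bool (snd (z i) \<le> t) - f (fst (z i)))\<^sup>2
          - (of_bool (snd (z i) \<le> t) - cond_cdf t (fst (z i)))\<^sup>2) / real n)"
proof -
  note meas[measurable]
  let ?g = "cond_cdf t"
  let ?Y = "\<lambda>p. of_bool (snd p \<le> t) :: real"
  define dL where "dL = (\<integral>p. (L (fst p) - ?g (fst p))\<^sup>2 \<partial>P)"
  define dU where "dU = (\<integral>p. (U (fst p) - ?g (fst p))\<^sup>2 \<partial>P)"
  define E where "E = (\<integral>p. U (fst p) - L (fst p) \<partial>P)"
  define A where "A = (\<Sum>i<n. (?Y (z i) - f (fst (z i)))\<^sup>2 - (?Y (z i) - ?g (fst (z i)))\<^sup>2)"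
  define a where "a p = excess False t p (L (fst p)) + excess True t p (U (fst p))" for p
  have sq: "\<bar>(u - v)\<^sup>2\<bar> \<le> 1" if "u \<in> {0..1}" "v \<in> {0..1}" for u v :: real
    using that by (auto simp: abs_square_le_1 abs_le_iff)
  have exc_m: "(\<lambda>p. excess b t p (v (fst p))) \<in> borel_measurable P" if "v \<in> borel_measurable borel" for b v
    by (rule excess_measurable2)
      (use that in \<open>auto simp: measurable_cong_sets[OF sets_P refl] intro: measurable_compose[OF fst_P, of v]\<close>)
  have [measurable]: "(\<lambda>p. L (fst p)) \<in> borel_measurable P" "(\<lambda>p. U (fst p)) \<in> borel_measurable P"
    "(\<lambda>p. f (fst p)) \<in> borel_measurable P" "(\<lambda>p. ?g (fst p)) \<in> borel_measurable P"
    by (rule measurable_compose[OF fst_P], measurable)+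
  have int_exc: "integrable P (\<lambda>p. excess False t p (L (fst p)))" "integrable P (\<lambda>p. excess True t p (U (fst p)))"
    using excess_bounded range by (auto intro!: integrable_P[where B = 2] exc_m meas)
  have int_L: "integrable P (\<lambda>p. (L (fst p) - ?g (fst p))\<^sup>2)"
    and int_U: "integrable P (\<lambda>p. (U (fst p) - ?g (fst p))\<^sup>2)"
    and int_f: "integrable P (\<lambda>p. (f (fst p) - ?g (fst p))\<^sup>2)"
    by (rule integrable_P[where B = 1], measurable, rule sq, rule range, rule cond_cdf_range)+
  have int_LU: "integrable P (\<lambda>p. U (fst p) - L (fst p))"
  proof (rule integrable_P[where B = 1])
    show "\<bar>U (fst p) - L (fst p)\<bar> \<le> 1" for p :: "(real ^ 'd) \<times> real"
      using range(1)[of "fst p"] range(2)[of "fst p"] by (auto simp: abs_le_iff)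
  qed measurable
  define w where "w p = U (fst p) - L (fst p)" for p :: "(real ^ 'd) \<times> real"
  have iw: "integrable P w" unfolding w_def[abs_def] by (rule int_LU)
  have "(\<Sum>i<n. a (z i)) \<le> A"
    unfolding A_def
  proof (rule sum_mono)
    fix i assume "i \<in> {..<n}"
    then have s: "L (fst (z i)) \<le> f (fst (z i))" "f (fst (z i)) \<le> U (fst (z i))" using squeeze_z by auto
    have "(L (fst (z i)))\<^sup>2 \<le> (f (fst (z i)))\<^sup>2" using s(1) range(1) by (intro power_mono) auto
    moreover have "(1 - U (fst (z i)))\<^sup>2 \<le> (1 - f (fst (z i)))\<^sup>2" using s(2) range(2) by (intro power_mono) auto
    ultimately show "a (z i) \<le> (?Y (z i) - f (fst (z i)))\<^sup>2 - (?Y (z i) - ?g (fst (z i)))\<^sup>2"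
      by (auto simp: a_def excess_def)
  qed
  then have An: "(\<Sum>i<n. a (z i)) / real n \<le> A / real n" by (rule divide_right_mono) simp
  have "offset_sup False t W n z + offset_sup True t W n z
      \<ge> (\<integral>p. a p \<partial>P) - (\<Sum>i<n. a (z i)) / real n - dL / 4 - dU / 4"
  proof -
    have "(\<integral>p. a p \<partial>P) = (\<integral>p. excess False t p (L (fst p)) \<partial>P) + (\<integral>p. excess True t p (U (fst p)) \<partial>P)"
      unfolding a_def using int_exc by simp
    moreover have "(\<Sum>i<n. a (z i)) / real n = (\<Sum>i<n. excess False t (z i) (L (fst (z i)))) / real n
        + (\<Sum>i<n. excess True t (z i) (U (fst (z i)))) / real n"
      by (simp add: a_def sum.distrib add_divide_distrib)
    ultimately show ?thesis
      using offset_sup_ge[OF W(1,2), where b = False and t = t and n = n and z = z]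
        offset_sup_ge[OF W(1,3), where b = True and t = t and n = n and z = z]
      unfolding dL_def dU_def by linarith
  qed
  moreover have "dL - 2 * E \<le> (\<integral>p. a p \<partial>P)"
  proof -
    define q where "q x = 2 * (L x - ?g x)" for x
    have [measurable]: "q \<in> borel_measurable borel" unfolding q_def[abs_def] by measurable
    have [measurable]: "(\<lambda>p. q (fst p)) \<in> borel_measurable P" by (rule measurable_compose[OF fst_P]) measurable
    have bd: "\<bar>q x * c\<bar> \<le> 2" if "c \<in> {0..1}" for x c
    proof -
      have "\<bar>L x - ?g x\<bar> * \<bar>c\<bar> \<le> 1 * 1"
        using range(1)[of x] cond_cdf_range[of t x] that
        by (intro mult_mono) (auto simp: abs_le_iff)
      then show ?thesis unfolding q_def abs_mult by simp
    qed
    have iY: "integrable P (\<lambda>p. q (fst p) * ?Y p)"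
      by (rule integrable_P[where B = 2], measurable) (rule bd, simp)
    have ig: "integrable P (\<lambda>p. q (fst p) * ?g (fst p))"
      by (rule integrable_P[where B = 2], measurable) (rule bd, rule cond_cdf_range)
    have "(\<integral>p. q (fst p) * ?Y p \<partial>P) = (\<integral>p. q (fst p) * ?g (fst p) \<partial>P)"
      by (rule conditional_mean) measurable
    then have "dL - 2 * E = (\<integral>p. (L (fst p) - ?g (fst p))\<^sup>2
        + (q (fst p) * ?g (fst p) - q (fst p) * ?Y p) - 2 * w p \<partial>P)"
      unfolding dL_def E_def w_def[symmetric] using int_L iY ig iw by simp
    also have "\<dots> \<le> (\<integral>p. a p \<partial>P)"
    proof (rule integral_mono_AE)
      show "integrable P a" unfolding a_def using int_exc by simp
      show "AE p in P. (L (fst p) - ?g (fst p))\<^sup>2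
        + (q (fst p) * ?g (fst p) - q (fst p) * ?Y p) - 2 * w p \<le> a p"
        using squeeze_P
      proof eventually_elim
        case (elim p)
        then have LU: "L (fst p) \<le> U (fst p)" by simp
        have "(U (fst p) - L (fst p)) * (2 - U (fst p) - L (fst p)) \<le> (U (fst p) - L (fst p)) * 2"
          using LU range(1)[of "fst p"] range(2)[of "fst p"] by (intro mult_left_mono) auto
        then show ?case
          using LU by (cases "snd p \<le> t") (simp_all add: a_def excess_def q_def w_def power2_eq_square algebra_simps)
      qed
    qed (use int_L iY ig iw in simp)
    finally show ?thesis .
  qed
  moreover have "dU \<le> dL + 2 * E"
  proof -
    have "dU \<le> (\<integral>p. (L (fst p) - ?g (fst p))\<^sup>2 + 2 * w p \<partial>P)"
      unfolding dU_def
    proof (rule integral_mono_AE)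
      show "AE p in P. (U (fst p) - ?g (fst p))\<^sup>2 \<le> (L (fst p) - ?g (fst p))\<^sup>2 + 2 * w p"
        using squeeze_P
      proof eventually_elim
        case (elim p)
        then have LU: "L (fst p) \<le> U (fst p)" by simp
        have "(U (fst p) - L (fst p)) * (U (fst p) + L (fst p) - 2 * ?g (fst p)) \<le> (U (fst p) - L (fst p)) * 2"
          using LU range(1)[of "fst p"] range(2)[of "fst p"] cond_cdf_range[of t "fst p"]
          by (intro mult_left_mono) auto
        then show ?case by (simp add: w_def power2_eq_square algebra_simps)
      qed
    qed (use int_L int_U iw in auto)
    then show ?thesis unfolding dL_def E_def w_def[symmetric] using int_L iw by simp
  qed
  moreover have "(\<integral>p. (f (fst p) - ?g (fst p))\<^sup>2 \<partial>P) \<le> dL + dU"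
  proof -
    have "(\<integral>p. (f (fst p) - ?g (fst p))\<^sup>2 \<partial>P)
        \<le> (\<integral>p. (L (fst p) - ?g (fst p))\<^sup>2 + (U (fst p) - ?g (fst p))\<^sup>2 \<partial>P)"
    proof (rule integral_mono_AE)
      show "AE p in P. (f (fst p) - ?g (fst p))\<^sup>2 \<le> (L (fst p) - ?g (fst p))\<^sup>2 + (U (fst p) - ?g (fst p))\<^sup>2"
        using squeeze_P
      proof eventually_elim
        case (elim p)
        show ?case
        proof (cases "?g (fst p) \<le> f (fst p)")
          case True
          then have "(f (fst p) - ?g (fst p))\<^sup>2 \<le> (U (fst p) - ?g (fst p))\<^sup>2"
            using elim by (intro power_mono) auto
          then show ?thesis by (simp add: add_increasing)
        next
          case False
          then have "(?g (fst p) - f (fst p))\<^sup>2 \<le> (?g (fst p) - L (fst p))\<^sup>2"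
            using elim by (intro power_mono) auto
          then show ?thesis by (simp add: add_increasing2 power2_commute)
        qed
      qed
    qed (use int_L int_U int_f in auto)
    then show ?thesis using int_L int_U by (simp add: dL_def dU_def)
  qed
  moreover have "D \<le> 4 * V + 12 * E + 4 * B"
    if "X - N - dL / 4 - dU / 4 \<le> V" "dL - 2 * E \<le> X" "dU \<le> dL + 2 * E" "D \<le> dL + dU" "N \<le> B"
    for D V X N B :: real
    using that by (simp add: field_simps)
  ultimately show ?thesis using An unfolding A_def[symmetric] E_def[symmetric] by blast
qed

lemma ident_P: "(\<lambda>p. p) \<in> P \<rightarrow>\<^sub>M borel"
  unfolding measurable_cong_sets[OF sets_P refl] by simp

lemma offset_sup_bounded:
  assumes W: "finite W" "\<And>v. v \<in> W \<Longrightarrow> v \<in> borel_measurable borel" "\<And>v x. v \<in> W \<Longrightarrow> v x \<in> {0..1}"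
    and n: "0 < n"
  shows "\<bar>offset_sup b t W n z\<bar> \<le> 5"
  unfolding offset_sup_def
proof (rule abs_Max_image_le)
  fix v assume "v \<in> insert (cond_cdf t) W"
  then have v: "v x \<in> {0..1}" "v \<in> borel_measurable borel" for x
    using W cond_cdf_range by auto
  have [measurable]: "(\<lambda>p. v (fst p)) \<in> borel_measurable P" "(\<lambda>p. cond_cdf t (fst p)) \<in> borel_measurable P"
    by (rule measurable_compose[OF fst_P], use v in measurable)+
  have m: "(\<lambda>p. excess b t p (v (fst p))) \<in> borel_measurable P"
    by (rule excess_measurable2[OF measurable_const ident_P]) measurable
  have sq: "\<bar>(v x - cond_cdf t x)\<^sup>2\<bar> \<le> 1" for x
    using v(1)[of x] cond_cdf_range[of t x] by (auto simp: abs_square_le_1 abs_le_iff)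
  have "\<bar>\<integral>p. excess b t p (v (fst p)) \<partial>P\<bar> \<le> 2"
    by (rule abs_expectation_le[OF integrable_P[OF m, of 2]]) (rule excess_bounded[OF v(1)])+
  moreover have "\<bar>\<integral>p. (v (fst p) - cond_cdf t (fst p))\<^sup>2 \<partial>P\<bar> \<le> 1"
    by (rule abs_expectation_le[OF integrable_P[where B = 1]]) (measurable, (rule sq)+)
  moreover have "\<bar>(\<Sum>i<n. excess b t (z i) (v (fst (z i)))) / real n\<bar> \<le> 2"
  proof -
    have "\<bar>\<Sum>i<n. excess b t (z i) (v (fst (z i)))\<bar> \<le> (\<Sum>i<n. 2)"
      by (rule order_trans[OF sum_abs sum_mono]) (rule excess_bounded[OF v(1)])
    then show ?thesis using n by (simp add: field_simps)
  qed
  ultimately show "\<bar>(\<integral>p. excess b t p (v (fst p)) \<partial>P) - (\<Sum>i<n. excess b t (z i) (v (fst (z i)))) / real n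
     - (\<integral>p. (v (fst p) - cond_cdf t (fst p))\<^sup>2 \<partial>P) / 4\<bar> \<le> 5" by linarith
qed (use W in auto)

text \<open>Joint measurability in the threshold and the sample, for Fubini's theorem. The index set of the maximum
depends on the threshold through \<open>cond_cdf\<close>; its contribution is \<open>0\<close>, so \<open>None\<close> can stand for it.\<close>

lemma offset_sup_measurable:
  assumes W: "finite W" "\<And>v. v \<in> W \<Longrightarrow> v \<in> borel_measurable borel"
    and T: "T \<in> borel_measurable N" and Z: "\<And>i. i < n \<Longrightarrow> Z i \<in> N \<rightarrow>\<^sub>M borel"
  shows "(\<lambda>w. offset_sup b (T w) W n (\<lambda>i. Z i w)) \<in> borel_measurable N"
proof -
  let ?F = "\<lambda>w v. (\<integral>p. excess b (T w) p (v (fst p)) \<partial>P)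
     - (\<Sum>i<n. excess b (T w) (Z i w) (v (fst (Z i w)))) / real n
     - (\<integral>p. (v (fst p) - cond_cdf (T w) (fst p))\<^sup>2 \<partial>P) / 4"
  let ?Fo = "\<lambda>w u. case u of None \<Rightarrow> 0 | Some v \<Rightarrow> ?F w v"
  have "offset_sup b (T w) W n (\<lambda>i. Z i w) = (MAX u\<in>insert None (Some ` W). ?Fo w u)" for w
    unfolding offset_sup_def by (simp add: image_image excess_self)
  moreover have "(\<lambda>w. MAX u\<in>insert None (Some ` W). ?Fo w u) \<in> borel_measurable N"
  proof (rule borel_measurable_Max)
    fix u assume u: "u \<in> insert None (Some ` W)"
    show "(\<lambda>w. ?Fo w u) \<in> borel_measurable N"
    proof (cases u)
      case (Some v)
      then have v: "v \<in> borel_measurable borel" using u W by auto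
      have sndP: "snd \<in> N \<Otimes>\<^sub>M P \<rightarrow>\<^sub>M borel"
        using measurable_snd[of N P] unfolding measurable_cong_sets[OF refl sets_P] .
      have T1: "(\<lambda>q. T (fst q)) \<in> borel_measurable (N \<Otimes>\<^sub>M P)"
        by (rule measurable_compose[OF measurable_fst T])
      have f1: "(\<lambda>q. fst (snd q)) \<in> N \<Otimes>\<^sub>M P \<rightarrow>\<^sub>M borel"
        by (rule measurable_compose[OF measurable_snd fst_P])
      have v1: "(\<lambda>q. v (fst (snd q))) \<in> borel_measurable (N \<Otimes>\<^sub>M P)"
        by (rule measurable_compose[OF f1 v])
      have "(\<lambda>w. \<integral>p. excess b (T w) p (v (fst p)) \<partial>P) \<in> borel_measurable N"
        by (rule borel_measurable_lebesgue_integral)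
          (use excess_measurable2[OF T1 sndP v1, of b] in \<open>simp add: case_prod_beta'\<close>)
      moreover have "(\<lambda>w. \<integral>p. (v (fst p) - cond_cdf (T w) (fst p))\<^sup>2 \<partial>P) \<in> borel_measurable N"
        by (rule borel_measurable_lebesgue_integral)
          (use v1 cond_cdf_measurable2[OF T1 f1] in \<open>simp add: case_prod_beta'\<close>)
      moreover have "(\<lambda>w. excess b (T w) (Z i w) (v (fst (Z i w)))) \<in> borel_measurable N" if "i < n" for i
        by (rule excess_measurable2[OF T Z[OF that]])
          (rule measurable_compose[OF measurable_compose[OF Z[OF that] measurable_fst_borel] v])
      ultimately have "(\<lambda>w. ?F w v) \<in> borel_measurable N"
        by (intro borel_measurable_diff borel_measurable_divide borel_measurable_sum borel_measurable_const) auto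
      then show ?thesis by (simp add: Some)
    qed simp
  qed (use W in simp)
  ultimately show ?thesis by (simp only:)
qed

lemma ridge_steps_props:
  assumes "0 < n" "v \<in> ridge_steps A k n"
  shows "v \<in> borel_measurable borel" "v x \<in> {0..1}"
proof -
  obtain a w where w: "antimono w" "\<And>t. w t \<in> {0..1::real}" "v = (\<lambda>x. w (a \<bullet> x))"
    using ridge_steps_ridge[OF assms] by blast
  have "w \<in> borel_measurable borel" by (rule borel_measurable_antimono[OF w(1)])
  then show "v \<in> borel_measurable borel" unfolding w(3) by measurable
  show "v x \<in> {0..1}" unfolding w(3) by (rule w(2))
qed

lemma expected_offset_sup_le:
  assumes n: "0 < n" and A: "finite A" "real (card A) \<le> exp (c * real n powr (1/3))" "0 \<le> c"
  shows "(\<integral>z. offset_sup b t (ridge_steps A k n) n z \<partial>PiM {..<n} (\<lambda>_. P))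
    \<le> (308 * c + 2536) * real n powr (- 2/3)"
proof -
  let ?W = "ridge_steps A k n" and ?fst = "\<lambda>(v :: real ^ 'd \<Rightarrow> real) (p :: (real ^ 'd) \<times> real). v (fst p)"
  let ?U = "(\<lambda>a (p :: (real ^ 'd) \<times> real). a \<bullet> fst p) ` A"
  have compose: "?fst v \<in> borel_measurable P" if "v \<in> borel_measurable borel" for v
    by (rule measurable_compose[OF fst_P that])
  have "(\<integral>z. (MAX v\<in>insert (?fst (cond_cdf t)) (?fst ` ?W).
        (\<integral>p. excess b t p (v p) \<partial>P) - (\<Sum>i<n. excess b t (z i) (v (z i))) / real n
        - (\<integral>p. (v p - ?fst (cond_cdf t) p)\<^sup>2 \<partial>P) / 4) \<partial>PiM {..<n} (\<lambda>_. P))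
      \<le> (308 * c + 2536) * real n powr (- 2/3)"
  proof (rule expected_offset_max[where U = ?U])
    show "real (card ?U) \<le> exp (c * real n powr (1/3))"
      using card_image_le[OF A(1), of "\<lambda>a (p :: (real ^ 'd) \<times> real). a \<bullet> fst p"] A(2) by linarith
    show "\<exists>u\<in>?U. \<exists>w. antimono w \<and> (\<forall>t. w t \<in> {0..1::real}) \<and> v = (\<lambda>p. w (u p))" if v: "v \<in> ?fst ` ?W" for v
    proof -
      obtain v' where v': "v' \<in> ?W" "v = ?fst v'" using v by blast
      obtain a w where "a \<in> A" "antimono w" "\<forall>t. w t \<in> {0..1::real}" "v' = (\<lambda>x. w (a \<bullet> x))"
        using ridge_steps_ridge[OF n v'(1)] by blast
      then show ?thesis unfolding v'(2)
        by (intro bexI[of _ "\<lambda>p. a \<bullet> fst p"] exI[of _ w]) auto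
    qed
    show "(\<lambda>p. excess b t p (v p)) \<in> borel_measurable P" if "v \<in> insert (?fst (cond_cdf t)) (?fst ` ?W)" for v
    proof (rule excess_measurable2[OF measurable_const ident_P])
      show "v \<in> borel_measurable P"
        using that
      proof
        assume "v = ?fst (cond_cdf t)"
        then show ?thesis using compose[OF cond_cdf_measurable, of t] by simp
      next
        assume "v \<in> ?fst ` ?W"
        then obtain v' where "v' \<in> ?W" "v = ?fst v'" by blast
        then show ?thesis using compose[OF ridge_steps_props(1)[OF n], of v'] by simp
      qed
    qed simp
    show "?fst (cond_cdf t) \<in> borel_measurable P" by (rule compose) measurable
    show "v \<in> borel_measurable P" "v p \<in> {0..1}" if "v \<in> ?fst ` ?W" for v p
    proof -
      obtain v' where v': "v' \<in> ?W" "v = ?fst v'" using \<open>v \<in> ?fst ` ?W\<close> by blast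
      show "v \<in> borel_measurable P" "v p \<in> {0..1}"
        using compose[OF ridge_steps_props(1)[OF n v'(1)]] ridge_steps_props(2)[OF n v'(1)] by (simp_all add: v'(2))
    qed
  qed (use prob_P n A finite_ridge_steps cond_cdf_range excess_self excess_lipschitz in auto)
  moreover have img: "insert (\<lambda>p. cond_cdf t (fst p)) (?fst ` ?W) = ?fst ` insert (cond_cdf t) ?W" by simp
  ultimately show ?thesis unfolding offset_sup_def img image_image by simp
qed

text \<open>By \<open>ridge_shift_integral_le\<close> with the shift \<open>2 / n\<close>, under the domination of the law of \<open>X\<close>; the
additional \<open>2 / n\<close> comes from rounding the values.\<close>

lemma bracket_mass_le:
  assumes law: "\<And>g. g \<in> borel_measurable borel \<Longrightarrow>
      (\<integral>\<^sup>+x. g x \<partial>distr P borel fst) \<le> ennreal C * (\<integral>\<^sup>+x\<in>cball 0 r. g x \<partial>lborel)"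
    and C: "0 \<le> C" and r: "0 \<le> r" and n: "4 \<le> n"
    and G: "antimono G" "\<And>t. G t \<in> {0..1}" and a: "1 / 2 \<le> norm a"
    and LU: "integrable P (\<lambda>p. U (fst p) - L (fst p))"
      "AE p in P. U (fst p) - L (fst p) \<le> G (a \<bullet> fst p - 2 / real n) - G (a \<bullet> fst p + 2 / real n) + 2 / real n"
  shows "(\<integral>p. U (fst p) - L (fst p) \<partial>P)
    \<le> (4 * C * (unit_ball_vol (real CARD('d)) * ((r + 1) ^ CARD('d) - r ^ CARD('d))) + 2) / real n"
proof -
  let ?D = "\<lambda>x. G (a \<bullet> x - 2 / real n) - G (a \<bullet> x + 2 / real n)"
  define K where "K = unit_ball_vol (real CARD('d)) * ((r + 1) ^ CARD('d) - r ^ CARD('d))"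
  have K: "0 \<le> K" using r by (auto simp: K_def intro!: mult_nonneg_nonneg power_mono)
  have [measurable]: "G \<in> borel_measurable borel" by (rule borel_measurable_antimono[OF G(1)])
  have D_m[measurable]: "?D \<in> borel_measurable borel" by measurable
  have D_mP: "(\<lambda>p. ?D (fst p)) \<in> borel_measurable P" by (rule measurable_compose[OF fst_P D_m])
  have D0: "0 \<le> ?D x" for x using antimonoD[OF G(1), of "a \<bullet> x - 2 / real n" "a \<bullet> x + 2 / real n"] by simp
  have D1: "\<bar>?D x\<bar> \<le> 1" for x
    using G(2)[of "a \<bullet> x - 2 / real n"] G(2)[of "a \<bullet> x + 2 / real n"] by (auto simp: abs_le_iff)
  have D_int: "integrable P (\<lambda>p. ?D (fst p))" by (rule integrable_P[OF D_mP]) (rule D1)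
  have "ennreal (\<integral>p. ?D (fst p) \<partial>P) = (\<integral>\<^sup>+p. ennreal (?D (fst p)) \<partial>P)"
    by (rule nn_integral_eq_integral[symmetric, OF D_int]) (use D0 in auto)
  also have "\<dots> = (\<integral>\<^sup>+x. ennreal (?D x) \<partial>distr P borel fst)"
    by (rule nn_integral_distr[symmetric]) measurable
  also have "\<dots> \<le> ennreal C * (\<integral>\<^sup>+x\<in>cball 0 r. ennreal (?D x) \<partial>lborel)"
    by (rule law) measurable
  also have "\<dots> \<le> ennreal C * ennreal (2 * (2 / real n) * K)"
  proof (rule mult_left_mono)
    have s: "0 \<le> 2 / real n" "2 * (2 / real n) \<le> 1" using n by (auto simp: field_simps)
    show "(\<integral>\<^sup>+x\<in>cball 0 r. ennreal (?D x) \<partial>lborel) \<le> ennreal (2 * (2 / real n) * K)"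
      using ridge_shift_integral_le[OF G a s r] unfolding K_def
      by (simp only: DIM_cart DIM_real mult_1_right)
  qed simp
  also have "\<dots> = ennreal (C * (2 * (2 / real n) * K))" by (rule ennreal_mult[symmetric]) (use C K in auto)
  finally have "(\<integral>p. ?D (fst p) \<partial>P) \<le> C * (2 * (2 / real n) * K)"
    using C K by (subst (asm) ennreal_le_iff) auto
  moreover have "(\<integral>p. U (fst p) - L (fst p) \<partial>P) \<le> (\<integral>p. ?D (fst p) + 2 / real n \<partial>P)"
    using LU D_int by (intro integral_mono_AE) auto
  moreover have "(\<integral>p. ?D (fst p) + 2 / real n \<partial>P) = (\<integral>p. ?D (fst p) \<partial>P) + 2 / real n"
    using D_int by (simp add: prob_space)
  ultimately show ?thesis unfolding K_def[symmetric] by (simp add: add_divide_distrib mult_ac)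
qed

section \<open>The convergence rate\<close>

text \<open>The inequality at one threshold is integrated over \<open>t\<close>. The empirical terms \<open>A t\<close> integrate to the
difference of the losses of the estimate and of the truth, which is nonpositive because the truth
belongs to the class over which the estimate minimizes.\<close>

lemma L2_error_le:
  fixes S :: "(real ^ 'd) set" and x :: "nat \<Rightarrow> real ^ 'd" and y :: "nat \<Rightarrow> real"
  assumes law: "\<And>g. g \<in> borel_measurable borel \<Longrightarrow>
      (\<integral>\<^sup>+x. g x \<partial>distr P borel fst) \<le> ennreal C * (\<integral>\<^sup>+x\<in>cball 0 (real r). g x \<partial>lborel)"
    and C: "0 \<le> C" and r: "0 < r" and S: "S \<subseteq> cball 0 (real r)" and S_P: "AE p in P. fst p \<in> S"
    and Q: "finite_measure Q" "sets Q = sets borel"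
    and truth: "(F0, \<alpha>0) \<in> index_class S" "\<And>t x. x \<in> S \<Longrightarrow> cond_cdf t x = F0 (\<alpha>0 \<bullet> x) t"
    and n: "4 \<le> n" and sample: "\<And>i. i < n \<Longrightarrow> x i \<in> S"
    and est: "is_index_estimate Q S n x y F \<alpha>"
  defines "W \<equiv> ridge_steps (dir_grid (r * CARD('d) * n)) (2 * r * n) n"
    and "K \<equiv> 4 * C * (unit_ball_vol (real CARD('d)) * ((real r + 1) ^ CARD('d) - real r ^ CARD('d))) + 2"
  shows "(L2_error P S Q F \<alpha> F0 \<alpha>0)\<^sup>2 \<le>
    4 * (\<integral>t. offset_sup False t W n (\<lambda>i. (x i, y i)) + offset_sup True t W n (\<lambda>i. (x i, y i)) \<partial>Q)
    + 12 * K * measure Q UNIV / real n"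
proof -
  interpret Q: finite_measure Q by (rule Q(1))
  have n0: "0 < n" using n by simp
  have space_Q: "space Q = UNIV" using sets_eq_imp_space_eq[OF Q(2)] by simp
  let ?z = "\<lambda>i. (x i, y i)"
  have W: "finite W" "\<And>v. v \<in> W \<Longrightarrow> v \<in> borel_measurable borel" "\<And>v x. v \<in> W \<Longrightarrow> v x \<in> {0..1}"
    unfolding W_def
    by (rule finite_ridge_steps[OF finite_dir_grid], erule ridge_steps_props(1)[OF n0],
        erule ridge_steps_props(2)[OF n0])
  have in_class: "(F, \<alpha>) \<in> index_class S" and optimal: "index_loss Q n x y F \<alpha> \<le> index_loss Q n x y F0 \<alpha>0"
    and F: "F \<in> antitone_cdfs UNIV"
    using est truth(1) by (auto simp: is_index_estimate_def)
  have \<alpha>: "norm \<alpha> = 1" using in_class by (simp add: index_class_def)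
  have F_cdf: "is_cdf (F s)" and F_anti: "antimono (\<lambda>s. F s t)" for s t
    using F by (auto simp: antitone_cdfs_def)
  have F01: "F s t \<in> {0..1}" for s t by (rule is_cdf_props(2)[OF F_cdf])
  have F0_cdf: "is_cdf (F0 (\<alpha>0 \<bullet> x i))" if "i < n" for i
    using truth(1) sample[OF that] by (auto simp: index_class_def antitone_cdfs_def)
  define V where "V t = offset_sup False t W n ?z + offset_sup True t W n ?z" for t
  define A where "A t = (\<Sum>i<n. (of_bool (y i \<le> t) - F (\<alpha> \<bullet> x i) t)\<^sup>2
      - (of_bool (y i \<le> t) - F0 (\<alpha>0 \<bullet> x i) t)\<^sup>2) / real n" for t
  obtain a where a: "a \<in> dir_grid (r * CARD('d) * n)" "norm (\<alpha> - a) \<le> real CARD('d) / real (r * CARD('d) * n)"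
    using dir_grid_approx[OF _ \<alpha>, of "r * CARD('d) * n"] r n0 by (metis nat_0_less_mult_iff zero_less_card_finite)
  then have a_close: "norm (\<alpha> - a) \<le> 1 / real (r * n)" by simp
  have "1 / real (r * n) \<le> 1 / 2"
  proof -
    have "1 * 4 \<le> r * n" using n r by (intro mult_le_mono) auto
    then have "real (1 * 4) \<le> real (r * n)" by (rule of_nat_mono)
    then have "2 \<le> real (r * n)" by linarith
    then show ?thesis by (intro divide_left_mono) auto
  qed
  then have a_norm: "1 / 2 \<le> norm a"
    using a_close norm_triangle_ineq2[of \<alpha> "\<alpha> - a"] \<alpha> by simp
  have pointwise: "(\<integral>p. (F (\<alpha> \<bullet> fst p) t - cond_cdf t (fst p))\<^sup>2 \<partial>P) \<le> 4 * V t + 12 * (K / real n) + 4 * A t" for t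
  proof -
    let ?G = "\<lambda>s. F s t"
    obtain L U where LU: "L \<in> W" "U \<in> W"
      and br: "\<And>x. norm x \<le> real r \<Longrightarrow> L x \<le> ?G (\<alpha> \<bullet> x) \<and> ?G (\<alpha> \<bullet> x) \<le> U x \<and>
        U x - L x \<le> ?G (a \<bullet> x - 2 / real n) - ?G (a \<bullet> x + 2 / real n) + 2 / real n"
      using ridge_bracket[OF n0 r F_anti F01 \<alpha> a(1) a_close, of t] unfolding W_def by blast
    have S_r: "norm x \<le> real r" if "x \<in> S" for x using S that by auto
    have f_m: "(\<lambda>x. ?G (\<alpha> \<bullet> x)) \<in> borel_measurable borel"
      using borel_measurable_antimono[OF F_anti, of t] by measurable
    have "(\<integral>p. (?G (\<alpha> \<bullet> fst p) - cond_cdf t (fst p))\<^sup>2 \<partial>P)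
      \<le> 4 * (offset_sup False t W n ?z + offset_sup True t W n ?z)
        + 12 * (\<integral>p. U (fst p) - L (fst p) \<partial>P)
        + 4 * ((\<Sum>i<n. (of_bool (snd (?z i) \<le> t) - ?G (\<alpha> \<bullet> fst (?z i)))\<^sup>2
            - (of_bool (snd (?z i) \<le> t) - cond_cdf t (fst (?z i)))\<^sup>2) / real n)"
    proof (rule squeezed_error_le[where f = "\<lambda>x. ?G (\<alpha> \<bullet> x)", OF n0 W(1) LU W(2)[OF LU(1)] W(2)[OF LU(2)] f_m W(3)[OF LU(1)] W(3)[OF LU(2)] F01])
      show "AE p in P. L (fst p) \<le> ?G (\<alpha> \<bullet> fst p) \<and> ?G (\<alpha> \<bullet> fst p) \<le> U (fst p)"
        using S_P by eventually_elim (use br S_r in blast)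
      show "L (fst (?z i)) \<le> ?G (\<alpha> \<bullet> fst (?z i)) \<and> ?G (\<alpha> \<bullet> fst (?z i)) \<le> U (fst (?z i))" if "i < n" for i
        using br[OF S_r[OF sample[OF that]]] by simp
    qed
    moreover have "(\<integral>p. U (fst p) - L (fst p) \<partial>P) \<le> K / real n"
      unfolding K_def
    proof (rule bracket_mass_le[OF law C _ n F_anti F01 a_norm])
      have [measurable]: "(\<lambda>p. U (fst p)) \<in> borel_measurable P" "(\<lambda>p. L (fst p)) \<in> borel_measurable P"
        by (rule measurable_compose[OF fst_P W(2)], rule LU)+
      show "integrable P (\<lambda>p. U (fst p) - L (fst p))"
      proof (rule integrable_P[where B = 1])
        show "\<bar>U (fst p) - L (fst p)\<bar> \<le> 1" for p :: "(real ^ 'd) \<times> real"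
          using W(3)[OF LU(1), of "fst p"] W(3)[OF LU(2), of "fst p"] by (auto simp: abs_le_iff)
      qed measurable
      show "AE p in P. U (fst p) - L (fst p)
          \<le> ?G (a \<bullet> fst p - 2 / real n) - ?G (a \<bullet> fst p + 2 / real n) + 2 / real n"
        using S_P by eventually_elim (use br S_r in blast)
    qed simp_all
    moreover have "(\<Sum>i<n. (of_bool (snd (?z i) \<le> t) - ?G (\<alpha> \<bullet> fst (?z i)))\<^sup>2
            - (of_bool (snd (?z i) \<le> t) - cond_cdf t (fst (?z i)))\<^sup>2) / real n = A t"
      unfolding A_def using truth(2)[OF sample] by simp
    ultimately show ?thesis unfolding V_def by linarith
  qed
  have meas_Q: "f \<in> borel_measurable Q \<longleftrightarrow> f \<in> borel_measurable borel" for f :: "real \<Rightarrow> real"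
    by (rule arg_cong[OF measurable_cong_sets[OF Q(2) refl]])
  have V_int: "integrable Q V"
  proof (rule Q.integrable_const_bound[where B = 10])
    have "(\<lambda>t. offset_sup b t W n ?z) \<in> borel_measurable borel" for b
      using offset_sup_measurable[OF W(1,2), where T = "\<lambda>t. t" and N = borel and Z = "\<lambda>i _. ?z i"] by simp
    then show "V \<in> borel_measurable Q" unfolding V_def[abs_def] meas_Q by measurable
    have bdd: "\<bar>offset_sup b t W n ?z\<bar> \<le> 5" for b t
      by (rule offset_sup_bounded) (rule W(1) n0 | erule W(2) | erule W(3))+
    have "\<bar>V t\<bar> \<le> 5 + 5" for t
      unfolding V_def by (rule order_trans[OF abs_triangle_ineq add_mono[OF bdd bdd]])
    then show "AE t in Q. norm (V t) \<le> 10" by simp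
  qed
  have sq_int: "integrable Q (\<lambda>t. (of_bool (y i \<le> t) - G t)\<^sup>2)" if "is_cdf G" for G i
  proof (rule Q.integrable_const_bound[where B = 1])
    show "AE t in Q. norm ((of_bool (y i \<le> t) - G t)\<^sup>2) \<le> 1"
    proof (intro AE_I2)
      fix t
      have "\<bar>of_bool (y i \<le> t) - G t\<bar> \<le> 1" using is_cdf_props(2)[OF that, of t] by (auto simp: abs_le_iff)
      then show "norm ((of_bool (y i \<le> t) - G t)\<^sup>2) \<le> 1" by (simp add: abs_square_le_1)
    qed
    show "(\<lambda>t. (of_bool (y i \<le> t) - G t)\<^sup>2) \<in> borel_measurable Q"
      unfolding meas_Q using is_cdf_props(1)[OF that] by measurable
  qed
  have term_int: "integrable Q (\<lambda>t. (of_bool (y i \<le> t) - F (\<alpha> \<bullet> x i) t)\<^sup>2)"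
    "integrable Q (\<lambda>t. (of_bool (y i \<le> t) - F0 (\<alpha>0 \<bullet> x i) t)\<^sup>2)" if "i < n" for i
    using sq_int[OF F_cdf] sq_int[OF F0_cdf[OF that]] by auto
  have A_int: "integrable Q A"
    unfolding A_def[abs_def] using term_int
    by (intro Bochner_Integration.integrable_divide Bochner_Integration.integrable_sum
        Bochner_Integration.integrable_diff) auto
  have "(\<integral>t. A t \<partial>Q) = index_loss Q n x y F \<alpha> - index_loss Q n x y F0 \<alpha>0"
  proof -
    define u where "u i t = (of_bool (y i \<le> t) - F (\<alpha> \<bullet> x i) t)\<^sup>2" for i t
    define w where "w i t = (of_bool (y i \<le> t) - F0 (\<alpha>0 \<bullet> x i) t)\<^sup>2" for i t
    have uw: "integrable Q (u i)" "integrable Q (w i)" if "i < n" for i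
      using term_int[OF that] by (simp_all add: u_def[abs_def] w_def[abs_def])
    have swap: "(\<integral>t. (\<Sum>i<n. u i t - w i t) \<partial>Q) = (\<Sum>i<n. (\<integral>t. u i t \<partial>Q) - (\<integral>t. w i t \<partial>Q))"
      using uw by (subst Bochner_Integration.integral_sum) auto
    show ?thesis
      unfolding A_def index_loss_def u_def[symmetric] w_def[symmetric] integral_divide_zero swap
      by (simp add: sum_subtractf diff_divide_distrib)
  qed
  then have A_le: "(\<integral>t. A t \<partial>Q) \<le> 0" using optimal by simp
  define R where "R t = 4 * V t + 12 * (K / real n) + 4 * A t" for t
  have R_int: "integrable Q R"
    unfolding R_def[abs_def] using V_int A_int by simp
  have R_nonneg: "0 \<le> R t" for t
    unfolding R_def by (rule order_trans[OF _ pointwise]) simp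
  have "(\<integral>\<^sup>+t. (\<integral>\<^sup>+x\<in>S. ennreal ((F (\<alpha> \<bullet> x) t - F0 (\<alpha>0 \<bullet> x) t)\<^sup>2) \<partial>distr P borel fst) \<partial>Q)
      \<le> (\<integral>\<^sup>+t. ennreal (R t) \<partial>Q)"
  proof (rule nn_integral_mono)
    fix t
    have [measurable]: "(\<lambda>s. F s t) \<in> borel_measurable borel" by (rule borel_measurable_antimono[OF F_anti])
    have m: "(\<lambda>x. (F (\<alpha> \<bullet> x) t - cond_cdf t x)\<^sup>2) \<in> borel_measurable borel" by measurable
    have "(\<integral>\<^sup>+x\<in>S. ennreal ((F (\<alpha> \<bullet> x) t - F0 (\<alpha>0 \<bullet> x) t)\<^sup>2) \<partial>distr P borel fst)
        \<le> (\<integral>\<^sup>+x. ennreal ((F (\<alpha> \<bullet> x) t - cond_cdf t x)\<^sup>2) \<partial>distr P borel fst)"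
      using truth(2) by (intro nn_integral_mono) (auto simp: indicator_def)
    also have "\<dots> = (\<integral>\<^sup>+p. ennreal ((F (\<alpha> \<bullet> fst p) t - cond_cdf t (fst p))\<^sup>2) \<partial>P)"
      using m by (subst nn_integral_distr) auto
    also have "\<dots> = ennreal (\<integral>p. (F (\<alpha> \<bullet> fst p) t - cond_cdf t (fst p))\<^sup>2 \<partial>P)"
    proof (rule nn_integral_eq_integral[OF integrable_P[where B = 1]])
      show "(\<lambda>p. (F (\<alpha> \<bullet> fst p) t - cond_cdf t (fst p))\<^sup>2) \<in> borel_measurable P"
        by (rule measurable_compose[OF fst_P m])
      show "\<bar>(F (\<alpha> \<bullet> fst p) t - cond_cdf t (fst p))\<^sup>2\<bar> \<le> 1" for p :: "(real ^ 'd) \<times> real"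
        using F01[of "\<alpha> \<bullet> fst p" t] cond_cdf_range[of t "fst p"] by (auto simp: abs_square_le_1 abs_le_iff)
    qed simp
    also have "\<dots> \<le> ennreal (R t)" unfolding R_def by (rule ennreal_leI[OF pointwise])
    finally show "(\<integral>\<^sup>+x\<in>S. ennreal ((F (\<alpha> \<bullet> x) t - F0 (\<alpha>0 \<bullet> x) t)\<^sup>2) \<partial>distr P borel fst) \<le> ennreal (R t)" .
  qed
  also have "\<dots> = ennreal (\<integral>t. R t \<partial>Q)"
    by (rule nn_integral_eq_integral[OF R_int]) (use R_nonneg in simp)
  finally have "(L2_error P S Q F \<alpha> F0 \<alpha>0)\<^sup>2 \<le> (\<integral>t. R t \<partial>Q)"
    unfolding L2_error_def using R_nonneg by (simp add: enn2real_leI integral_nonneg_AE)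
  also have "(\<integral>t. R t \<partial>Q) = 4 * (\<integral>t. V t \<partial>Q) + 12 * K * measure Q UNIV / real n + 4 * (\<integral>t. A t \<partial>Q)"
    unfolding R_def[abs_def] using V_int A_int by (simp add: space_Q mult_ac)
  also have "\<dots> \<le> 4 * (\<integral>t. V t \<partial>Q) + 12 * K * measure Q UNIV / real n" using A_le by simp
  finally show ?thesis by (simp add: V_def)
qed

lemma expected_integrated_offset_le:
  fixes X :: "nat \<Rightarrow> 'w \<Rightarrow> real ^ 'd" and Y :: "nat \<Rightarrow> 'w \<Rightarrow> real" and k :: nat
  assumes M: "prob_space M"
    and indep: "prob_space.indep_vars M (\<lambda>_. borel) (\<lambda>i \<omega>. (X i \<omega>, Y i \<omega>)) UNIV"
    and law: "\<And>i. distr M borel (\<lambda>\<omega>. (X i \<omega>, Y i \<omega>)) = P"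
    and Q: "finite_measure Q" "sets Q = sets borel"
    and n: "0 < n" and A: "finite A" "real (card A) \<le> exp (c * real n powr (1/3))" "0 \<le> c"
  defines "H \<equiv> \<lambda>\<omega>. \<integral>t. offset_sup False t (ridge_steps A k n) n (\<lambda>i. (X i \<omega>, Y i \<omega>))
      + offset_sup True t (ridge_steps A k n) n (\<lambda>i. (X i \<omega>, Y i \<omega>)) \<partial>Q"
  shows "integrable M H" "(\<integral>\<omega>. H \<omega> \<partial>M) \<le> 2 * (308 * c + 2536) * measure Q UNIV * real n powr (- 2/3)"
proof -
  interpret M: prob_space M by (rule M)
  interpret Q: finite_measure Q by (rule Q(1))
  interpret QM: pair_sigma_finite Q M ..
  interpret QM': finite_measure "Q \<Otimes>\<^sub>M M" by (rule finite_measure_pair_measure) unfold_locales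
  have space_Q: "space Q = UNIV" using sets_eq_imp_space_eq[OF Q(2)] by simp
  let ?W = "ridge_steps A k n"
  have W: "finite ?W" "\<And>v. v \<in> ?W \<Longrightarrow> v \<in> borel_measurable borel" "\<And>v x. v \<in> ?W \<Longrightarrow> v x \<in> {0..1}"
    by (rule finite_ridge_steps[OF A(1)], erule ridge_steps_props(1)[OF n], erule ridge_steps_props(2)[OF n])
  let ?Z = "\<lambda>i \<omega>. (X i \<omega>, Y i \<omega>)"
  have Z: "?Z i \<in> M \<rightarrow>\<^sub>M borel" for i
    using indep by (auto simp: M.indep_vars_def)
  define V where "V b t \<omega> = offset_sup b t ?W n (\<lambda>i. ?Z i \<omega>)" for b t \<omega>
  have V_bdd: "\<bar>V b t \<omega>\<bar> \<le> 5" for b t \<omega> unfolding V_def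
    by (rule offset_sup_bounded) (rule W(1) n | erule W(2) | erule W(3))+
  have fst_Q: "fst \<in> borel_measurable (Q \<Otimes>\<^sub>M M)"
    using measurable_fst[of Q M] unfolding measurable_cong_sets[OF refl Q(2)] .
  have V_m: "(\<lambda>(t, \<omega>). V b t \<omega>) \<in> borel_measurable (Q \<Otimes>\<^sub>M M)" for b
    unfolding V_def case_prod_beta'
    by (rule offset_sup_measurable[OF W(1,2) fst_Q measurable_compose[OF measurable_snd Z]])
  have V_int: "integrable (Q \<Otimes>\<^sub>M M) (\<lambda>(t, \<omega>). V b t \<omega>)" for b
    by (rule QM'.integrable_const_bound[where B = 5]) (use V_bdd V_m in auto)
  then have VV_int: "integrable (Q \<Otimes>\<^sub>M M) (\<lambda>(t, \<omega>). V False t \<omega> + V True t \<omega>)"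
    using Bochner_Integration.integrable_add[OF V_int[of False] V_int[of True]] by (simp add: case_prod_beta')
  have H: "H = (\<lambda>\<omega>. \<integral>t. V False t \<omega> + V True t \<omega> \<partial>Q)" by (simp add: H_def V_def)
  show "integrable M H"
    unfolding H by (rule QM.integrable_snd[OF VV_int])
  have EV: "(\<integral>\<omega>. V b t \<omega> \<partial>M) \<le> (308 * c + 2536) * real n powr (- 2/3)" for b t
  proof -
    have "M.indep_vars (\<lambda>_. borel) ?Z {..<n}" by (rule M.indep_vars_subset[OF indep]) simp
    then have "distr M (PiM {..<n} (\<lambda>_. borel)) (\<lambda>\<omega>. \<lambda>i\<in>{..<n}. ?Z i \<omega>) = PiM {..<n} (\<lambda>i. distr M borel (?Z i))"
      using n Z by (subst (asm) M.indep_vars_iff_distr_eq_PiM') auto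
    then have d: "distr M (PiM {..<n} (\<lambda>_. borel)) (\<lambda>\<omega>. \<lambda>i\<in>{..<n}. ?Z i \<omega>) = PiM {..<n} (\<lambda>_. P)"
      by (simp add: law)
    have m: "(\<lambda>\<omega>. \<lambda>i\<in>{..<n}. ?Z i \<omega>) \<in> M \<rightarrow>\<^sub>M PiM {..<n} (\<lambda>_. borel)"
      using Z by (intro measurable_restrict)
    have o: "(\<lambda>z. offset_sup b t ?W n z) \<in> borel_measurable (PiM {..<n} (\<lambda>_. borel))"
      using offset_sup_measurable[OF W(1,2), where T = "\<lambda>_. t" and N = "PiM {..<n} (\<lambda>_. borel)" and Z = "\<lambda>i z. z i" and n = n and b = b]
      by simp
    have "(\<integral>\<omega>. V b t \<omega> \<partial>M) = (\<integral>\<omega>. offset_sup b t ?W n (\<lambda>i\<in>{..<n}. ?Z i \<omega>) \<partial>M)"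
      unfolding V_def offset_sup_def by simp
    also have "\<dots> = (\<integral>z. offset_sup b t ?W n z \<partial>PiM {..<n} (\<lambda>_. P))"
      using integral_distr[OF m o] unfolding d by simp
    also have "\<dots> \<le> (308 * c + 2536) * real n powr (- 2/3)"
      by (rule expected_offset_sup_le[OF n A])
    finally show ?thesis .
  qed
  have V_sec: "integrable M (\<lambda>\<omega>. V b t \<omega>)" for b t
  proof (rule M.integrable_const_bound[where B = 5])
    show "(\<lambda>\<omega>. V b t \<omega>) \<in> borel_measurable M"
      using measurable_compose[OF measurable_Pair1'[of t Q M] V_m[of b]] by (simp add: space_Q)
  qed (use V_bdd in auto)
  have "(\<integral>\<omega>. H \<omega> \<partial>M) = (\<integral>t. (\<integral>\<omega>. V False t \<omega> + V True t \<omega> \<partial>M) \<partial>Q)"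
    unfolding H by (rule QM.Fubini_integral[OF VV_int])
  also have "\<dots> \<le> (\<integral>t. 2 * (308 * c + 2536) * real n powr (- 2/3) \<partial>Q)"
  proof (rule integral_mono)
    show "integrable Q (\<lambda>t. \<integral>\<omega>. V False t \<omega> + V True t \<omega> \<partial>M)"
      by (rule QM.integrable_fst[OF VV_int])
    show "(\<integral>\<omega>. V False t \<omega> + V True t \<omega> \<partial>M) \<le> 2 * (308 * c + 2536) * real n powr (- 2/3)" for t
    proof -
      have "(\<integral>\<omega>. V False t \<omega> + V True t \<omega> \<partial>M) = (\<integral>\<omega>. V False t \<omega> \<partial>M) + (\<integral>\<omega>. V True t \<omega> \<partial>M)"
        by (rule Bochner_Integration.integral_add[OF V_sec V_sec])
      also have "\<dots> \<le> (308 * c + 2536) * real n powr (- 2/3) + (308 * c + 2536) * real n powr (- 2/3)"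
        by (rule add_mono[OF EV EV])
      finally show ?thesis by (simp add: algebra_simps)
    qed
  qed simp
  also have "\<dots> = 2 * (308 * c + 2536) * measure Q UNIV * real n powr (- 2/3)"
    by (simp add: space_Q)
  finally show "(\<integral>\<omega>. H \<omega> \<partial>M) \<le> 2 * (308 * c + 2536) * measure Q UNIV * real n powr (- 2/3)" .
qed

end

theorem theorem1:
  fixes M :: "'w measure"
    and X :: "nat \<Rightarrow> 'w \<Rightarrow> real ^ 'd"
    and Y :: "nat \<Rightarrow> 'w \<Rightarrow> real"
    and P :: "((real ^ 'd) \<times> real) measure"
    and S :: "(real ^ 'd) set"
    and Q :: "real measure"
    and F0 :: "real \<Rightarrow> real \<Rightarrow> real"
    and \<alpha>0 :: "real ^ 'd"
    and Fhat :: "nat \<Rightarrow> 'w \<Rightarrow> real \<Rightarrow> real \<Rightarrow> real"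
    and \<alpha>hat :: "nat \<Rightarrow> 'w \<Rightarrow> real ^ 'd"
  assumes "prob_space M"
    and iid_indep: "prob_space.indep_vars M (\<lambda>_. borel) (\<lambda>i \<omega>. (X i \<omega>, Y i \<omega>)) UNIV"
    and iid_law: "\<And>i. distr M borel (\<lambda>\<omega>. (X i \<omega>, Y i \<omega>)) = P"
    and range_X: "AE p in P. fst p \<in> S"
    and "bounded S" and "convex S"
    and "finite_measure Q" and "sets Q = sets borel"
    and truth_in_class: "(F0, \<alpha>0) \<in> index_class S"
    and model: "\<exists>\<kappa>. is_cond_distr P snd fst \<kappa> \<and>
                  (\<forall>x\<in>S. \<forall>y. measure (\<kappa> x) {..y} = F0 (\<alpha>0 \<bullet> x) y)"
    and estimator: "\<And>n. n \<ge> 1 \<Longrightarrow> AE \<omega> in M.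
                  is_index_estimate Q S n (\<lambda>i. X i \<omega>) (\<lambda>i. Y i \<omega>) (Fhat n \<omega>) (\<alpha>hat n \<omega>)"
    and "discrete_weight_condition P S Q \<or> continuous_weight_condition P S Q"
  shows "bigO_in_prob M
           (\<lambda>n \<omega>. L2_error P S Q (Fhat n \<omega>) (\<alpha>hat n \<omega>) F0 \<alpha>0)
           (\<lambda>n. real n powr (- 1 / 3))"
proof -
  interpret M: prob_space M by fact
  have Z: "(\<lambda>\<omega>. (X i \<omega>, Y i \<omega>)) \<in> M \<rightarrow>\<^sub>M borel" for i
    using iid_indep by (auto simp: M.indep_vars_def)
  have P: "prob_space P" "sets P = sets borel"
    using M.prob_space_distr[OF Z[of 0]] iid_law[of 0] by (auto simp: iid_law[symmetric])
  obtain \<kappa> where \<kappa>: "is_cond_distr P snd fst \<kappa>"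
    "\<And>x y. x \<in> S \<Longrightarrow> measure (\<kappa> x) {..y} = F0 (\<alpha>0 \<bullet> x) y"
    using model by blast
  interpret conditional_cdf P \<kappa> by (rule conditional_cdf.intro[OF P \<kappa>(1)])
  obtain C r where Cr: "0 \<le> C" "S \<subseteq> cball 0 (real r)" "0 < r" and
    law: "\<forall>g\<in>borel_measurable borel.
      (\<integral>\<^sup>+x. g x \<partial>distr P borel fst) \<le> ennreal C * (\<integral>\<^sup>+x\<in>cball 0 (real r). g x \<partial>lborel)"
    using covariate_law_le[OF P \<open>convex S\<close> \<open>bounded S\<close> range_X assms(12)] by (elim exE conjE)
  define D where "D = CARD('d)"
  define A where "A n = (dir_grid (r * D * n) :: (real ^ 'd) set)" for n
  define c where "c = real (D * (3 * r * D + 3))"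
  define q where "q = measure Q UNIV"
  define K where "K = 4 * C * (unit_ball_vol (real CARD('d)) * ((real r + 1) ^ CARD('d) - real r ^ CARD('d))) + 2"
  define B where "B = 2 * (308 * c + 2536) * q"
  define H where "H n \<omega> = (\<integral>t. offset_sup False t (ridge_steps (A n) (2 * r * n) n) n (\<lambda>i. (X i \<omega>, Y i \<omega>))
      + offset_sup True t (ridge_steps (A n) (2 * r * n) n) n (\<lambda>i. (X i \<omega>, Y i \<omega>)) \<partial>Q)" for n \<omega>
  have A: "finite (A n)" "0 < n \<Longrightarrow> real (card (A n)) \<le> exp (c * real n powr (1/3))" for n
    unfolding A_def c_def D_def using finite_dir_grid dir_grid_exponential_bound[OF _ Cr(3)] by auto
  have c: "0 \<le> c" and q: "0 \<le> q" by (simp_all add: c_def q_def)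
  have B: "0 \<le> B" using c q by (simp add: B_def)
  have K: "0 \<le> K" using Cr(1) by (auto simp: K_def intro!: mult_nonneg_nonneg add_nonneg_nonneg power_mono)
  have H_int: "integrable M (H n)" and H_mean: "(\<integral>\<omega>. H n \<omega> \<partial>M) \<le> B * real n powr (- 2/3)" if "0 < n" for n
    using expected_integrated_offset_le[OF \<open>prob_space M\<close> iid_indep iid_law assms(7,8) that A(1) A(2)[OF that] c]
    unfolding H_def[abs_def] B_def q_def by auto
  have H_nonneg: "0 \<le> H n \<omega>" for n \<omega>
    unfolding H_def by (intro integral_nonneg_AE AE_I2 add_nonneg_nonneg offset_sup_nonneg finite_ridge_steps A)
  have error: "AE \<omega> in M. (L2_error P S Q (Fhat n \<omega>) (\<alpha>hat n \<omega>) F0 \<alpha>0)\<^sup>2 \<le> 4 * H n \<omega> + 12 * K * q / real n"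
    if n: "4 \<le> n" for n
  proof -
    have "AE \<omega> in M. X i \<omega> \<in> S" for i
    proof -
      have "AE p in distr M borel (\<lambda>\<omega>. (X i \<omega>, Y i \<omega>)). fst p \<in> S"
        unfolding iid_law by (rule range_X)
      from AE_distrD[OF Z this] show ?thesis by simp
    qed
    then have "AE \<omega> in M. \<forall>i. X i \<omega> \<in> S" by (simp add: AE_all_countable)
    moreover have "AE \<omega> in M. is_index_estimate Q S n (\<lambda>i. X i \<omega>) (\<lambda>i. Y i \<omega>) (Fhat n \<omega>) (\<alpha>hat n \<omega>)"
      using n by (intro estimator) simp
    ultimately show ?thesis
    proof eventually_elim
      case (elim \<omega>)
      show ?case
        unfolding H_def K_def q_def A_def D_def
        by (rule L2_error_le[OF law[rule_format] Cr(1,3,2) range_X assms(7,8) truth_in_class _ n _ elim(2)])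
          (use elim(1) \<kappa>(2) in \<open>auto simp: cond_cdf_def\<close>)
    qed
  qed
  show ?thesis
    unfolding bigO_in_prob_def
  proof (intro allI impI)
    fix \<epsilon> :: real assume \<epsilon>: "0 < \<epsilon>"
    \<comment> \<open>With level \<open>a\<close> Markov's inequality leaves \<open>B / a \<le> \<epsilon>\<close>; the summand \<open>1\<close> keeps \<open>a\<close> positive if \<open>B = 0\<close>.\<close>
    define a where "a = B / \<epsilon> + 1"
    have a: "0 < a" using B \<epsilon> by (simp add: a_def add_nonneg_pos)
    \<comment> \<open>Outside the exceptional set, \<open>L2_error_le\<close> bounds the squared error by \<open>k\<^sup>2 * n powr (- 2/3)\<close>.\<close>
    define k where "k = sqrt (4 * a + 12 * K * q)"
    have k2: "k\<^sup>2 = 4 * a + 12 * K * q" using a K q by (simp add: k_def)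
    have k: "0 < k" using a K q by (simp add: k_def add_pos_nonneg)
    have "\<exists>E\<in>sets M. measure M E \<le> \<epsilon> \<and>
        {\<omega> \<in> space M. k * real n powr (- 1 / 3) < \<bar>L2_error P S Q (Fhat n \<omega>) (\<alpha>hat n \<omega>) F0 \<alpha>0\<bar>} \<subseteq> E"
      if n: "4 \<le> n" for n
    proof -
      let ?L = "\<lambda>\<omega>. L2_error P S Q (Fhat n \<omega>) (\<alpha>hat n \<omega>) F0 \<alpha>0"
      let ?s = "real n powr (- 2/3)"
      have n0: "0 < n" and s: "0 < ?s" using n by auto
      obtain N where N: "N \<in> null_sets M"
        "{\<omega> \<in> space M. \<not> (?L \<omega>)\<^sup>2 \<le> 4 * H n \<omega> + 12 * K * q / real n} \<subseteq> N"
        using error[OF n] by (auto simp: eventually_ae_filter)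
      define E where "E = {\<omega> \<in> space M. a * ?s \<le> H n \<omega>}"
      have E_m: "E \<in> sets M" unfolding E_def using H_int[OF n0] by measurable
      have "measure M E \<le> (\<integral>\<omega>. H n \<omega> \<partial>M) / (a * ?s)"
        unfolding E_def using a s H_nonneg
        by (intro integral_Markov_inequality_measure[OF H_int[OF n0], of "space M"]) auto
      also have "\<dots> \<le> B * ?s / (a * ?s)"
        using H_mean[OF n0] a s by (intro divide_right_mono) auto
      also have "\<dots> = B / a" using s by simp
      also have "\<dots> \<le> \<epsilon>" using a \<epsilon> by (simp add: a_def field_simps)
      finally have E_le: "measure M E \<le> \<epsilon>" .
      have "{\<omega> \<in> space M. k * real n powr (- 1 / 3) < \<bar>?L \<omega>\<bar>} \<subseteq> E \<union> N"
      proof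
        fix \<omega> assume "\<omega> \<in> {\<omega> \<in> space M. k * real n powr (- 1 / 3) < \<bar>?L \<omega>\<bar>}"
        then have \<omega>: "\<omega> \<in> space M" "k * real n powr (- 1 / 3) < \<bar>?L \<omega>\<bar>" by auto
        show "\<omega> \<in> E \<union> N"
        proof (rule ccontr)
          assume "\<omega> \<notin> E \<union> N"
          then have h: "H n \<omega> < a * ?s" "(?L \<omega>)\<^sup>2 \<le> 4 * H n \<omega> + 12 * K * q / real n"
            using \<omega>(1) N(2) by (auto simp: E_def)
          have "(real n powr (- 1 / 3))\<^sup>2 = ?s" using n0 by (simp add: powr_power)
          then have "k\<^sup>2 * ?s = (k * real n powr (- 1 / 3))\<^sup>2" by (simp add: power_mult_distrib)
          also have "\<dots> < \<bar>?L \<omega>\<bar>\<^sup>2" using \<omega>(2) k by (intro power_strict_mono) auto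
          also have "\<dots> \<le> 4 * H n \<omega> + 12 * K * q / real n" using h(2) by simp
          also have "12 * K * q / real n = 12 * K * q * real n powr (- 1)"
            using n0 by (simp add: powr_minus_divide)
          also have "\<dots> \<le> 12 * K * q * ?s"
            using n0 K q by (intro mult_left_mono powr_mono) auto
          also have "4 * H n \<omega> + 12 * K * q * ?s < k\<^sup>2 * ?s"
            using h(1) unfolding k2 by (simp add: distrib_right)
          finally show False by simp
        qed
      qed
      moreover have "measure M (E \<union> N) \<le> \<epsilon>"
        using E_le E_m N(1) measure_Un_null_set[OF E_m N(1)] by simp
      ultimately show ?thesis using E_m N(1) by (intro bexI[of _ "E \<union> N"]) auto
    qed
    then show "\<exists>K>0. \<forall>\<^sub>F n in sequentially. \<exists>E\<in>sets M. measure M E \<le> \<epsilon> \<and>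
        {\<omega> \<in> space M. K * real n powr (- 1 / 3) < \<bar>L2_error P S Q (Fhat n \<omega>) (\<alpha>hat n \<omega>) F0 \<alpha>0\<bar>} \<subseteq> E"
      using k by (intro exI[of _ k] conjI eventually_sequentiallyI[of 4]) auto
  qed
qed

end
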